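(* (i) Problem $\mathrm{VI}_{h,\sigma}$ admits a unique solution $u_h\in V_{nh,\sigma}$. Furthermore, it satisfies $$a(u_h,u_h)+j_h(u_{h\tau})=(f,u_h)_{L^2(\Omega)^2}.$$ (ii) Problems $\mathrm{VI}_{h,\sigma}$, $\mathrm{VI}_h$ and $\mathrm{VE}_h$ are equivalent in the following sense. (a) If $u_h\in V_{nh,\sigma}$ is a solution of Problem $\mathrm{VI}_{h,\sigma}$, then there exists a unique $p_h\in\mathring Q_h$ such that $(u_h,p_h)$ solves Problem $\mathrm{VI}_h$. (b) If $(u_h,p_h)\in V_{nh}\times\mathring Q_h$ is a solution of Problem $\mathrm{VI}_h$, then there exists a unique $\lambda_h\in\tilde\Lambda_h$ such that $(u_h,p_h,\lambda_h)$ solves Problem $\mathrm{VE}_h$. (c) If $(u_h,p_h,\lambda_h)\in V_{nh}\times\mathring Q_h\times\tilde\Lambda_h$ is a solution of Problem $\mathrm{VE}_h$, then $u_h$ solves Problem $\mathrm{VI}_{h,\sigma}$.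
   Context: Geometry. $\Omega\subset\mathbf R^2$ is a bounded polygonal domain with boundary $\Gamma=\partial\Omega=\overline\Gamma_0\cup\overline\Gamma_1$, where $\Gamma_0,\Gamma_1$ are disjoint nonempty relatively open subsets of $\Gamma$ and $\overline\Gamma_1$ is exactly one whole side of the polygon, with endpoints $M_1,M_{m+1}$. On $\Gamma_1$, $n=(n_1,n_2)$ is the (constant) outer unit normal and $\tau=(n_2,-n_1)$; for a vector field $v$, $v_n=v\cdot n$, $v_\tau=v\cdot\tau$ on $\Gamma_1$ (and $v_{hn}$, $v_{h\tau}$ for $v_h$). Data. $\nu>0$, $f\in L^2(\Omega)^2$, $g\in C^0(\overline\Gamma_1)$ with $g>0$ on $\Gamma_1$. Mesh. $\{\mathscr T_h\}_h$ is a family of triangulations of $\overline\Omega$, $h$ being the length of the greatest side, such that: two distinct triangles meet in a side, a node or $\emptyset$; the triangles cover $\overline\Omega$ and the boundary vertices belong to $\Gamma$; for some constants $K,K'>0$ independent of $h$ each triangle contains a circle of radius $Kh$ and is contained in a circle of radius $K'h$; each triangle has at least one vertex not on $\Gamma$. $\Sigma_h$ is the set of all vertices and all midpoints of sides of triangles. $\Gamma_{0,h}=\overline\Gamma_0\cap\Sigma_h$, $\overline\Gamma_1\cap\Sigma_h=\{M_1,M_{3/2},M_2,\dots,M_m,M_{m+1/2},M_{m+1}\}$, where $M_1,M_2,\dots,M_{m+1}$ are the vertices on $\overline\Gamma_1$ in order along $\overline\Gamma_1$ ($m$ depends on $h$) and $M_{i+1/2}$ is the midpoint of the side $e_i=[M_i,M_{i+1}]$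 of length $|e_i|$; $\mathring\Gamma_{1,h}=\Gamma_1\cap\Sigma_h$. Spaces ($\mathscr P_k$ = polynomials of degree $\le k$). $V_h=\{v_h\in C^0(\overline\Omega)^2: v_h|_T\in\mathscr P_2(T)^2\ \forall T\in\mathscr T_h\}$, $Q_h=\{q_h\in C^0(\overline\Omega): q_h|_T\in\mathscr P_1(T)\ \forall T\in\mathscr T_h\}$, $\mathring Q_h=\{q_h\in Q_h:\int_\Omega q_h\,dx=0\}$, $V_{nh}=\{v_h\in V_h: v_h(M)=0\ \forall M\in\Gamma_{0,h},\ v_{hn}(M)=0\ \forall M\in\mathring\Gamma_{1,h}\}$, $V_{nh,\sigma}=\{v_h\in V_{nh}: b(v_h,q_h)=0\ \forall q_h\in\mathring Q_h\}$. $\Lambda_h=\{\mu_h\in C^0(\overline\Gamma_1):\mu_h|_{e_i}\in\mathscr P_2(e_i)\ (1\le i\le m),\ \mu_h(M_1)=\mu_h(M_{m+1})=0\}$, $\tilde\Lambda_h=\{\mu_h\in\Lambda_h:|\mu_h(M)|\le1\ \forall M\in\mathring\Gamma_{1,h}\}$. Forms. $a(u,v)=2\nu\sum_{i,j=1}^2\int_\Omega e_{ij}(u)e_{ij}(v)\,dx$ with $e_{ij}(u)=\frac12(\partial u_i/\partial x_j+\partial u_j/\partial x_i)$; $b(v,q)=-\int_\Omega(\mathrm{div}\,v)q\,dx$. With $g_i=g(M_i)$, $\lambda_{h,i}=\lambda_h(M_i)$, etc. (also for half-integer indices), $$(\lambda_h,\mu_h)_{\Lambda_h}=\frac16\sum_{i=1}^m|e_i|\big(g_i\lambda_{h,i}\mu_{h,i}+4g_{i+\frac12}\lambda_{h,i+\frac12}\mu_{h,i+\frac12}+g_{i+1}\lambda_{h,i+1}\mu_{h,i+1}\big),$$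 $$j_h(\eta_h)=\frac16\sum_{i=1}^m|e_i|\big(g_i|\eta_{h,i}|+4g_{i+\frac12}|\eta_{h,i+\frac12}|+g_{i+1}|\eta_{h,i+1}|\big)\quad(\lambda_h,\mu_h,\eta_h\in\Lambda_h).$$ Problem $\mathrm{VI}_h$: find $(u_h,p_h)\in V_{nh}\times\mathring Q_h$ with $a(u_h,v_h-u_h)+b(v_h-u_h,p_h)+j_h(v_{h\tau})-j_h(u_{h\tau})\ge(f,v_h-u_h)_{L^2(\Omega)^2}$ for all $v_h\in V_{nh}$ and $b(u_h,q_h)=0$ for all $q_h\in\mathring Q_h$. Problem $\mathrm{VI}_{h,\sigma}$: find $u_h\in V_{nh,\sigma}$ with $a(u_h,v_h-u_h)+j_h(v_{h\tau})-j_h(u_{h\tau})\ge(f,v_h-u_h)_{L^2(\Omega)^2}$ for all $v_h\in V_{nh,\sigma}$. Problem $\mathrm{VE}_h$: find $(u_h,p_h,\lambda_h)\in V_{nh}\times\mathring Q_h\times\tilde\Lambda_h$ with $a(u_h,v_h)+b(v_h,p_h)+(v_{h\tau},\lambda_h)_{\Lambda_h}=(f,v_h)_{L^2(\Omega)^2}$ for all $v_h\in V_{nh}$, $b(u_h,q_h)=0$ for all $q_h\in\mathring Q_h$, and $(u_{h\tau},\mu_h-\lambda_h)_{\Lambda_h}\le0$ for all $\mu_h\in\tilde\Lambda_h$. *)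

theory Defs
  imports "HOL-Analysis.Analysis"
begin

type_synonym plane = "real^2"

section \<open>Polygonal domains\<close>

definition polygon_side :: "plane list \<Rightarrow> nat \<Rightarrow> plane set" where
  "polygon_side vs i = closed_segment (vs ! i) (vs ! (Suc i mod length vs))"

definition polygon_curve :: "plane list \<Rightarrow> plane set" where
  "polygon_curve vs = (\<Union>i<length vs. polygon_side vs i)"

text \<open>
  Two sides meet exactly in the vertices they share, and there are no straight angles, so
  that each \<open>polygon_side\<close> is a whole geometric side.
\<close>

definition simple_polygon :: "plane list \<Rightarrow> bool" where
  "simple_polygon vs \<longleftrightarrow>
     3 \<le> length vs \<and> distinct vs \<and>
     (\<forall>i<length vs. \<forall>j<length vs. i \<noteq> j \<longrightarrow>
        polygon_side vs i \<inter> polygon_side vs j =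
          {vs ! i, vs ! (Suc i mod length vs)} \<inter> {vs ! j, vs ! (Suc j mod length vs)}) \<and>
     (\<forall>i<length vs. \<not> collinear
        {vs ! i, vs ! (Suc i mod length vs), vs ! (Suc (Suc i) mod length vs)})"

text \<open>
  The boundary consists of finitely many pairwise disjoint simple closed polygons: one for a
  simply connected domain, more if there are holes.  As the domain is connected and every such
  polygon lies in its boundary, the domain is locally on one side of its boundary (no slits).
\<close>

definition polygonal_domain :: "plane set \<Rightarrow> plane list set \<Rightarrow> bool" where
  "polygonal_domain \<Omega> P \<longleftrightarrow>
     open \<Omega> \<and> connected \<Omega> \<and> \<Omega> \<noteq> {} \<and> bounded \<Omega> \<and>
     finite P \<and> (\<forall>vs\<in>P. simple_polygon vs) \<and>
     pairwise (\<lambda>vs ws. disjnt (polygon_curve vs) (polygon_curve ws)) P \<and>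
     frontier \<Omega> = (\<Union>vs\<in>P. polygon_curve vs)"

definition outer_unit_normal :: "plane set \<Rightarrow> plane set \<Rightarrow> plane \<Rightarrow> bool" where
  "outer_unit_normal \<Omega> \<Gamma>1 n \<longleftrightarrow>
     norm n = 1 \<and>
     (\<forall>x\<in>\<Gamma>1. \<forall>y\<in>\<Gamma>1. n \<bullet> (y - x) = 0) \<and>
     (\<forall>x\<in>\<Gamma>1. \<forall>\<^sub>F t in at_right 0. x - t *\<^sub>R n \<in> \<Omega> \<and> x + t *\<^sub>R n \<notin> closure \<Omega>)"

definition tangent :: "plane \<Rightarrow> plane" where
  "tangent n = vector [n $ 2, - n $ 1]"


section \<open>Triangulations\<close>

definition mesh_vertices :: "plane set set \<Rightarrow> plane set" where
  "mesh_vertices \<T> = {x. \<exists>T\<in>\<T>. x extreme_point_of T}"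

definition mesh_sides :: "plane set set \<Rightarrow> plane set set" where
  "mesh_sides \<T> = {e. \<exists>T\<in>\<T>. e edge_of T}"

definition mesh_nodes :: "plane set set \<Rightarrow> plane set" where
  "mesh_nodes \<T> =
     mesh_vertices \<T> \<union> {midpoint a b |a b. closed_segment a b \<in> mesh_sides \<T>}"

definition mesh_size :: "plane set set \<Rightarrow> real" where
  "mesh_size \<T> = Max {dist a b |a b. closed_segment a b \<in> mesh_sides \<T>}"

text \<open>
  The library predicate \<open>triangulation\<close> says that the intersection of two members is a face of
  each; for two distinct triangles this means a common side, a common vertex, or the empty set.
\<close>

definition mesh_of :: "plane set \<Rightarrow> plane set set \<Rightarrow> bool" where
  "mesh_of \<Omega> \<T> \<longleftrightarrow>
     triangulation \<T> \<and> (\<forall>T\<in>\<T>. 2 simplex T) \<and>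
     \<Union>\<T> = closure \<Omega> \<and>
     mesh_vertices \<T> \<inter> frontier (\<Union>\<T>) \<subseteq> frontier \<Omega> \<and>
     (\<forall>T\<in>\<T>. \<exists>x. x extreme_point_of T \<and> x \<notin> frontier \<Omega>)"

definition regular_mesh_family ::
    "plane set \<Rightarrow> real \<Rightarrow> real \<Rightarrow> real set \<Rightarrow> (real \<Rightarrow> plane set set) \<Rightarrow> bool" where
  "regular_mesh_family \<Omega> K K' H \<T> \<longleftrightarrow>
     0 < K \<and> 0 < K' \<and>
     (\<forall>h\<in>H. mesh_of \<Omega> (\<T> h) \<and> h = mesh_size (\<T> h) \<and>
        (\<forall>T\<in>\<T> h. (\<exists>c. cball c (K * h) \<subseteq> T) \<and> (\<exists>c. T \<subseteq> cball c (K' * h))))"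

text \<open>\<open>M 1, \<dots>, M (m + 1)\<close> are the mesh vertices on \<open>[A, B]\<close>, listed from \<open>A\<close> to \<open>B\<close>.\<close>

definition side_vertices ::
    "plane set set \<Rightarrow> plane \<Rightarrow> plane \<Rightarrow> nat \<Rightarrow> (nat \<Rightarrow> plane) \<Rightarrow> bool" where
  "side_vertices \<T> A B m M \<longleftrightarrow>
     M ` {1..Suc m} = mesh_vertices \<T> \<inter> closed_segment A B \<and>
     M 1 = A \<and> M (Suc m) = B \<and>
     (\<forall>i\<in>{1..Suc m}. \<forall>j\<in>{1..Suc m}. i < j \<longrightarrow> dist A (M i) < dist A (M j))"

text \<open>The midpoint of the side \<open>e\<^sub>i = [M\<^sub>i, M\<^sub>i\<^sub>+\<^sub>1]\<close>, i.e. the node with index \<open>i + 1/2\<close>.\<close>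

definition half_node :: "(nat \<Rightarrow> plane) \<Rightarrow> nat \<Rightarrow> plane" where
  "half_node M i = midpoint (M i) (M (Suc i))"


section \<open>Finite element spaces\<close>

definition poly_le :: "nat \<Rightarrow> (plane \<Rightarrow> real) set" where
  "poly_le k = {p. \<exists>c :: nat \<Rightarrow> nat \<Rightarrow> real. \<forall>x.
     p x = (\<Sum>i\<le>k. \<Sum>j\<le>k - i. c i j * (x $ 1) ^ i * (x $ 2) ^ j)}"

text \<open>
  Restriction to \<open>S\<close> belongs to \<open>P\<^sub>k(S)\<close>.  On a segment this is the same as being a polynomial
  of degree at most \<open>k\<close> in arc length.
\<close>

definition poly_on :: "nat \<Rightarrow> plane set \<Rightarrow> (plane \<Rightarrow> real) \<Rightarrow> bool" where
  "poly_on k S v \<longleftrightarrow> (\<exists>p\<in>poly_le k. \<forall>x\<in>S. v x = p x)"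

text \<open>
  Functions on \<open>closure \<Omega>\<close> (respectively on \<open>closure \<Gamma>1\<close>) are represented by total functions
  that vanish outside this set.  So equality of functions is equality on the set, and the
  spaces are closed under pointwise linear combinations.
\<close>

definition V_h :: "plane set \<Rightarrow> plane set set \<Rightarrow> (plane \<Rightarrow> plane) set" where
  "V_h \<Omega> \<T> = {v. continuous_on (closure \<Omega>) v \<and> (\<forall>x. x \<notin> closure \<Omega> \<longrightarrow> v x = 0) \<and>
     (\<forall>T\<in>\<T>. \<forall>i. poly_on 2 T (\<lambda>x. v x $ i))}"

definition Q_h :: "plane set \<Rightarrow> plane set set \<Rightarrow> (plane \<Rightarrow> real) set" where
  "Q_h \<Omega> \<T> = {q. continuous_on (closure \<Omega>) q \<and> (\<forall>x. x \<notin> closure \<Omega> \<longrightarrow> q x = 0) \<and>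
     (\<forall>T\<in>\<T>. poly_on 1 T q)}"

definition Q0_h :: "plane set \<Rightarrow> plane set set \<Rightarrow> (plane \<Rightarrow> real) set" where
  "Q0_h \<Omega> \<T> = {q \<in> Q_h \<Omega> \<T>. (\<integral>x. q x \<partial>lebesgue_on \<Omega>) = 0}"

definition V_nh ::
    "plane set \<Rightarrow> plane set \<Rightarrow> plane set \<Rightarrow> plane \<Rightarrow> plane set set \<Rightarrow> (plane \<Rightarrow> plane) set" where
  "V_nh \<Omega> \<Gamma>0 \<Gamma>1 n \<T> = {v \<in> V_h \<Omega> \<T>.
     (\<forall>x \<in> closure \<Gamma>0 \<inter> mesh_nodes \<T>. v x = 0) \<and>
     (\<forall>x \<in> \<Gamma>1 \<inter> mesh_nodes \<T>. v x \<bullet> n = 0)}"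

definition Lambda_h ::
    "plane set \<Rightarrow> nat \<Rightarrow> (nat \<Rightarrow> plane) \<Rightarrow> (plane \<Rightarrow> real) set" where
  "Lambda_h \<Gamma>1 m M = {\<mu>. continuous_on (closure \<Gamma>1) \<mu> \<and>
     (\<forall>x. x \<notin> closure \<Gamma>1 \<longrightarrow> \<mu> x = 0) \<and>
     (\<forall>i\<in>{1..m}. poly_on 2 (closed_segment (M i) (M (Suc i))) \<mu>) \<and>
     \<mu> (M 1) = 0 \<and> \<mu> (M (Suc m)) = 0}"

definition Lambda_tilde_h ::
    "plane set \<Rightarrow> plane set set \<Rightarrow> nat \<Rightarrow> (nat \<Rightarrow> plane) \<Rightarrow> (plane \<Rightarrow> real) set" where
  "Lambda_tilde_h \<Gamma>1 \<T> m M =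
     {\<mu> \<in> Lambda_h \<Gamma>1 m M. \<forall>x \<in> \<Gamma>1 \<inter> mesh_nodes \<T>. \<bar>\<mu> x\<bar> \<le> 1}"

definition tang_comp :: "plane set \<Rightarrow> plane \<Rightarrow> (plane \<Rightarrow> plane) \<Rightarrow> plane \<Rightarrow> real" where
  "tang_comp \<Gamma>1 n v = (\<lambda>x. if x \<in> closure \<Gamma>1 then v x \<bullet> tangent n else 0)"


section \<open>Forms\<close>

definition in_L2 :: "plane set \<Rightarrow> (plane \<Rightarrow> plane) \<Rightarrow> bool" where
  "in_L2 \<Omega> f \<longleftrightarrow>
     f \<in> borel_measurable (lebesgue_on \<Omega>) \<and> integrable (lebesgue_on \<Omega>) (\<lambda>x. (norm (f x))\<^sup>2)"

definition L2_inner :: "plane set \<Rightarrow> (plane \<Rightarrow> plane) \<Rightarrow> (plane \<Rightarrow> plane) \<Rightarrow> real" where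
  "L2_inner \<Omega> f v = (\<integral>x. f x \<bullet> v x \<partial>lebesgue_on \<Omega>)"

text \<open>
  The derivative of component \<open>i\<close> in direction \<open>j\<close>.  For continuous piecewise polynomials it
  exists in the interior of every triangle, i.e. almost everywhere, where it is also the weak
  derivative; the unspecified value of \<open>deriv\<close> elsewhere does not affect the integrals below.
\<close>

definition partial_deriv :: "2 \<Rightarrow> 2 \<Rightarrow> (plane \<Rightarrow> plane) \<Rightarrow> plane \<Rightarrow> real" where
  "partial_deriv i j v x = deriv (\<lambda>t. v (x + t *\<^sub>R axis j 1) $ i) 0"

definition strain :: "2 \<Rightarrow> 2 \<Rightarrow> (plane \<Rightarrow> plane) \<Rightarrow> plane \<Rightarrow> real" where
  "strain i j v x = (partial_deriv i j v x + partial_deriv j i v x) / 2"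

definition divergence :: "(plane \<Rightarrow> plane) \<Rightarrow> plane \<Rightarrow> real" where
  "divergence v x = (\<Sum>i\<in>UNIV. partial_deriv i i v x)"

definition a_form :: "real \<Rightarrow> plane set \<Rightarrow> (plane \<Rightarrow> plane) \<Rightarrow> (plane \<Rightarrow> plane) \<Rightarrow> real" where
  "a_form \<nu> \<Omega> u v =
     2 * \<nu> * (\<Sum>i\<in>UNIV. \<Sum>j\<in>UNIV. \<integral>x. strain i j u x * strain i j v x \<partial>lebesgue_on \<Omega>)"

definition b_form :: "plane set \<Rightarrow> (plane \<Rightarrow> plane) \<Rightarrow> (plane \<Rightarrow> real) \<Rightarrow> real" where
  "b_form \<Omega> v q = - (\<integral>x. divergence v x * q x \<partial>lebesgue_on \<Omega>)"

definition Lambda_inner ::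
    "(plane \<Rightarrow> real) \<Rightarrow> nat \<Rightarrow> (nat \<Rightarrow> plane) \<Rightarrow> (plane \<Rightarrow> real) \<Rightarrow> (plane \<Rightarrow> real) \<Rightarrow> real" where
  "Lambda_inner g m M l \<mu> = 1 / 6 * (\<Sum>i = 1..m. dist (M i) (M (Suc i)) *
     (g (M i) * l (M i) * \<mu> (M i)
      + 4 * g (half_node M i) * l (half_node M i) * \<mu> (half_node M i)
      + g (M (Suc i)) * l (M (Suc i)) * \<mu> (M (Suc i))))"

definition j_h :: "(plane \<Rightarrow> real) \<Rightarrow> nat \<Rightarrow> (nat \<Rightarrow> plane) \<Rightarrow> (plane \<Rightarrow> real) \<Rightarrow> real" where
  "j_h g m M \<eta> = 1 / 6 * (\<Sum>i = 1..m. dist (M i) (M (Suc i)) *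
     (g (M i) * \<bar>\<eta> (M i)\<bar>
      + 4 * g (half_node M i) * \<bar>\<eta> (half_node M i)\<bar>
      + g (M (Suc i)) * \<bar>\<eta> (M (Suc i))\<bar>))"

definition V_nh_sigma ::
    "plane set \<Rightarrow> plane set \<Rightarrow> plane set \<Rightarrow> plane \<Rightarrow> plane set set \<Rightarrow> (plane \<Rightarrow> plane) set" where
  "V_nh_sigma \<Omega> \<Gamma>0 \<Gamma>1 n \<T> =
     {v \<in> V_nh \<Omega> \<Gamma>0 \<Gamma>1 n \<T>. \<forall>q \<in> Q0_h \<Omega> \<T>. b_form \<Omega> v q = 0}"


section \<open>The discrete problems\<close>

definition solves_VI_sigma where
  "solves_VI_sigma \<Omega> \<Gamma>0 \<Gamma>1 n \<nu> f g \<T> m M u \<longleftrightarrow>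
     u \<in> V_nh_sigma \<Omega> \<Gamma>0 \<Gamma>1 n \<T> \<and>
     (\<forall>v \<in> V_nh_sigma \<Omega> \<Gamma>0 \<Gamma>1 n \<T>.
        a_form \<nu> \<Omega> u (\<lambda>x. v x - u x)
        + j_h g m M (tang_comp \<Gamma>1 n v) - j_h g m M (tang_comp \<Gamma>1 n u)
        \<ge> L2_inner \<Omega> f (\<lambda>x. v x - u x))"

definition solves_VI where
  "solves_VI \<Omega> \<Gamma>0 \<Gamma>1 n \<nu> f g \<T> m M u p \<longleftrightarrow>
     u \<in> V_nh \<Omega> \<Gamma>0 \<Gamma>1 n \<T> \<and> p \<in> Q0_h \<Omega> \<T> \<and>
     (\<forall>v \<in> V_nh \<Omega> \<Gamma>0 \<Gamma>1 n \<T>.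
        a_form \<nu> \<Omega> u (\<lambda>x. v x - u x) + b_form \<Omega> (\<lambda>x. v x - u x) p
        + j_h g m M (tang_comp \<Gamma>1 n v) - j_h g m M (tang_comp \<Gamma>1 n u)
        \<ge> L2_inner \<Omega> f (\<lambda>x. v x - u x)) \<and>
     (\<forall>q \<in> Q0_h \<Omega> \<T>. b_form \<Omega> u q = 0)"

definition solves_VE where
  "solves_VE \<Omega> \<Gamma>0 \<Gamma>1 n \<nu> f g \<T> m M u p l \<longleftrightarrow>
     u \<in> V_nh \<Omega> \<Gamma>0 \<Gamma>1 n \<T> \<and> p \<in> Q0_h \<Omega> \<T> \<and> l \<in> Lambda_tilde_h \<Gamma>1 \<T> m M \<and>
     (\<forall>v \<in> V_nh \<Omega> \<Gamma>0 \<Gamma>1 n \<T>.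
        a_form \<nu> \<Omega> u v + b_form \<Omega> v p + Lambda_inner g m M (tang_comp \<Gamma>1 n v) l
        = L2_inner \<Omega> f v) \<and>
     (\<forall>q \<in> Q0_h \<Omega> \<T>. b_form \<Omega> u q = 0) \<and>
     (\<forall>\<mu> \<in> Lambda_tilde_h \<Gamma>1 \<T> m M.
        Lambda_inner g m M (tang_comp \<Gamma>1 n u) (\<lambda>x. \<mu> x - l x) \<le> 0)"

end

theory Submission
  imports Defs "HOL-Library.Function_Algebras"
begin

text \<open>
  All spaces are finite-dimensional, and the equivalences are linear algebra once three facts about
  the mesh are known.  Definiteness of \<open>a\<close>: a function in \<open>V_h\<close> without strain is a rigid motion on
  every triangle; the motions agree throughout the mesh, and a rigid motion vanishing at both ends of
  the slip side is zero.  Inf-sup condition: for an interior vertex \<open>z\<close> and a neighbour \<open>w\<close>, the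
  divergence of \<open>hat z * hat w * (w - z)\<close> is \<open>hat z - hat w\<close> on each triangle with both corners and
  zero on the others, and its integral against a pressure \<open>q\<close> is a positive multiple of \<open>q z - q w\<close>; as every
  triangle has an interior vertex, a pressure orthogonal to these divergences is constant.  Traces:
  the slip side is a union of mesh sides, so tangential nodal values there can be prescribed freely.

  The velocity minimises the energy among divergence-free functions.  Testing with functions that
  vanish at the slip nodes gives an equation whose Lagrange multiplier is the pressure.  The residual
  of this equation on all of \<open>V_nh\<close> is bounded by the friction functional, hence depends only on the
  tangential nodal values, and its coefficients are the multiplier on the slip side.
\<close>

section \<open>Variational inequalities on finite-dimensional subspaces\<close>

text \<open>The inf-sup condition is needed already for velocities without slip values. Correcting a
  test function by such a velocity changes its divergence functional but not its friction, and this
  turns the inequality on the divergence-free space into one on \<open>V_nh\<close>. The bubbles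
  qualify because they vanish on the whole boundary. Two geometric facts have to be extracted from
  the hypotheses. The mesh covers the closure of the domain, and a slit would make its interior
  larger than \<open>\<Omega>\<close>; Jordan separation excludes this, and only then do hat
  functions of vertices in \<open>\<Omega>\<close> vanish on the frontier. Moreover both ends of the
  slip side lie in \<open>closure \<Gamma>0\<close>, which follows from the neighbouring polygon
  sides. This gives two Dirichlet points for definiteness and removes the end terms of the
  quadrature, where \<open>g\<close> may vanish, so that all remaining weights are positive. The
  direction \<open>w - z\<close> of the bubble is dictated by barycentric coordinates: along it they
  have slopes -1 and 1, so the divergence is antisymmetric under exchange of \<open>z\<close> and
  \<open>w\<close> and detects only \<open>q z - q w\<close>, whatever the value at the third
  corner.\<close>

instantiation "fun" :: (type, real_vector) real_vector
begin

definition scaleR_fun :: "real \<Rightarrow> ('a \<Rightarrow> 'b) \<Rightarrow> 'a \<Rightarrow> 'b" where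
  "scaleR_fun c f = (\<lambda>x. c *\<^sub>R f x)"

instance
  by standard (auto simp: scaleR_fun_def fun_eq_iff algebra_simps)

end

lemma scaleR_fun_apply [simp]: "(c *\<^sub>R f) x = c *\<^sub>R f x"
  by (simp add: scaleR_fun_def)

text \<open>Linearity is demanded on \<open>W\<close> only: Bochner integrals and
  \<open>deriv\<close> take default values where they are undefined, so the forms are linear on
  finite element functions but need not be so on arbitrary ones.\<close>

definition linear_form :: "'a::real_vector set \<Rightarrow> ('a \<Rightarrow> real) \<Rightarrow> bool" where
  "linear_form W f \<longleftrightarrow>
     (\<forall>x\<in>W. \<forall>y\<in>W. f (x + y) = f x + f y) \<and> (\<forall>c. \<forall>x\<in>W. f (c *\<^sub>R x) = c * f x)"

text \<open>Definiteness is relative to \<open>W\<close> as well: the strain form degenerates on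
  rigid motions and becomes definite through the boundary conditions.\<close>

definition inner_product_on :: "'a::real_vector set \<Rightarrow> ('a \<Rightarrow> 'a \<Rightarrow> real) \<Rightarrow> bool" where
  "inner_product_on W s \<longleftrightarrow>
     (\<forall>x\<in>W. linear_form W (s x)) \<and> (\<forall>x\<in>W. \<forall>y\<in>W. s x y = s y x) \<and>
     (\<forall>x\<in>W. x \<noteq> 0 \<longrightarrow> 0 < s x x)"

lemma linear_form_add: "linear_form W f \<Longrightarrow> x \<in> W \<Longrightarrow> y \<in> W \<Longrightarrow> f (x + y) = f x + f y"
  and linear_form_scaleR: "linear_form W f \<Longrightarrow> x \<in> W \<Longrightarrow> f (c *\<^sub>R x) = c * f x"
  by (auto simp: linear_form_def)

lemma linear_form_0: "linear_form W f \<Longrightarrow> x \<in> W \<Longrightarrow> f 0 = 0"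
  using linear_form_scaleR[of W f x 0] by simp

lemma linear_form_diff:
  assumes "linear_form W f" "subspace W" "x \<in> W" "y \<in> W"
  shows "f (x - y) = f x - f y"
proof -
  have "f (x + (-1) *\<^sub>R y) = f x + (-1) * f y"
    using assms linear_form_add[of W f x "(-1) *\<^sub>R y"] linear_form_scaleR[of W f y "-1"]
    by (simp add: subspace_neg)
  then show ?thesis by simp
qed

lemma linear_form_sum:
  assumes f: "linear_form W f" and W: "subspace W" and g: "\<And>i. i \<in> I \<Longrightarrow> g i \<in> W"
  shows "f (\<Sum>i\<in>I. c i *\<^sub>R g i) = (\<Sum>i\<in>I. c i * f (g i))"
proof (cases "finite I")
  case True
  then show ?thesis
    using g
  proof (induction I)
    case empty
    then show ?case using linear_form_0[OF f] W by (auto simp: subspace_def)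
  next
    case (insert i I)
    have "(\<Sum>i\<in>I. c i *\<^sub>R g i) \<in> W"
      using insert W by (intro subspace_sum subspace_scale) auto
    then show ?case
      using insert W f by (simp add: linear_form_add linear_form_scaleR subspace_scale)
  qed
next
  case False
  then show ?thesis using linear_form_0[OF f] W by (auto simp: subspace_def)
qed

lemma linear_form_subset: "linear_form W f \<Longrightarrow> U \<subseteq> W \<Longrightarrow> linear_form U f"
  unfolding linear_form_def by blast

lemma inner_product_on_subset: "inner_product_on W s \<Longrightarrow> U \<subseteq> W \<Longrightarrow> inner_product_on U s"
  unfolding inner_product_on_def by (meson linear_form_subset subsetD)

lemma subspace_kernel:
  assumes V: "subspace V" and \<phi>: "\<And>i. i \<in> I \<Longrightarrow> linear_form V (\<phi> i)"
  shows "subspace {v \<in> V. \<forall>i\<in>I. \<phi> i v = 0}"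
  by (rule subspaceI)
    (use V in \<open>auto simp: subspace_0 subspace_add subspace_scale linear_form_0[OF \<phi> subspace_0[OF V]]
      linear_form_add[OF \<phi>] linear_form_scaleR[OF \<phi>]\<close>)

text \<open>Finite dimension is encoded as containment in a finite span; this passes at once to
  smaller subspaces, and the spanning vectors may lie outside \<open>W\<close>.\<close>

locale inner_subspace =
  fixes W :: "'a::real_vector set" and s :: "'a \<Rightarrow> 'a \<Rightarrow> real"
  assumes W: "subspace W" and finite_dim: "\<exists>B. finite B \<and> W \<subseteq> span B"
    and s: "inner_product_on W s"
begin

lemma mem [simp]: "0 \<in> W" "x \<in> W \<Longrightarrow> y \<in> W \<Longrightarrow> x + y \<in> W" "x \<in> W \<Longrightarrow> y \<in> W \<Longrightarrow> x - y \<in> W"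
  "x \<in> W \<Longrightarrow> c *\<^sub>R x \<in> W"
  using W by (auto simp: subspace_0 subspace_add subspace_diff subspace_scale)

lemma mem_sum: "E \<subseteq> W \<Longrightarrow> (\<Sum>e\<in>E. c e *\<^sub>R e) \<in> W"
  using W by (intro subspace_sum) auto

lemma linear_right: "x \<in> W \<Longrightarrow> linear_form W (s x)"
  using s by (simp add: inner_product_on_def)

lemma sym: "x \<in> W \<Longrightarrow> y \<in> W \<Longrightarrow> s x y = s y x"
  using s by (simp add: inner_product_on_def)

lemma linear_left: "x \<in> W \<Longrightarrow> linear_form W (\<lambda>y. s y x)"
  using linear_right[of x] unfolding linear_form_def by (simp add: sym[of _ x])

lemma bilinear [simp]:
  assumes "x \<in> W" "y \<in> W"
  shows "s x (c *\<^sub>R y) = c * s x y" "s (c *\<^sub>R x) y = c * s x y"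
    "z \<in> W \<Longrightarrow> s x (y + z) = s x y + s x z" "z \<in> W \<Longrightarrow> s x (y - z) = s x y - s x z"
    "z \<in> W \<Longrightarrow> s (x + y) z = s x z + s y z" "z \<in> W \<Longrightarrow> s (x - y) z = s x z - s y z"
  using assms linear_form_add[OF linear_right] linear_form_diff[OF linear_right W]
    linear_form_scaleR[OF linear_right] linear_form_add[OF linear_left]
    linear_form_diff[OF linear_left W] linear_form_scaleR[OF linear_left] by auto

lemma sum_right: "x \<in> W \<Longrightarrow> E \<subseteq> W \<Longrightarrow> s x (\<Sum>e\<in>E. c e *\<^sub>R e) = (\<Sum>e\<in>E. c e * s x e)"
  by (intro linear_form_sum[OF linear_right W]) auto

lemma pos: "x \<in> W \<Longrightarrow> x \<noteq> 0 \<Longrightarrow> 0 < s x x"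
  using s by (simp add: inner_product_on_def)

lemma nonneg: "x \<in> W \<Longrightarrow> 0 \<le> s x x"
  using pos[of x] linear_form_0[OF linear_right[of x], of x] by (cases "x = 0") auto

definition orthonormal :: "'a set \<Rightarrow> bool" where
  "orthonormal E \<longleftrightarrow> finite E \<and> E \<subseteq> W \<and> (\<forall>d\<in>E. \<forall>e\<in>E. s d e = (if d = e then 1 else 0))"

lemma orthonormal_sum:
  assumes E: "orthonormal E" and d: "d \<in> E"
  shows "s d (\<Sum>e\<in>E. c e *\<^sub>R e) = c d"
proof -
  have "s d (\<Sum>e\<in>E. c e *\<^sub>R e) = (\<Sum>e\<in>E. c e * s d e)"
    using E d by (intro sum_right) (auto simp: orthonormal_def)
  also have "\<dots> = (\<Sum>e\<in>E. if d = e then c e else 0)"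
    using E d by (intro sum.cong) (auto simp: orthonormal_def)
  finally show ?thesis using E d by (simp add: orthonormal_def)
qed

text \<open>Orthonormal sets are independent, so \<open>card B\<close> bounds their size and a
  largest one exists; a vector not reproduced by its coefficients would leave a residual whose
  normalisation could be added.\<close>

lemma orthonormal_basis_exists:
  obtains E where "orthonormal E" "\<And>v. v \<in> W \<Longrightarrow> v = (\<Sum>e\<in>E. s v e *\<^sub>R e)"
proof -
  obtain B where B: "finite B" "W \<subseteq> span B" using finite_dim by blast
  have bound: "card E \<le> card B" if E: "orthonormal E" for E
  proof -
    have "independent E"
    proof (rule independent_if_scalars_zero)
      show "finite E" using E by (simp add: orthonormal_def)
      fix c e assume "(\<Sum>x\<in>E. c x *\<^sub>R x) = 0" "e \<in> E"
      then show "c e = 0"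
        using orthonormal_sum[OF E, of e c] linear_form_0[OF linear_right, of e e] E
        by (auto simp: orthonormal_def)
    qed
    moreover have "E \<subseteq> span B" using E B by (auto simp: orthonormal_def)
    ultimately show ?thesis using independent_span_bound[OF B(1)] by blast
  qed
  have "orthonormal {}" by (simp add: orthonormal_def)
  then obtain E where E: "orthonormal E" and max: "\<And>E'. orthonormal E' \<Longrightarrow> card E' \<le> card E"
    using ex_has_greatest_nat[of orthonormal "{}" card "Suc (card B)"] bound by (auto simp: less_Suc_eq_le)
  have fin: "finite E" and sub: "E \<subseteq> W" using E by (auto simp: orthonormal_def)
  have "v = (\<Sum>e\<in>E. s v e *\<^sub>R e)" if v: "v \<in> W" for v
  proof (rule ccontr)
    define r where "r = v - (\<Sum>e\<in>E. s v e *\<^sub>R e)"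
    assume "v \<noteq> (\<Sum>e\<in>E. s v e *\<^sub>R e)"
    then have r0: "r \<noteq> 0" by (simp add: r_def)
    have r: "r \<in> W" using v mem_sum[OF sub] by (simp add: r_def)
    define e' where "e' = (1 / sqrt (s r r)) *\<^sub>R r"
    have e': "e' \<in> W" "s e' e' = 1" using r pos[OF r r0] by (simp_all add: e'_def)
    have orth: "s d e' = 0" "s e' d = 0" if d: "d \<in> E" for d
    proof -
      have dW: "d \<in> W" using d sub by blast
      have "s d r = 0"
        using orthonormal_sum[OF E d, of "s v"] v dW mem_sum[OF sub, of "s v"] sym[OF v dW] by (simp add: r_def)
      then show "s d e' = 0" using r dW by (simp add: e'_def)
      then show "s e' d = 0" using sym[OF e'(1) dW] by simp
    qed
    have "e' \<notin> E" using orth e'(2) by fastforce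
    moreover have "orthonormal (insert e' E)"
      using E e' orth by (auto simp: orthonormal_def)
    ultimately show False using max[of "insert e' E"] fin by simp
  qed
  then show ?thesis using that E by blast
qed

text \<open>In an orthonormal basis the representing vector has the coordinates
  \<open>f e\<close>.\<close>

lemma riesz_representation:
  assumes f: "linear_form W f"
  obtains r where "r \<in> W" "\<And>v. v \<in> W \<Longrightarrow> f v = s v r"
proof -
  obtain E where E: "orthonormal E" "\<And>v. v \<in> W \<Longrightarrow> v = (\<Sum>e\<in>E. s v e *\<^sub>R e)"
    using orthonormal_basis_exists by metis
  have sub: "E \<subseteq> W" using E(1) by (simp add: orthonormal_def)
  show ?thesis
  proof
    show "(\<Sum>e\<in>E. f e *\<^sub>R e) \<in> W" using sub by (rule mem_sum)
    fix v assume v: "v \<in> W"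
    have "f v = f (\<Sum>e\<in>E. s v e *\<^sub>R e)" using E(2)[OF v] by simp
    also have "\<dots> = (\<Sum>e\<in>E. s v e * f e)"
      using sub by (intro linear_form_sum[OF f W]) auto
    also have "\<dots> = s v (\<Sum>e\<in>E. f e *\<^sub>R e)"
      using sum_right[OF v sub] by (simp add: mult.commute)
    finally show "f v = s v (\<Sum>e\<in>E. f e *\<^sub>R e)" .
  qed
qed

text \<open>A minimising sequence of the energy is Cauchy by the parallelogram identity, and so
  converges coordinatewise in an orthonormal basis.\<close>

lemma variational_inequality_exists:
  assumes f: "linear_form W f"
    and j_add: "\<And>x y. x \<in> W \<Longrightarrow> y \<in> W \<Longrightarrow> j (x + y) \<le> j x + j y"
    and j_scale: "\<And>c x. x \<in> W \<Longrightarrow> j (c *\<^sub>R x) = \<bar>c\<bar> * j x"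
  obtains u where "u \<in> W" "\<And>v. v \<in> W \<Longrightarrow> f (v - u) \<le> s u (v - u) + j v - j u"
proof -
  obtain r where r: "r \<in> W" "\<And>v. v \<in> W \<Longrightarrow> f v = s v r"
    using riesz_representation[OF f] by blast
  obtain E where E: "orthonormal E" "\<And>v. v \<in> W \<Longrightarrow> v = (\<Sum>e\<in>E. s v e *\<^sub>R e)"
    using orthonormal_basis_exists by metis
  have fin: "finite E" and sub: "E \<subseteq> W" using E(1) by (auto simp: orthonormal_def)
  have expand: "s x v = (\<Sum>e\<in>E. s v e * s x e)" if "x \<in> W" "v \<in> W" for x v
    using sum_right[OF that(1) sub, of "s v"] E(2)[OF that(2)] by simp
  have parseval: "s v v = (\<Sum>e\<in>E. (s v e)\<^sup>2)" if "v \<in> W" for v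
    using expand[OF that that] by (simp add: power2_eq_square)
  \<comment> \<open>Subadditivity at \<open>x\<close> and \<open>- x\<close> gives
    \<open>0 = j 0 \<le> 2 * j x\<close>.\<close>
  have j_nonneg: "0 \<le> j x" if x: "x \<in> W" for x
    using j_add[OF x mem(4)[OF x], of "-1"] j_scale[OF x, of "-1"] j_scale[OF x, of 0] by simp
  have j_sum: "j (\<Sum>e\<in>A. c e *\<^sub>R e) \<le> (\<Sum>e\<in>A. \<bar>c e\<bar> * j e)" if "finite A" "A \<subseteq> W" for A c
    using that
  proof (induction A)
    case empty
    then show ?case using j_scale[OF mem(1), of 0] by simp
  next
    case (insert e A)
    then have "j (c e *\<^sub>R e + (\<Sum>e\<in>A. c e *\<^sub>R e)) \<le> j (c e *\<^sub>R e) + j (\<Sum>e\<in>A. c e *\<^sub>R e)"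
      by (intro j_add) (auto simp: mem_sum)
    then show ?case using insert j_scale[of e "c e"] by simp
  qed
  define J where "J v = s v v / 2 + j v - f v" for v
  \<comment> \<open>Completing the square: \<open>s v v / 2 - s v r\<close> is at least
    \<open>- (s r r / 2)\<close>.\<close>
  have J_ge: "- (s r r / 2) \<le> J v" if v: "v \<in> W" for v
    using nonneg[of "v - r"] j_nonneg[OF v] r v sym[OF r(1) v] by (simp add: J_def)
  define I where "I = Inf (J ` W)"
  have bdd: "bdd_below (J ` W)" using J_ge by (auto simp: bdd_below_def)
  have I_le: "I \<le> J v" if "v \<in> W" for v
    unfolding I_def using bdd that by (intro cInf_lower) auto
  have "W \<noteq> {}" using mem(1) by blast
  then have "\<exists>v\<in>W. J v < I + inverse (real (Suc k))" for k
    using cInf_lessD[of "J ` W" "I + inverse (real (Suc k))"] by (auto simp: I_def)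
  then obtain v where v: "\<And>k. v k \<in> W" "\<And>k. J (v k) < I + inverse (real (Suc k))" by metis
  have close: "s (v k - v l) (v k - v l) \<le> 4 * (inverse (real (Suc k)) + inverse (real (Suc l)))" for k l
  proof -
    let ?m = "(1/2) *\<^sub>R (v k + v l)"
    have m: "?m \<in> W" using v(1) by simp
    have "j ?m \<le> (j (v k) + j (v l)) / 2"
      using j_scale[of "v k + v l" "1/2"] j_add[OF v(1) v(1), of k l] v(1) by simp
    moreover have "f ?m = (f (v k) + f (v l)) / 2" using v(1) r m by simp
    moreover have "s ?m ?m = (s (v k) (v k) + 2 * s (v k) (v l) + s (v l) (v l)) / 4"
      "s (v k - v l) (v k - v l) = s (v k) (v k) - 2 * s (v k) (v l) + s (v l) (v l)"
      using v(1) sym[OF v(1) v(1), of l k] by (simp_all add: add_divide_distrib)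
    \<comment> \<open>The midpoint has energy at least \<open>I\<close>, and each of the other two
      energies exceeds \<open>I\<close> by less than its reciprocal; the factor 4 in the claim
      undoes the quarter here.\<close>
    ultimately have "s (v k - v l) (v k - v l) / 4 \<le> J (v k) + J (v l) - 2 * J ?m"
      unfolding J_def by argo
    then show ?thesis using v(2)[of k] v(2)[of l] I_le[OF m] by argo
  qed
  have coord: "(s x e)\<^sup>2 \<le> s x x" if "x \<in> W" "e \<in> E" for x e
    unfolding parseval[OF that(1)] using that(2) fin by (intro member_le_sum) auto
  have "Cauchy (\<lambda>k. s (v k) e)" if e: "e \<in> E" for e
  proof (rule CauchyI)
    fix \<epsilon> :: real assume "0 < \<epsilon>"
    then obtain N where N: "inverse (real (Suc N)) < \<epsilon>\<^sup>2 / 8"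
      using reals_Archimedean[of "\<epsilon>\<^sup>2 / 8"] by auto
    have "norm (s (v k) e - s (v l) e) < \<epsilon>" if "k \<ge> N" "l \<ge> N" for k l
    proof -
      have "(s (v k) e - s (v l) e)\<^sup>2 \<le> s (v k - v l) (v k - v l)"
        using coord[of "v k - v l" e] v(1) e sub by auto
      also have "\<dots> \<le> 4 * (inverse (real (Suc k)) + inverse (real (Suc l)))" by (rule close)
      also have "\<dots> \<le> 4 * (inverse (real (Suc N)) + inverse (real (Suc N)))"
        using that by (intro mult_left_mono add_mono le_imp_inverse_le) auto
      also have "\<dots> < \<epsilon>\<^sup>2" using N by simp
      finally show ?thesis using \<open>0 < \<epsilon>\<close> power2_less_imp_less[of "\<bar>s (v k) e - s (v l) e\<bar>" \<epsilon>] by auto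
    qed
    then show "\<exists>M. \<forall>m\<ge>M. \<forall>n\<ge>M. norm (s (v m) e - s (v n) e) < \<epsilon>" by blast
  qed
  then have "\<forall>e\<in>E. \<exists>c. (\<lambda>k. s (v k) e) \<longlonglongrightarrow> c"
    by (metis Cauchy_convergent convergentD)
  then obtain c where c: "\<And>e. e \<in> E \<Longrightarrow> (\<lambda>k. s (v k) e) \<longlonglongrightarrow> c e" by metis
  define u where "u = (\<Sum>e\<in>E. c e *\<^sub>R e)"
  have u: "u \<in> W" unfolding u_def using sub by (rule mem_sum)
  have ue: "s u e = c e" if e: "e \<in> E" for e
    using orthonormal_sum[OF E(1) e, of c] sym[OF u, of e] sub e by (auto simp: u_def)
  have lim: "(\<lambda>k. s (u - v k) e) \<longlonglongrightarrow> 0" if e: "e \<in> E" for e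
  proof -
    have "e \<in> W" using e sub by blast
    then have "s (u - v k) e = c e - s (v k) e" for k using u v(1) ue[OF e] by simp
    then show ?thesis using tendsto_diff[OF tendsto_const[of "c e"] c[OF e]] by simp
  qed
  have lim_form: "(\<lambda>k. (\<Sum>e\<in>E. \<bar>s (u - v k) e\<bar> * K e)) \<longlonglongrightarrow> 0" for K :: "'a \<Rightarrow> real"
  proof -
    have "(\<lambda>k. (\<Sum>e\<in>E. \<bar>s (u - v k) e\<bar> * K e)) \<longlonglongrightarrow> (\<Sum>e\<in>E. \<bar>0\<bar> * K e)"
      using lim by (intro tendsto_sum tendsto_mult tendsto_rabs tendsto_const)
    then show ?thesis by simp
  qed
  have J_u: "J u \<le> I"
  proof (rule LIMSEQ_le)
    \<comment> \<open>A bound for \<open>J u - I\<close>: the summands control the quadratic, linear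
      and friction parts of \<open>J u - J (v k)\<close> and the excess of \<open>J (v k)\<close>
      over \<open>I\<close>.\<close>
    define \<epsilon> where "\<epsilon> k = (s u u - s (v k) (v k)) / 2 + (\<Sum>e\<in>E. \<bar>s (u - v k) e\<bar> * \<bar>s r e\<bar>)
        + (\<Sum>e\<in>E. \<bar>s (u - v k) e\<bar> * j e) + inverse (real (Suc k))" for k
    have "(\<lambda>k. s (v k) (v k)) \<longlonglongrightarrow> s u u"
      unfolding parseval[OF v(1)] parseval[OF u] using c ue
      by (auto intro!: tendsto_sum tendsto_power)
    then have "\<epsilon> \<longlonglongrightarrow> (s u u - s u u) / 2 + 0 + 0 + 0"
      unfolding \<epsilon>_def by (intro tendsto_intros lim_form LIMSEQ_inverse_real_of_nat) auto
    then have "\<epsilon> \<longlonglongrightarrow> 0" by simp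
    from tendsto_add[OF tendsto_const[of I] this] show "(\<lambda>k. I + \<epsilon> k) \<longlonglongrightarrow> I" by simp
    show "(\<lambda>k. J u) \<longlonglongrightarrow> J u" by simp
    have "J u \<le> I + \<epsilon> k" for k
    proof -
      have d: "u - v k \<in> W" using u v(1) by simp
      have "j u \<le> j (v k) + j (u - v k)" using j_add[OF v(1)[of k] d] by simp
      moreover have "j (u - v k) \<le> (\<Sum>e\<in>E. \<bar>s (u - v k) e\<bar> * j e)"
        using j_sum[OF fin sub, of "\<lambda>e. s (u - v k) e"] E(2)[OF d] by simp
      moreover have "f u - f (v k) = s r (u - v k)"
        using u v(1)[of k] r sym[OF r(1)] by simp
      then have "\<bar>f u - f (v k)\<bar> \<le> (\<Sum>e\<in>E. \<bar>s (u - v k) e\<bar> * \<bar>s r e\<bar>)"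
        using sum_abs[of "\<lambda>e. s (u - v k) e * s r e" E] expand[OF r(1) d] by (simp add: abs_mult)
      then have "- (f u - f (v k)) \<le> (\<Sum>e\<in>E. \<bar>s (u - v k) e\<bar> * \<bar>s r e\<bar>)" by linarith
      ultimately show ?thesis using v(2)[of k] unfolding J_def \<epsilon>_def diff_divide_distrib by argo
    qed
    then show "\<exists>N. \<forall>n\<ge>N. J u \<le> I + \<epsilon> n" by blast
  qed
  have "f (v - u) \<le> s u (v - u) + j v - j u" if v: "v \<in> W" for v
  proof (rule ccontr)
    define d where "d = v - u"
    define X where "X = s u d + j v - j u - f d"
    assume "\<not> f (v - u) \<le> s u (v - u) + j v - j u"
    then have X: "X < 0" by (simp add: X_def d_def)
    have dW: "d \<in> W" using v u by (simp add: d_def)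
    have S: "0 \<le> s d d" using nonneg[OF dW] .
    \<comment> \<open>The bound 1 keeps \<open>u + t *\<^sub>R d\<close> between \<open>u\<close>
      and \<open>v\<close>, so that convexity of \<open>j\<close> applies; the other bound makes the
      quadratic term too small to compensate \<open>X < 0\<close>. Adding 1 to \<open>s d d\<close>
      avoids a zero denominator.\<close>
    define t where "t = min 1 (- X / (s d d + 1))"
    have t: "0 < t" "t \<le> 1" using X S by (auto simp: t_def divide_less_0_iff)
    have "t \<le> - X / (s d d + 1)" by (simp add: t_def)
    then have tS: "t * s d d \<le> - X - t" using S by (simp add: field_simps)
    have "J u \<le> J (u + t *\<^sub>R d)" using J_u I_le[of "u + t *\<^sub>R d"] u dW by simp
    moreover have "s (u + t *\<^sub>R d) (u + t *\<^sub>R d) = s u u + 2 * (t * s u d) + t\<^sup>2 * s d d"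
      using u dW sym[OF dW u] by (simp add: power2_eq_square algebra_simps)
    moreover have "f (u + t *\<^sub>R d) = f u + t * f d" using u dW r by simp
    moreover have "j (u + t *\<^sub>R d) \<le> j u - t * j u + t * j v"
    proof -
      have "u + t *\<^sub>R d = (1 - t) *\<^sub>R u + t *\<^sub>R v" by (simp add: d_def algebra_simps)
      then show ?thesis
        using j_add[of "(1 - t) *\<^sub>R u" "t *\<^sub>R v"] j_scale[OF u, of "1 - t"] j_scale[OF v, of t] t u v
        by (simp add: left_diff_distrib)
    qed
    ultimately have "0 \<le> t * s u d + t\<^sup>2 * s d d / 2 + t * j v - t * j u - t * f d"
      unfolding J_def by argo
    then have "0 \<le> t * (s u d + t * s d d / 2 + j v - j u - f d)"
      by (simp add: algebra_simps power2_eq_square)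
    then have "0 \<le> X + t * s d d / 2" using t by (simp add: zero_le_mult_iff X_def)
    then show False using tS t X S by auto
  qed
  then show ?thesis using that u by blast
qed

end

text \<open>The inf-sup condition makes \<open>(q, r) \<mapsto> a (T q) (T r)\<close> an inner product on \<open>Q\<close>, where
  \<open>T q\<close> represents \<open>b _ q\<close>.\<close>

lemma pairing_surjective:
  fixes V :: "'v::real_vector set" and Q :: "'q::real_vector set"
  assumes V: "inner_subspace V a"
    and Q: "subspace Q" "\<exists>C. finite C \<and> Q \<subseteq> span C"
    and b1: "\<And>q. q \<in> Q \<Longrightarrow> linear_form V (\<lambda>v. b v q)"
    and b2: "\<And>v. v \<in> V \<Longrightarrow> linear_form Q (b v)"
    and inf_sup: "\<And>q. q \<in> Q \<Longrightarrow> (\<And>v. v \<in> V \<Longrightarrow> b v q = 0) \<Longrightarrow> q = 0"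
  shows "linear_form Q l \<Longrightarrow> \<exists>w\<in>V. \<forall>q\<in>Q. b w q = l q"
    and "linear_form V F \<Longrightarrow> (\<And>w. w \<in> V \<Longrightarrow> \<forall>q\<in>Q. b w q = 0 \<Longrightarrow> F w = 0) \<Longrightarrow>
      \<exists>p\<in>Q. \<forall>w\<in>V. F w = b w p"
proof -
  interpret V: inner_subspace V a by (rule V)
  have "\<forall>q\<in>Q. \<exists>r\<in>V. \<forall>v\<in>V. b v q = a v r"
    using V.riesz_representation[OF b1] by metis
  then obtain T where T: "\<And>q. q \<in> Q \<Longrightarrow> T q \<in> V" "\<And>q v. q \<in> Q \<Longrightarrow> v \<in> V \<Longrightarrow> b v q = a v (T q)"
    by metis
  define s where "s q r = b (T q) r" for q r
  interpret Q: inner_subspace Q s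
  proof
    show "inner_product_on Q s"
      unfolding inner_product_on_def
    proof (intro conjI ballI impI)
      fix q assume q: "q \<in> Q"
      show "linear_form Q (s q)" unfolding s_def using b2 T q by auto
      show "s q r = s r q" if "r \<in> Q" for r
        unfolding s_def using T q that by (simp add: V.sym)
      assume "q \<noteq> 0"
      then have "T q \<noteq> 0"
        using inf_sup[OF q] T(2)[OF q] linear_form_0[OF V.linear_right] by (metis T(1) q)
      then show "0 < s q q" unfolding s_def using T q V.pos[of "T q"] by auto
    qed
  qed (rule Q)+
  show "\<exists>w\<in>V. \<forall>q\<in>Q. b w q = l q" if l: "linear_form Q l"
  proof -
    obtain r where "r \<in> Q" "\<And>q. q \<in> Q \<Longrightarrow> l q = s q r" using Q.riesz_representation[OF l] by blast
    then show ?thesis using Q.sym T(1) by (intro bexI[of _ "T r"]) (auto simp: s_def)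
  qed
  show "\<exists>p\<in>Q. \<forall>w\<in>V. F w = b w p"
    if F: "linear_form V F" and ker: "\<And>w. w \<in> V \<Longrightarrow> \<forall>q\<in>Q. b w q = 0 \<Longrightarrow> F w = 0"
  proof -
    obtain r where r: "r \<in> V" "\<And>v. v \<in> V \<Longrightarrow> F v = a v r"
      using V.riesz_representation[OF F] by blast
    obtain p where p: "p \<in> Q" "\<And>q. q \<in> Q \<Longrightarrow> b r q = s q p"
      using Q.riesz_representation[OF b2[OF r(1)]] by blast
    have Tp: "T p \<in> V" using T p by blast
    \<comment> \<open>By the choice of \<open>p\<close>, \<open>d\<close> is annihilated by every
      \<open>b _ q\<close>, hence by \<open>F\<close>. So \<open>a d r = F d\<close> and
      \<open>a d (T p) = b d p\<close> both vanish, and \<open>a d d = 0\<close>.\<close>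
    define d where "d = r - T p"
    have d: "d \<in> V" using r Tp by (simp add: d_def)
    have orth: "b d q = 0" if q: "q \<in> Q" for q
      using linear_form_diff[OF b1[OF q] V.W r(1) Tp] p(2)[OF q] Q.sym[OF q p(1)]
      by (simp add: d_def s_def)
    then have "a d r = 0" "a d (T p) = 0" using ker[OF d] r(2)[OF d] orth[OF p(1)] T(2)[OF p(1) d] by auto
    then have "a d d = 0" using V.bilinear(4)[OF d r(1) Tp] by (simp add: d_def)
    then have "d = 0" using V.pos[OF d] by force
    then show ?thesis using p r T by (auto simp: d_def)
  qed
qed

section \<open>The abstract friction problem: energy, pressure and slip multiplier\<close>

locale friction_problem =
  fixes V :: "'v::real_vector set" and Q :: "'q::real_vector set" and X :: "'i set"
    and a :: "'v \<Rightarrow> 'v \<Rightarrow> real" and b :: "'v \<Rightarrow> 'q \<Rightarrow> real" and F :: "'v \<Rightarrow> real"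
    and t :: "'i \<Rightarrow> 'v \<Rightarrow> real" and w :: "'i \<Rightarrow> real" and \<psi> :: "'i \<Rightarrow> 'v"
  assumes V: "subspace V" "\<exists>A. finite A \<and> V \<subseteq> span A"
    and Q: "subspace Q" "\<exists>C. finite C \<and> Q \<subseteq> span C"
    and a: "inner_product_on V a" and F: "linear_form V F"
    and b1: "\<And>q. q \<in> Q \<Longrightarrow> linear_form V (\<lambda>v. b v q)"
    and b2: "\<And>v. v \<in> V \<Longrightarrow> linear_form Q (b v)"
    and X: "finite X" "\<And>x. x \<in> X \<Longrightarrow> 0 < w x"
    and t: "\<And>x. x \<in> X \<Longrightarrow> linear_form V (t x)"
    and \<psi>: "\<And>x. x \<in> X \<Longrightarrow> \<psi> x \<in> V"
      "\<And>x y. x \<in> X \<Longrightarrow> y \<in> X \<Longrightarrow> t y (\<psi> x) = (if x = y then 1 else 0)"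
    and inf_sup: "\<And>q. q \<in> Q \<Longrightarrow>
      (\<And>v. v \<in> V \<Longrightarrow> \<forall>x\<in>X. t x v = 0 \<Longrightarrow> b v q = 0) \<Longrightarrow> q = 0"
begin

sublocale inner_subspace V a
  using V a by unfold_locales

definition j :: "'v \<Rightarrow> real" where
  "j v = (\<Sum>x\<in>X. w x * \<bar>t x v\<bar>)"

definition S :: "'v set" where
  "S = {v \<in> V. \<forall>q\<in>Q. b v q = 0}"

definition VI_sigma :: "'v \<Rightarrow> bool" where
  "VI_sigma u \<longleftrightarrow> u \<in> S \<and> (\<forall>v\<in>S. F (v - u) \<le> a u (v - u) + j v - j u)"

definition VI :: "'v \<Rightarrow> 'q \<Rightarrow> bool" where
  "VI u p \<longleftrightarrow> u \<in> S \<and> p \<in> Q \<and>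
     (\<forall>v\<in>V. F (v - u) \<le> a u (v - u) + b (v - u) p + j v - j u)"

text \<open>The multiplier is an arbitrary function of which only the values on \<open>X\<close>
  enter; it becomes a finite element function later, by interpolation.\<close>

definition VE :: "'v \<Rightarrow> 'q \<Rightarrow> ('i \<Rightarrow> real) \<Rightarrow> bool" where
  "VE u p l \<longleftrightarrow> u \<in> S \<and> p \<in> Q \<and> (\<forall>x\<in>X. \<bar>l x\<bar> \<le> 1) \<and>
     (\<forall>v\<in>V. a u v + b v p + (\<Sum>x\<in>X. w x * t x v * l x) = F v) \<and>
     (\<forall>\<mu>. (\<forall>x\<in>X. \<bar>\<mu> x\<bar> \<le> 1) \<longrightarrow> (\<Sum>x\<in>X. w x * t x u * (\<mu> x - l x)) \<le> 0)"

lemma SV: "v \<in> S \<Longrightarrow> v \<in> V"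
  by (simp add: S_def)

lemma subspace_S: "subspace S"
  unfolding S_def by (intro subspace_kernel V b1)

lemma j_add: "x \<in> V \<Longrightarrow> y \<in> V \<Longrightarrow> j (x + y) \<le> j x + j y"
  unfolding j_def sum.distrib[symmetric]
  using X by (intro sum_mono)
    (auto simp: linear_form_add[OF t] less_imp_le abs_triangle_ineq mult_left_mono simp flip: distrib_left)

lemma j_scale: "x \<in> V \<Longrightarrow> j (c *\<^sub>R x) = \<bar>c\<bar> * j x"
  unfolding j_def sum_distrib_left
  by (intro sum.cong) (auto simp: linear_form_scaleR[OF t] abs_mult)

text \<open>For uniqueness, testing each of two solutions with the other and adding cancels
  \<open>F\<close> and \<open>j\<close> and leaves
  \<open>a (u' - u) (u' - u) \<le> 0\<close>.\<close>

lemma ex1_VI_sigma: "\<exists>!u. VI_sigma u"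
proof -
  interpret S: inner_subspace S a
    using subspace_S V(2) inner_product_on_subset[OF a] SV by unfold_locales blast+
  have "linear_form S F" using F SV linear_form_subset by blast
  then obtain u where "u \<in> S" "\<And>v. v \<in> S \<Longrightarrow> F (v - u) \<le> a u (v - u) + j v - j u"
    using S.variational_inequality_exists[of F j] j_add j_scale SV by metis
  moreover have "u = u'" if "VI_sigma u" "VI_sigma u'" for u u'
  proof (rule ccontr)
    assume ne: "u \<noteq> u'"
    have uu: "u \<in> V" "u' \<in> V" using that SV by (auto simp: VI_sigma_def)
    have "F (u' - u) \<le> a u (u' - u) + j u' - j u" "F (u - u') \<le> a u' (u - u') + j u - j u'"
      using that by (auto simp: VI_sigma_def)
    moreover have "F (u - u') = F u - F u'" "F (u' - u) = F u' - F u"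
      using linear_form_diff[OF F V(1)] uu by auto
    moreover have "0 < a (u' - u) (u' - u)" using pos[of "u' - u"] uu ne by simp
    ultimately show False using uu by simp
  qed
  ultimately show ?thesis by (auto simp: VI_sigma_def)
qed

text \<open>The test functions \<open>0\<close> and \<open>2 *\<^sub>R u\<close> give opposite
  inequalities, since \<open>j\<close> is positively homogeneous.\<close>

lemma VI_sigma_energy: "VI_sigma u \<Longrightarrow> a u u + j u = F u"
proof -
  assume u: "VI_sigma u"
  have uV: "u \<in> V" using u SV by (simp add: VI_sigma_def)
  have "0 \<in> S" "2 *\<^sub>R u \<in> S" using subspace_S u by (auto simp: VI_sigma_def subspace_def)
  then have "F (0 - u) \<le> a u (0 - u) + j 0 - j u"
    "F (2 *\<^sub>R u - u) \<le> a u (2 *\<^sub>R u - u) + j (2 *\<^sub>R u) - j u"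
    using u by (auto simp only: VI_sigma_def)
  moreover have "2 *\<^sub>R u - u = u" by (simp add: scaleR_2)
  moreover have "j (2 *\<^sub>R u) = 2 * j u" "j 0 = 0"
    using j_scale[OF uV, of 2] j_scale[OF uV, of 0] by auto
  moreover have "F (- u) = - F u" "a u (- u) = - a u u"
    using linear_form_scaleR[OF F uV, of "-1"] bilinear(1)[OF uV uV, of "-1"] by auto
  ultimately show ?thesis by simp
qed

lemma sum_le_j:
  assumes "\<forall>x\<in>X. \<bar>\<mu> x\<bar> \<le> 1"
  shows "(\<Sum>x\<in>X. w x * t x v * \<mu> x) \<le> j v"
  unfolding j_def
proof (rule sum_mono)
  fix x assume x: "x \<in> X"
  have "t x v * \<mu> x \<le> \<bar>t x v\<bar> * 1"
    using assms x abs_mult[of "t x v" "\<mu> x"] mult_left_mono[of "\<bar>\<mu> x\<bar>" 1 "\<bar>t x v\<bar>"] by force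
  then show "w x * t x v * \<mu> x \<le> w x * \<bar>t x v\<bar>"
    using X(2)[OF x] by (simp add: mult.assoc)
qed

definition V0 :: "'v set" where
  "V0 = {v \<in> V. \<forall>x\<in>X. t x v = 0}"

lemma V0V: "v \<in> V0 \<Longrightarrow> v \<in> V"
  by (simp add: V0_def)

lemma subspace_V0: "subspace V0"
  unfolding V0_def by (intro subspace_kernel V t)

lemma j_V0: "v \<in> V \<Longrightarrow> z \<in> V0 \<Longrightarrow> j (v + z) = j v"
  unfolding j_def by (intro sum.cong) (auto simp: V0_def linear_form_add[OF t])

text \<open>The inf-sup hypothesis concerns exactly the functions in \<open>V0\<close>, which
  \<open>j\<close> does not see; so divergence can be corrected, and a pressure recovered, without
  touching the friction term.\<close>

lemma pairing_V0:
  shows "linear_form Q l \<Longrightarrow> \<exists>z\<in>V0. \<forall>q\<in>Q. b z q = l q"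
    and "linear_form V0 G \<Longrightarrow> (\<And>z. z \<in> V0 \<Longrightarrow> \<forall>q\<in>Q. b z q = 0 \<Longrightarrow> G z = 0) \<Longrightarrow>
      \<exists>p\<in>Q. \<forall>z\<in>V0. G z = b z p"
proof -
  have V0: "inner_subspace V0 a"
    using subspace_V0 V(2) inner_product_on_subset[OF a] V0V by unfold_locales blast+
  have b1': "linear_form V0 (\<lambda>v. b v q)" if "q \<in> Q" for q
    using linear_form_subset[OF b1[OF that]] V0V by blast
  have b2': "linear_form Q (b v)" if "v \<in> V0" for v using b2 that V0V by blast
  have inf_sup': "q = 0" if "q \<in> Q" "\<And>v. v \<in> V0 \<Longrightarrow> b v q = 0" for q
    using inf_sup[OF that(1)] that(2) by (simp add: V0_def)
  note * = pairing_surjective[OF V0 Q b1' b2' inf_sup']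
  show "linear_form Q l \<Longrightarrow> \<exists>z\<in>V0. \<forall>q\<in>Q. b z q = l q" using *(1) by blast
  show "linear_form V0 G \<Longrightarrow> (\<And>z. z \<in> V0 \<Longrightarrow> \<forall>q\<in>Q. b z q = 0 \<Longrightarrow> G z = 0) \<Longrightarrow>
      \<exists>p\<in>Q. \<forall>z\<in>V0. G z = b z p" using *(2) by blast
qed

lemma linear_form_residual:
  "u \<in> V \<Longrightarrow> p \<in> Q \<Longrightarrow> linear_form V (\<lambda>v. F v - a u v - b v p)"
  using F b1[of p] linear_right[of u] unfolding linear_form_def
  by (auto simp: algebra_simps)

text \<open>The test functions \<open>0\<close> and \<open>2 *\<^sub>R u\<close> yield the equality
  at \<open>u\<close>; subtracting it from the inequality bounds the residual by \<open>j v\<close>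
  for every \<open>v\<close>, and \<open>- v\<close> gives the absolute value.\<close>

lemma VI_residual:
  assumes "VI u p" "v \<in> V"
  shows "\<bar>F v - a u v - b v p\<bar> \<le> j v" and "F u - a u u - b u p = j u"
proof -
  let ?G = "\<lambda>v. F v - a u v - b v p"
  have u: "u \<in> V" "p \<in> Q" and ineq: "\<And>v. v \<in> V \<Longrightarrow> ?G (v - u) \<le> j v - j u"
    using assms SV by (force simp: VI_def)+
  have G: "linear_form V ?G" using linear_form_residual[OF u] .
  have "0 \<in> V" "2 *\<^sub>R u \<in> V" using V u by (auto simp: subspace_def)
  then have "?G (0 - u) \<le> j 0 - j u" "?G (2 *\<^sub>R u - u) \<le> j (2 *\<^sub>R u) - j u"
    using ineq by blast+
  moreover have "2 *\<^sub>R u - u = u" by (simp add: scaleR_2)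
  moreover have "j (2 *\<^sub>R u) = 2 * j u" "j 0 = 0"
    using j_scale[OF u(1), of 2] j_scale[OF u(1), of 0] by auto
  moreover have "?G (0 - u) = - ?G u"
    using linear_form_scaleR[OF G u(1), of "-1"] by simp
  ultimately show Gu: "?G u = j u" by simp
  have le: "?G v \<le> j v" if v: "v \<in> V" for v
    using ineq[OF v] linear_form_diff[OF G V(1) v u(1)] Gu by simp
  have "- ?G v \<le> j v"
    using le[of "(-1) *\<^sub>R v"] linear_form_scaleR[OF G assms(2), of "-1"] j_scale[OF assms(2), of "-1"]
      assms(2) V by (simp add: subspace_neg)
  then show "\<bar>?G v\<bar> \<le> j v" using le[OF assms(2)] by linarith
qed

text \<open>Adding a divergence-free \<open>z\<close> from \<open>V0\<close> to \<open>u\<close>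
  leaves the friction unchanged, so the inequality holds for \<open>z\<close> and \<open>- z\<close>
  and becomes an equation; the pressure is its Lagrange multiplier on \<open>V0\<close>.\<close>

lemma VI_sigma_imp_ex1_VI:
  assumes u: "VI_sigma u"
  shows "\<exists>!p. VI u p"
proof -
  have uV: "u \<in> V" and uS: "u \<in> S" using u SV by (auto simp: VI_sigma_def)
  let ?G = "\<lambda>v. F v - a u v"
  have G: "linear_form V ?G"
    using F linear_right[OF uV] unfolding linear_form_def by (auto simp: algebra_simps)
  have ker_le: "?G z \<le> 0" if z: "z \<in> V0" "\<forall>q\<in>Q. b z q = 0" for z
  proof -
    have zV: "z \<in> V" and zS: "z \<in> S" using z V0V by (auto simp: S_def)
    have "u + z \<in> S" using subspace_S uS zS by (simp add: subspace_add)
    then have "F (u + z - u) \<le> a u (u + z - u) + j (u + z) - j u" using u by (simp only: VI_sigma_def)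
    then show ?thesis using j_V0[OF uV z(1)] by simp
  qed
  have ker: "?G z = 0" if z: "z \<in> V0" "\<forall>q\<in>Q. b z q = 0" for z
  proof -
    have "b ((-1) *\<^sub>R z) q = 0" if "q \<in> Q" for q
      using linear_form_scaleR[OF b1[OF that] V0V[OF z(1)], of "-1"] z(2) that by simp
    then have "?G ((-1) *\<^sub>R z) \<le> 0" using ker_le subspace_V0 z(1) subspace_scale by blast
    then show ?thesis using linear_form_scaleR[OF G V0V[OF z(1)], of "-1"] ker_le[OF z] by simp
  qed
  have "linear_form V0 ?G" using linear_form_subset[OF G] V0V by blast
  then obtain p where p: "p \<in> Q" "\<And>z. z \<in> V0 \<Longrightarrow> ?G z = b z p"
    using pairing_V0(2)[of ?G] ker by blast
  have "VI u p"
    unfolding VI_def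
  proof (intro conjI ballI uS p(1))
    fix v assume v: "v \<in> V"
    then have d: "v - u \<in> V" using uV V by (simp add: subspace_diff)
    \<comment> \<open>Removing from \<open>v\<close> a friction-neutral part with the same
      divergence functional as \<open>v - u\<close> produces an admissible test function
      \<open>v'\<close>; the removed part reappears as the pressure term.\<close>
    obtain z where z: "z \<in> V0" "\<And>q. q \<in> Q \<Longrightarrow> b z q = b (v - u) q"
      using pairing_V0(1)[OF b2[OF d]] by blast
    define v' where "v' = v - z"
    have zV: "z \<in> V" using z V0V by blast
    have v': "v' \<in> V" using v zV V by (simp add: v'_def subspace_diff)
    have bv': "b v' q = 0" if q: "q \<in> Q" for q
      using linear_form_diff[OF b1[OF q] V(1) v zV] linear_form_diff[OF b1[OF q] V(1) v uV] z(2)[OF q] uS q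
      by (simp add: v'_def S_def)
    then have "v' \<in> S" using v' by (simp add: S_def)
    then have "?G (v' - u) \<le> j v' - j u" using u by (auto simp: VI_sigma_def)
    moreover have "v' - u = v - u - z" by (simp add: v'_def)
    then have "?G (v' - u) = ?G (v - u) - ?G z"
      using linear_form_diff[OF G V(1) d zV] by (simp only:)
    moreover have "j v' = j v" using j_V0[OF v' z(1)] by (simp add: v'_def)
    moreover have "?G z = b (v - u) p" using p z by simp
    ultimately show "F (v - u) \<le> a u (v - u) + b (v - u) p + j v - j u" by linarith
  qed
  \<comment> \<open>Where \<open>j\<close> vanishes, the residual bound is an equation, so any two
    pressures agree on \<open>V0\<close> and the inf-sup condition identifies them.\<close>
  moreover have "p' = p" if p': "VI u p'" for p'
  proof -
    have p'Q: "p' \<in> Q" using p' by (simp add: VI_def)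
    have "b v (p' - p) = 0" if v: "v \<in> V" "\<forall>x\<in>X. t x v = 0" for v
    proof -
      have "j v = 0" using v by (simp add: j_def)
      then have "F v - a u v - b v p' = 0" using VI_residual(1)[OF p' v(1)] by simp
      moreover have "F v - a u v = b v p" using p(2)[of v] v by (simp add: V0_def)
      ultimately show ?thesis using linear_form_diff[OF b2[OF v(1)] Q(1) p'Q p(1)] by simp
    qed
    then have "p' - p = 0" using inf_sup[of "p' - p"] p'Q p(1) Q(1) by (simp add: subspace_diff)
    then show ?thesis by simp
  qed
  ultimately show ?thesis by blast
qed

text \<open>Since \<open>j (\<psi> x) = w x\<close>, the residual bound says that the coefficient at
  \<open>x\<close> is at most 1 in modulus. Subtracting from \<open>v\<close> its nodal interpolant
  leaves \<open>j\<close> zero, hence residual zero, so these coefficients determine the whole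
  residual.\<close>

lemma VI_imp_VE:
  assumes up: "VI u p"
  shows "VE u p (\<lambda>x. (F (\<psi> x) - a u (\<psi> x) - b (\<psi> x) p) / w x)" (is "VE u p ?l")
proof -
  let ?G = "\<lambda>v. F v - a u v - b v p"
  have u: "u \<in> S" "u \<in> V" "p \<in> Q" using up SV by (auto simp: VI_def)
  have G: "linear_form V ?G" using linear_form_residual[OF u(2,3)] .
  have bound: "\<bar>?l x\<bar> \<le> 1" if x: "x \<in> X" for x
  proof -
    have "j (\<psi> x) = (\<Sum>y\<in>X. if x = y then w y else 0)"
      unfolding j_def using x \<psi>(2) by (intro sum.cong) auto
    also have "\<dots> = w x" using x X by simp
    finally show ?thesis
      using VI_residual(1)[OF up \<psi>(1)[OF x]] X(2)[OF x] by (simp add: abs_divide)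
  qed
  have rep: "(\<Sum>x\<in>X. w x * t x v * ?l x) = ?G v" if v: "v \<in> V" for v
  proof -
    define z where "z = (\<Sum>x\<in>X. t x v *\<^sub>R \<psi> x)"
    have z: "z \<in> V" unfolding z_def using \<psi>(1) V by (intro subspace_sum subspace_scale) auto
    have "t y z = t y v" if y: "y \<in> X" for y
    proof -
      have "t y z = (\<Sum>x\<in>X. t x v * t y (\<psi> x))"
        unfolding z_def using \<psi>(1) by (intro linear_form_sum[OF t[OF y] V(1)])
      also have "\<dots> = (\<Sum>x\<in>X. if y = x then t x v else 0)"
        using \<psi>(2) y by (intro sum.cong) auto
      finally show ?thesis using X y by simp
    qed
    then have "j (v - z) = 0"
      unfolding j_def using linear_form_diff[OF t V(1) v z] by simp
    then have "?G (v - z) = 0" using VI_residual(1)[OF up, of "v - z"] v z V by (simp add: subspace_diff)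
    then have "?G v = ?G z" using linear_form_diff[OF G V(1) v z] by simp
    also have "\<dots> = (\<Sum>x\<in>X. t x v * ?G (\<psi> x))"
      unfolding z_def using \<psi>(1) by (intro linear_form_sum[OF G V(1)])
    also have "\<dots> = (\<Sum>x\<in>X. w x * t x v * ?l x)"
      using X(2) by (intro sum.cong) (auto simp: less_imp_neq[THEN not_sym])
    finally show ?thesis by simp
  qed
  have "(\<Sum>x\<in>X. w x * t x u * (\<mu> x - ?l x)) \<le> 0" if \<mu>: "\<forall>x\<in>X. \<bar>\<mu> x\<bar> \<le> 1" for \<mu>
  proof -
    have "(\<Sum>x\<in>X. w x * t x u * \<mu> x) \<le> j u" using \<mu> by (rule sum_le_j)
    then show ?thesis
      using rep[OF u(2)] VI_residual(2)[OF up u(2)] by (simp add: right_diff_distrib sum_subtractf)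
  qed
  then show ?thesis
    unfolding VE_def using u bound rep by auto
qed

lemma VE_unique:
  assumes "VE u p l" "VE u p l'" "x \<in> X"
  shows "l x = l' x"
proof -
  have pick: "(\<Sum>y\<in>X. w y * t y (\<psi> x) * k y) = w x * k x" for k
  proof -
    have "(\<Sum>y\<in>X. w y * t y (\<psi> x) * k y) = (\<Sum>y\<in>X. if x = y then w y * k y else 0)"
      using assms(3) \<psi>(2) by (intro sum.cong) auto
    then show ?thesis using assms(3) X by simp
  qed
  have "a u (\<psi> x) + b (\<psi> x) p + w x * l x = F (\<psi> x)" "a u (\<psi> x) + b (\<psi> x) p + w x * l' x = F (\<psi> x)"
    using assms(1,2) \<psi>(1)[OF assms(3)] unfolding VE_def pick[symmetric] by auto
  then have "w x * l x = w x * l' x" by linarith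
  then show ?thesis using X(2)[OF assms(3)] by simp
qed

text \<open>Testing the multiplier inequality with the sign of \<open>t x u\<close> shows that the
  coupling term at \<open>u\<close> is at least \<open>j u\<close>, while at any \<open>v\<close> it
  is at most \<open>j v\<close>; the pressure drops out on \<open>S\<close>.\<close>

lemma VE_imp_VI_sigma:
  assumes "VE u p l"
  shows "VI_sigma u"
proof -
  have u: "u \<in> S" "u \<in> V" "p \<in> Q" and l: "\<And>x. x \<in> X \<Longrightarrow> \<bar>l x\<bar> \<le> 1"
    and eq: "\<And>v. v \<in> V \<Longrightarrow> a u v + b v p + (\<Sum>x\<in>X. w x * t x v * l x) = F v"
    and ineq: "\<And>\<mu>. \<forall>x\<in>X. \<bar>\<mu> x\<bar> \<le> 1 \<Longrightarrow> (\<Sum>x\<in>X. w x * t x u * (\<mu> x - l x)) \<le> 0"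
    using assms SV by (auto simp: VE_def)
  have "(\<Sum>x\<in>X. w x * t x u * (sgn (t x u) - l x)) \<le> 0"
    by (intro ineq) (auto simp: sgn_if)
  moreover have "w x * t x u * sgn (t x u) = w x * \<bar>t x u\<bar>" for x
    by (simp add: abs_sgn mult.assoc)
  ultimately have ju: "j u \<le> (\<Sum>x\<in>X. w x * t x u * l x)"
    by (simp add: j_def right_diff_distrib sum_subtractf)
  have "F (v - u) \<le> a u (v - u) + j v - j u" if v: "v \<in> S" for v
  proof -
    have d: "v - u \<in> V" and vV: "v \<in> V" using v u V SV by (auto simp: subspace_diff)
    have "v - u \<in> S" using v u subspace_S by (simp add: subspace_diff)
    then have "b (v - u) p = 0" using u by (simp add: S_def)
    moreover have "(\<Sum>x\<in>X. w x * t x (v - u) * l x) =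
        (\<Sum>x\<in>X. w x * t x v * l x) - (\<Sum>x\<in>X. w x * t x u * l x)"
      unfolding sum_subtractf[symmetric]
      by (intro sum.cong) (simp_all add: linear_form_diff[OF t V(1) vV u(2)] right_diff_distrib left_diff_distrib)
    moreover have "(\<Sum>x\<in>X. w x * t x v * l x) \<le> j v" using l by (intro sum_le_j) simp
    ultimately show ?thesis using eq[OF d] ju by linarith
  qed
  then show ?thesis using u by (simp add: VI_sigma_def)
qed

end


section \<open>Barycentric coordinates and hat functions\<close>

definition corners :: "plane set \<Rightarrow> plane set" where
  "corners T = {x. x extreme_point_of T}"

text \<open>The barycentric coordinate of \<open>z\<close>, as an affine function on the whole
  plane. If \<open>z\<close> is no corner of \<open>T\<close>, it is the zero function, which spares
  case distinctions when triangles are treated uniformly.\<close>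

definition bary :: "plane set \<Rightarrow> plane \<Rightarrow> plane \<Rightarrow> real" where
  "bary T z = (SOME l. (\<exists>\<alpha> \<beta>. l = (\<lambda>x. \<alpha> + \<beta> \<bullet> x)) \<and> (\<forall>s\<in>corners T. l s = (if s = z then 1 else 0)))"

text \<open>Affine independence is linear independence of the differences from one base point, where
  values can be prescribed; the adjoint at 1 is the gradient of the resulting functional.\<close>

lemma affine_interpolation:
  fixes C :: "'a::euclidean_space set" and r :: "'a \<Rightarrow> real"
  assumes C: "\<not> affine_dependent C"
  obtains \<alpha> \<beta> where "\<And>s. s \<in> C \<Longrightarrow> \<alpha> + \<beta> \<bullet> s = r s"
proof (cases "C = {}")
  case False
  then obtain a where a: "a \<in> C" by blast
  let ?D = "(\<lambda>x. x - a) ` (C - {a})"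
  have "independent ?D"
    using C a affine_dependent_iff_dependent[of a "C - {a}"]
    by (simp add: insert_absorb dependent_def Setcompr_eq_image)
  then obtain g where g: "linear g" "\<And>y. y \<in> ?D \<Longrightarrow> g y = r (y + a) - r a"
    using linear_independent_extend[of ?D "\<lambda>y. r (y + a) - r a"] by blast
  have g_inner: "g y = adjoint g 1 \<bullet> y" for y
    using adjoint_works[OF g(1), of y 1] by (simp add: inner_commute)
  have "(r a - adjoint g 1 \<bullet> a) + adjoint g 1 \<bullet> s = r s" if "s \<in> C" for s
  proof (cases "s = a")
    case False
    then have "g (s - a) = r s - r a" using g(2)[of "s - a"] that by auto
    then show ?thesis using g_inner[of "s - a"] by (simp add: inner_diff_right)
  qed simp
  then show ?thesis using that by blast
qed (use that in blast)

locale triangle_mesh =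
  fixes \<T> :: "plane set set"
  assumes triangulation: "triangulation \<T>" and triangles: "\<And>T. T \<in> \<T> \<Longrightarrow> 2 simplex T"
begin

abbreviation "vertices \<equiv> mesh_vertices \<T>"

lemma finite_mesh: "finite \<T>"
  using triangulation by (simp add: triangulation_def)

lemma face_mesh: "T \<in> \<T> \<Longrightarrow> T' \<in> \<T> \<Longrightarrow> (T \<inter> T') face_of T"
  using triangulation by (simp add: triangulation_def)

lemma compact_mesh: "T \<in> \<T> \<Longrightarrow> compact T"
  and convex_mesh: "T \<in> \<T> \<Longrightarrow> convex T"
  and closed_mesh: "T \<in> \<T> \<Longrightarrow> closed T"
  using triangles by (auto intro: compact_simplex convex_simplex closed_simplex)

lemma corners_simplex:
  assumes "T \<in> \<T>"
  shows "finite (corners T)" "card (corners T) = 3" "\<not> affine_dependent (corners T)"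
    "T = convex hull (corners T)"
proof -
  obtain C where C: "\<not> affine_dependent C" "int (card C) = 2 + 1" "T = convex hull C"
    using triangles[OF assms] by (auto simp: simplex_def)
  have "corners T = C"
    using C by (auto simp: corners_def extreme_point_of_convex_hull_affine_independent)
  then show "finite (corners T)" "card (corners T) = 3" "\<not> affine_dependent (corners T)"
    "T = convex hull (corners T)"
    using C aff_independent_finite by auto
qed

lemma corners_subset: "corners T \<subseteq> T"
  by (auto simp: corners_def extreme_point_of_def)

lemma aff_dim_mesh: "T \<in> \<T> \<Longrightarrow> aff_dim T = 2"
  using triangles by (rule aff_dim_simplex)

lemma affine_hull_mesh: "T \<in> \<T> \<Longrightarrow> affine hull T = UNIV"
  using aff_dim_mesh[of T] by (simp flip: aff_dim_eq_full)

lemma affine_hull_corners: "T \<in> \<T> \<Longrightarrow> affine hull (corners T) = UNIV"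
  using affine_hull_mesh[of T] corners_simplex(4)[of T] by (metis affine_hull_convex_hull)

lemma interior_mesh: "T \<in> \<T> \<Longrightarrow> interior T \<noteq> {}"
proof -
  assume T: "T \<in> \<T>"
  then have "T \<noteq> {}" using corners_simplex(2)[OF T] corners_subset[of T] by force
  then have "rel_interior T \<noteq> {}" using convex_mesh[OF T] by (simp add: rel_interior_eq_empty)
  then show ?thesis using affine_hull_mesh[OF T] by (simp add: rel_interior_interior)
qed

lemma
  assumes "T \<in> \<T>"
  shows bary_affine: "\<exists>\<alpha> \<beta>. bary T z = (\<lambda>x. \<alpha> + \<beta> \<bullet> x)"
    and bary_corner: "s \<in> corners T \<Longrightarrow> bary T z s = (if s = z then 1 else 0)"
proof -
  obtain \<alpha> \<beta> where "\<And>s. s \<in> corners T \<Longrightarrow> \<alpha> + \<beta> \<bullet> s = (if s = z then 1 else 0)"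
    using affine_interpolation[OF corners_simplex(3)[OF assms], of "\<lambda>s. if s = z then 1 else 0"] by blast
  then have "\<exists>l. (\<exists>\<alpha> \<beta>. l = (\<lambda>x. \<alpha> + \<beta> \<bullet> x)) \<and> (\<forall>s\<in>corners T. l s = (if s = z then 1 else 0))"
    by (intro exI[of _ "\<lambda>x. \<alpha> + \<beta> \<bullet> x"]) auto
  from someI_ex[OF this]
  have *: "(\<exists>\<alpha> \<beta>. bary T z = (\<lambda>x. \<alpha> + \<beta> \<bullet> x)) \<and> (\<forall>s\<in>corners T. bary T z s = (if s = z then 1 else 0))"
    unfolding bary_def[symmetric] .
  show "\<exists>\<alpha> \<beta>. bary T z = (\<lambda>x. \<alpha> + \<beta> \<bullet> x)" using * by blast
  show "s \<in> corners T \<Longrightarrow> bary T z s = (if s = z then 1 else 0)" using * by blast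
qed

text \<open>The affine hull of the corners is the plane, so \<open>x\<close> may lie outside
  \<open>T\<close>; evaluating \<open>bary T z\<close> on an affine combination of corners reads off
  its coefficient at \<open>z\<close>.\<close>

lemma affine_bary:
  assumes "T \<in> \<T>"
  shows "\<alpha> + \<beta> \<bullet> x = (\<Sum>s\<in>corners T. bary T s x * (\<alpha> + \<beta> \<bullet> s))"
    and bary_sum: "(\<Sum>s\<in>corners T. bary T s x) = 1"
    and bary_point: "(\<Sum>s\<in>corners T. bary T s x *\<^sub>R s) = x"
proof -
  note fin = corners_simplex(1)[OF assms]
  have "x \<in> affine hull (corners T)" using affine_hull_corners[OF assms] by simp
  then obtain u where u: "sum u (corners T) = 1" "(\<Sum>v\<in>corners T. u v *\<^sub>R v) = x"
    unfolding affine_hull_finite[OF fin] by auto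
  have aff: "\<alpha> + \<beta> \<bullet> x = (\<Sum>v\<in>corners T. u v * (\<alpha> + \<beta> \<bullet> v))" for \<alpha> \<beta>
    using u(1) by (simp add: u(2)[symmetric] inner_sum_right distrib_left sum.distrib flip: sum_distrib_right)
  have uz: "bary T z x = u z" if z: "z \<in> corners T" for z
  proof -
    obtain \<alpha> \<beta> where ab: "bary T z = (\<lambda>x. \<alpha> + \<beta> \<bullet> x)" using bary_affine[OF assms] by blast
    have "bary T z x = (\<Sum>v\<in>corners T. u v * bary T z v)" unfolding ab by (rule aff)
    also have "\<dots> = (\<Sum>v\<in>corners T. if v = z then u v else 0)"
      by (intro sum.cong) (auto simp: bary_corner[OF assms])
    finally show ?thesis using z fin by simp
  qed
  show "\<alpha> + \<beta> \<bullet> x = (\<Sum>s\<in>corners T. bary T s x * (\<alpha> + \<beta> \<bullet> s))"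
    unfolding aff[of \<alpha> \<beta>] by (intro sum.cong) (auto simp: uz)
  have "(\<Sum>s\<in>corners T. bary T s x) = sum u (corners T)" by (intro sum.cong) (auto simp: uz)
  then show "(\<Sum>s\<in>corners T. bary T s x) = 1" using u(1) by (rule trans)
  have "(\<Sum>s\<in>corners T. bary T s x *\<^sub>R s) = (\<Sum>v\<in>corners T. u v *\<^sub>R v)"
    by (intro sum.cong) (auto simp: uz)
  then show "(\<Sum>s\<in>corners T. bary T s x *\<^sub>R s) = x" using u(2) by (rule trans)
qed

lemma mem_mesh_iff: "T \<in> \<T> \<Longrightarrow> x \<in> T \<longleftrightarrow> (\<forall>s\<in>corners T. 0 \<le> bary T s x)"
proof
  assume T: "T \<in> \<T>" and x: "x \<in> T"
  show "\<forall>s\<in>corners T. 0 \<le> bary T s x"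
  proof
    fix s
    obtain \<alpha> \<beta> where ab: "bary T s = (\<lambda>x. \<alpha> + \<beta> \<bullet> x)" using bary_affine[OF T] by blast
    have "{x. 0 \<le> bary T s x} = {x. \<beta> \<bullet> x \<ge> - \<alpha>}" by (auto simp: ab)
    then have "convex {x. 0 \<le> bary T s x}" by (simp add: convex_halfspace_ge)
    moreover have "corners T \<subseteq> {x. 0 \<le> bary T s x}" by (auto simp: bary_corner[OF T])
    ultimately have "convex hull (corners T) \<subseteq> {x. 0 \<le> bary T s x}" by (rule hull_minimal[rotated])
    then show "0 \<le> bary T s x" using x corners_simplex(4)[OF T] by blast
  qed
next
  assume T: "T \<in> \<T>" and *: "\<forall>s\<in>corners T. 0 \<le> bary T s x"
  then have "x \<in> convex hull (corners T)"
    unfolding convex_hull_finite[OF corners_simplex(1)[OF T]]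
    by (intro CollectI exI[of _ "\<lambda>s. bary T s x"] conjI bary_sum[OF T] bary_point[OF T])
  then show "x \<in> T" using corners_simplex(4)[OF T] by simp
qed

lemma bary_no_corner: "T \<in> \<T> \<Longrightarrow> z \<notin> corners T \<Longrightarrow> bary T z x = 0"
proof -
  assume T: "T \<in> \<T>" and z: "z \<notin> corners T"
  obtain \<alpha> \<beta> where ab: "bary T z = (\<lambda>x. \<alpha> + \<beta> \<bullet> x)" using bary_affine[OF T] by blast
  have "bary T z x = (\<Sum>s\<in>corners T. bary T s x * bary T z s)" unfolding ab by (rule affine_bary[OF T])
  also have "\<dots> = 0" using z by (intro sum.neutral) (auto simp: bary_corner[OF T])
  finally show ?thesis .
qed

lemma bary_nonneg: "T \<in> \<T> \<Longrightarrow> x \<in> T \<Longrightarrow> 0 \<le> bary T z x"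
  by (cases "z \<in> corners T") (auto simp: mem_mesh_iff bary_no_corner)

text \<open>Excludes hanging nodes: an extreme point of one triangle is extreme in the common face,
  and extreme points of a face are extreme in the other triangle.\<close>

lemma corner_of_mesh_vertex:
  assumes "z \<in> vertices" "T \<in> \<T>" "z \<in> T"
  shows "z \<in> corners T"
proof -
  obtain T' where T': "T' \<in> \<T>" "z extreme_point_of T'" using assms by (auto simp: mesh_vertices_def)
  then have "z \<in> T'" by (simp add: extreme_point_of_def)
  then have "z extreme_point_of (T' \<inter> T)"
    using extreme_point_of_face[OF face_mesh[OF T'(1) assms(2)]] T' assms by simp
  then show ?thesis
    using extreme_point_of_face[OF face_mesh[OF assms(2) T'(1)]] by (simp add: corners_def Int_commute)
qed

text \<open>The common face is the convex hull of its extreme points, which are corners of both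
  triangles; there the two affine functions take the same values.\<close>

lemma bary_agree:
  assumes T: "T \<in> \<T>" "T' \<in> \<T>" and x: "x \<in> T" "x \<in> T'"
  shows "bary T z x = bary T' z x"
proof -
  let ?F = "T \<inter> T'"
  have FT: "?F face_of T" "?F face_of T'" using face_mesh[OF T] face_mesh[OF T(2,1)] by (simp_all add: Int_commute)
  have "compact ?F" "convex ?F"
    using T by (auto intro: compact_Int convex_Int compact_mesh convex_mesh)
  then have F: "?F = convex hull {y. y extreme_point_of ?F}" by (rule Krein_Milman_Minkowski)
  obtain \<alpha> \<beta> \<alpha>' \<beta>' where ab: "bary T z = (\<lambda>x. \<alpha> + \<beta> \<bullet> x)" "bary T' z = (\<lambda>x. \<alpha>' + \<beta>' \<bullet> x)"
    using bary_affine T by metis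
  have "{y. bary T z y = bary T' z y} = {y. (\<beta> - \<beta>') \<bullet> y = \<alpha>' - \<alpha>}"
    by (auto simp: ab inner_diff_left)
  then have "convex {y. bary T z y = bary T' z y}" by (simp add: convex_hyperplane)
  moreover have "bary T z y = bary T' z y" if "y extreme_point_of ?F" for y
  proof -
    have "y \<in> corners T" "y \<in> corners T'"
      using that extreme_point_of_face[OF FT(1)] extreme_point_of_face[OF FT(2)] by (auto simp: corners_def)
    then show ?thesis using bary_corner T by simp
  qed
  ultimately have "convex hull {y. y extreme_point_of ?F} \<subseteq> {y. bary T z y = bary T' z y}"
    by (intro hull_minimal) auto
  then show ?thesis using F x by blast
qed

text \<open>The piecewise linear nodal function of \<open>z\<close>; by \<open>bary_agree\<close>
  the choice of the triangle is immaterial.\<close>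

definition hat :: "plane \<Rightarrow> plane \<Rightarrow> real" where
  "hat z x = (if x \<in> \<Union>\<T> then bary (SOME T. T \<in> \<T> \<and> x \<in> T) z x else 0)"

lemma hat_eq: "T \<in> \<T> \<Longrightarrow> x \<in> T \<Longrightarrow> hat z x = bary T z x"
proof -
  assume T: "T \<in> \<T>" "x \<in> T"
  then have "(SOME T. T \<in> \<T> \<and> x \<in> T) \<in> \<T> \<and> x \<in> (SOME T. T \<in> \<T> \<and> x \<in> T)"
    by (intro someI[where P = "\<lambda>T. T \<in> \<T> \<and> x \<in> T"]) simp
  then have "bary (SOME T. T \<in> \<T> \<and> x \<in> T) z x = bary T z x" using T by (intro bary_agree) auto
  moreover have "hat z x = bary (SOME T. T \<in> \<T> \<and> x \<in> T) z x" using T unfolding hat_def by (subst if_P) blast+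
  ultimately show ?thesis by (rule trans[rotated])
qed

lemma hat_outside: "x \<notin> \<Union>\<T> \<Longrightarrow> hat z x = 0"
  by (simp add: hat_def)

lemma hat_nonneg: "0 \<le> hat z x"
  by (cases "x \<in> \<Union>\<T>") (auto simp: hat_outside hat_eq bary_nonneg)

lemma hat_vertex:
  assumes "y \<in> vertices"
  shows "hat z y = (if y = z then 1 else 0)"
proof -
  obtain T where T: "T \<in> \<T>" "y \<in> corners T" using assms by (auto simp: mesh_vertices_def corners_def)
  then show ?thesis using hat_eq[OF T(1), of y z] corners_subset[of T] bary_corner[OF T(1)] by auto
qed

lemma continuous_on_bary: "T \<in> \<T> \<Longrightarrow> continuous_on S (bary T z)"
  using bary_affine[of T z] by (auto intro!: continuous_intros)

lemma continuous_on_mesh: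
  fixes F :: "plane \<Rightarrow> 'a::topological_space"
  assumes "\<And>T. T \<in> \<T> \<Longrightarrow> continuous_on T F"
  shows "continuous_on (\<Union>\<T>) F"
  using continuous_on_closed_Union[of \<T> id F] finite_mesh closed_mesh assms by simp

lemma continuous_on_hat: "continuous_on (\<Union>\<T>) (hat z)"
proof (rule continuous_on_mesh)
  fix T assume T: "T \<in> \<T>"
  show "continuous_on T (hat z)"
    using continuous_on_bary[OF T] by (rule continuous_on_eq) (simp add: hat_eq[OF T])
qed

text \<open>Contracting a point towards \<open>z\<close> moves it into a neighbourhood covered by the triangles
  at \<open>z\<close>; as long as \<open>hat z\<close> stays positive, the point itself lies in the same triangle.\<close>

lemma interior_if_hat_pos:
  assumes z: "z \<in> vertices" "z \<in> interior (\<Union>\<T>)" and pos: "0 < hat z x"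
  shows "x \<in> interior (\<Union>\<T>)"
proof -
  have xU: "x \<in> \<Union>\<T>" using pos hat_outside[of x z] by fastforce
  then obtain T where T: "T \<in> \<T>" "x \<in> T" by blast
  have zT: "z \<in> corners T"
    using pos hat_eq[OF T, of z] bary_no_corner[OF T(1), of z x] by fastforce
  let ?far = "\<Union>{T \<in> \<T>. z \<notin> T}"
  have "closed ?far" using finite_mesh closed_mesh by (intro closed_Union) auto
  then have "open (interior (\<Union>\<T>) - ?far)" by (intro open_Diff) auto
  moreover have "z \<in> interior (\<Union>\<T>) - ?far" using z by auto
  ultimately obtain \<epsilon> where \<epsilon>: "0 < \<epsilon>" "ball z \<epsilon> \<subseteq> interior (\<Union>\<T>) - ?far"
    by (meson openE)
  \<comment> \<open>Small enough that the contraction \<open>c\<close> maps the unit ball around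
    \<open>x\<close> into the neighbourhood of \<open>z\<close> met only by triangles at
    \<open>z\<close>. The added 1 is the radius of that unit ball and keeps the quotient defined for
    \<open>x = z\<close>.\<close>
  define s where "s = min 1 (\<epsilon> / (2 * (dist x z + 1)))"
  have dz: "0 < dist x z + 1" by (rule add_nonneg_pos) auto
  have s: "0 < s" "s \<le> 1" using \<epsilon>(1) dz by (auto simp: s_def)
  have "s \<le> \<epsilon> / (2 * (dist x z + 1))" by (simp add: s_def)
  then have s_le: "s * (dist x z + 1) < \<epsilon>"
    using dz \<epsilon>(1) by (simp add: field_simps)
  define c where "c y = z + s *\<^sub>R (y - z)" for y
  have c_ball: "c y \<in> ball z \<epsilon>" if "dist y x < 1" for y
  proof -
    have "dist z (c y) = s * dist y z" using s by (simp add: c_def dist_norm norm_minus_commute)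
    also have "\<dots> \<le> s * (dist x z + 1)"
      using dist_triangle[of y z x] that s by (intro mult_left_mono) auto
    finally show ?thesis using s_le by simp
  qed
  have c_aff: "\<alpha> + \<beta> \<bullet> c y = (1 - s) * (\<alpha> + \<beta> \<bullet> z) + s * (\<alpha> + \<beta> \<bullet> y)" for \<alpha> \<beta> y
    by (simp add: c_def inner_add_right inner_diff_right algebra_simps)
  have c_bary: "bary T' w (c y) = (1 - s) * (if z = w then 1 else 0) + s * bary T' w y"
    if T': "T' \<in> \<T>" "z \<in> corners T'" for T' w y
  proof -
    obtain \<alpha> \<beta> where ab: "bary T' w = (\<lambda>x. \<alpha> + \<beta> \<bullet> x)" using bary_affine[OF T'(1)] by blast
    show ?thesis using c_aff[of \<alpha> \<beta> y] bary_corner[OF T', of w] by (simp only: ab)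
  qed
  have "c x = (1 - s) *\<^sub>R z + s *\<^sub>R x" by (simp add: c_def algebra_simps)
  then have cxT: "c x \<in> T"
    using convexD_alt[OF convex_mesh[OF T(1)] subsetD[OF corners_subset zT] T(2), of s] s by simp
  \<comment> \<open>On a triangle \<open>T'\<close> at \<open>z\<close> the contraction gives
    \<open>bary T' z (c y) = 1 - s + s * bary T' z y\<close>. Exceeding \<open>1 - s\<close> is thus
    an open condition that carries positivity of the coordinate from \<open>x\<close> over to all
    nearby \<open>y\<close>.\<close>
  have hat_cx: "1 - s < hat z (c x)"
    using c_bary[OF T(1) zT, of z x] pos s unfolding hat_eq[OF T(1) cxT, of z] hat_eq[OF T, of z] by simp
  have "continuous_on (ball z \<epsilon>) (hat z)"
    using \<epsilon>(2) interior_subset by (intro continuous_on_subset[OF continuous_on_hat]) blast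
  moreover have "c x \<in> ball z \<epsilon>" using c_ball[of x] by simp
  ultimately have "isCont (hat z) (c x)" by (simp add: continuous_on_eq_continuous_at)
  moreover have "isCont c x" unfolding c_def by (intro continuous_intros)
  ultimately have "isCont (\<lambda>y. hat z (c y)) x" by (rule isCont_o2[rotated])
  then have "\<forall>\<^sub>F y in at x. 1 - s < hat z (c y)"
    using hat_cx by (auto simp: isCont_def intro: order_tendstoD)
  then have "\<forall>\<^sub>F y in nhds x. 1 - s < hat z (c y)"
    using hat_cx by (simp add: eventually_nhds_conv_at)
  moreover have "\<forall>\<^sub>F y in nhds x. dist y x < 1"
    by (simp add: eventually_nhds_metric) (auto intro: exI[of _ 1])
  ultimately have "\<forall>\<^sub>F y in nhds x. y \<in> \<Union>\<T>"
  proof eventually_elim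
    case (elim y)
    then have cb: "c y \<in> ball z \<epsilon>" using c_ball by blast
    then obtain T' where T': "T' \<in> \<T>" "c y \<in> T'" using \<epsilon>(2) interior_subset by blast
    then have "z \<in> T'" using \<epsilon>(2) cb by blast
    then have zT': "z \<in> corners T'" using corner_of_mesh_vertex[OF z(1) T'(1)] by blast
    have "0 \<le> bary T' w y" if w: "w \<in> corners T'" for w
    proof (cases "z = w")
      case True
      then have "0 < s * bary T' w y"
        using elim(1) hat_eq[OF T', of z] c_bary[OF T'(1) zT', of w y] by simp
      then show ?thesis using s by (simp add: zero_less_mult_iff)
    next
      case False
      then have "0 \<le> s * bary T' w y"
        using bary_nonneg[OF T', of w] c_bary[OF T'(1) zT', of w y] by simp
      then show ?thesis using s by (simp add: zero_le_mult_iff)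
    qed
    then have "y \<in> T'" using mem_mesh_iff[OF T'(1)] by blast
    then show ?case using T' by blast
  qed
  then obtain S where "open S" "x \<in> S" "\<forall>y\<in>S. y \<in> \<Union>\<T>" unfolding eventually_nhds by blast
  then show ?thesis by (intro interiorI[of S]) blast+
qed

text \<open>Equal dimension prevents one triangle from being a face of another, so the common face
  is proper and lies in the frontier of a convex set.\<close>

lemma negligible_mesh_Int:
  assumes "T \<in> \<T>" "T' \<in> \<T>" "T \<noteq> T'"
  shows "negligible (T \<inter> T')"
proof -
  have "T \<inter> T' \<noteq> T"
  proof
    assume TT: "T \<inter> T' = T"
    then have "T face_of T'" using face_mesh[OF assms(2,1)] by (simp add: Int_commute)
    then have "aff_dim T < aff_dim T'"
      using face_of_aff_dim_lt[OF convex_mesh[OF assms(2)]] assms(3) by blast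
    then show False using aff_dim_mesh assms by simp
  qed
  then have "(T \<inter> T') \<inter> interior T = {}"
    using face_of_disjoint_interior[OF face_mesh[OF assms(1,2)]] by blast
  then have "T \<inter> T' \<subseteq> frontier T"
    using closed_mesh[OF assms(1)] by (auto simp: frontier_def)
  then show ?thesis
    using negligible_convex_frontier[OF convex_mesh[OF assms(1)]] negligible_subset by blast
qed

lemma closure_interior_mesh: "T \<in> \<T> \<Longrightarrow> closure (interior T) = T"
  using convex_closure_interior[OF convex_mesh interior_mesh] closed_mesh by simp

end


section \<open>Integrals of piecewise continuous functions\<close>

lemma compact_absolutely_integrable:
  fixes G :: "'a::euclidean_space \<Rightarrow> real"
  assumes "compact T" "continuous_on T G"
  shows "G absolutely_integrable_on T"
proof -
  obtain B where B: "\<And>x. x \<in> T \<Longrightarrow> norm (G x) \<le> B"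
    using compact_imp_bounded[OF compact_continuous_image[OF assms(2,1)]] by (auto simp: bounded_iff)
  have T: "T \<in> lmeasurable" using assms(1) by (rule lmeasurable_compact)
  show ?thesis
  proof (rule measurable_bounded_by_integrable_imp_absolutely_integrable)
    show "G \<in> borel_measurable (lebesgue_on T)"
      using assms(2) T by (intro continuous_imp_measurable_on_sets_lebesgue) auto
    show "T \<in> sets lebesgue" using T by auto
    show "(\<lambda>x. B) integrable_on T" using T by (rule integrable_on_const)
  qed (use B in auto)
qed

text \<open>\<open>regular\<close> excludes slits, i.e. boundary points inside the closure; with it
  the interior of the covered set is exactly \<open>\<Omega>\<close>. The last assumption lets
  integrals over \<open>\<Omega>\<close> be computed triangle by triangle.\<close>

locale domain_mesh = triangle_mesh +
  fixes \<Omega> :: "plane set"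
  assumes open_domain: "open \<Omega>" and connected_domain: "connected \<Omega>" and domain_nonempty: "\<Omega> \<noteq> {}"
    and cover: "\<Union>\<T> = closure \<Omega>"
    and regular: "frontier \<Omega> \<inter> interior (closure \<Omega>) = {}"
    and negligible_frontier_domain: "negligible (frontier \<Omega>)"
begin

abbreviation "area \<equiv> lebesgue_on \<Omega>"

lemma interior_cover: "interior (\<Union>\<T>) = \<Omega>"
proof
  show "interior (\<Union>\<T>) \<subseteq> \<Omega>"
    unfolding cover using regular interior_subset[of "closure \<Omega>"] open_domain
    by (auto simp: frontier_def interior_open)
  show "\<Omega> \<subseteq> interior (\<Union>\<T>)"
    unfolding cover using open_domain closure_subset by (intro interior_maximal)
qed

lemma interior_mesh_subset: "T \<in> \<T> \<Longrightarrow> interior T \<subseteq> \<Omega>"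
  using interior_mono[of T "\<Union>\<T>"] interior_cover by blast

lemma sets_domain [measurable, simp]: "\<Omega> \<in> sets lebesgue"
  using open_domain by auto

lemma compact_closure_domain: "compact (closure \<Omega>)"
  unfolding cover[symmetric] using finite_mesh compact_mesh by (rule compact_Union)

text \<open>Each piece extends continuously to its closed triangle, but nothing is said about values
  on the sides: derivatives of finite element functions jump there, and \<open>deriv\<close> may be
  unspecified.\<close>

definition pw :: "(plane \<Rightarrow> real) \<Rightarrow> bool" where
  "pw F \<longleftrightarrow> (\<forall>T\<in>\<T>. \<exists>G. continuous_on T G \<and> (\<forall>x\<in>interior T. F x = G x))"

lemma pwI: "(\<And>T. T \<in> \<T> \<Longrightarrow> continuous_on T G) \<Longrightarrow> (\<And>T x. T \<in> \<T> \<Longrightarrow> x \<in> interior T \<Longrightarrow> F x = G x) \<Longrightarrow> pw F"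
  unfolding pw_def by blast

lemma pw_const: "pw (\<lambda>x. c)"
  unfolding pw_def by (intro ballI exI[of _ "\<lambda>x. c"]) auto

lemma pw_map2:
  assumes "pw F" "pw G" and op: "\<And>T F G :: plane \<Rightarrow> real. continuous_on T F \<Longrightarrow> continuous_on T G \<Longrightarrow> continuous_on T (\<lambda>x. op (F x) (G x))"
  shows "pw (\<lambda>x. op (F x) (G x))"
  unfolding pw_def
proof
  fix T assume "T \<in> \<T>"
  then obtain F' G' where "continuous_on T F'" "\<forall>x\<in>interior T. F x = F' x"
    "continuous_on T G'" "\<forall>x\<in>interior T. G x = G' x"
    using assms(1,2) unfolding pw_def by meson
  then show "\<exists>H. continuous_on T H \<and> (\<forall>x\<in>interior T. op (F x) (G x) = H x)"
    by (intro exI[of _ "\<lambda>x. op (F' x) (G' x)"]) (simp add: op)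
qed

lemma pw_add: "pw F \<Longrightarrow> pw G \<Longrightarrow> pw (\<lambda>x. F x + G x)"
  by (rule pw_map2) (auto intro: continuous_on_add)

lemma pw_mult: "pw F \<Longrightarrow> pw G \<Longrightarrow> pw (\<lambda>x. F x * G x)"
  by (rule pw_map2) (auto intro: continuous_on_mult)

text \<open>Frontiers and overlaps of triangles and the frontier of the domain are null sets, so
  \<open>F\<close> can be replaced by \<open>G T\<close> on each triangle, whatever its values on
  the sides.\<close>

lemma piecewise_integral:
  fixes F :: "plane \<Rightarrow> real"
  assumes G: "\<And>T. T \<in> \<T> \<Longrightarrow> continuous_on T (G T)"
    and F: "\<And>T x. T \<in> \<T> \<Longrightarrow> x \<in> interior T \<Longrightarrow> F x = G T x"
  shows "integrable area F" "(\<integral>x. F x \<partial>area) = (\<Sum>T\<in>\<T>. integral T (G T))"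
proof -
  have abs: "F absolutely_integrable_on T" "(F has_integral integral T (G T)) T" if T: "T \<in> \<T>" for T
  proof -
    have G_abs: "G T absolutely_integrable_on T"
      using compact_absolutely_integrable[OF compact_mesh[OF T] G[OF T]] .
    have neg: "negligible (frontier T)" using negligible_convex_frontier[OF convex_mesh[OF T]] .
    have F_eq: "F x = G T x" if "x \<in> T - frontier T" for x
      using F[OF T] that closed_mesh[OF T] by (auto simp: frontier_def)
    show "F absolutely_integrable_on T"
      using absolutely_integrable_spike[OF G_abs neg F_eq] .
    have "(G T has_integral integral T (G T)) T"
      using G_abs set_lebesgue_integral_eq_integral(1) by (metis integrable_integral)
    then show "(F has_integral integral T (G T)) T"
      by (rule has_integral_spike[OF neg, rotated]) (rule F_eq)
  qed
  have "F absolutely_integrable_on (\<Union>\<T>)"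
  proof -
    have "F absolutely_integrable_on (\<Union>S)" if "S \<subseteq> \<T>" for S
      using finite_subset[OF that finite_mesh] that
      by (induction S) (auto intro: absolutely_integrable_Un abs(1))
    then show ?thesis by blast
  qed
  moreover have "(F has_integral (\<Sum>T\<in>\<T>. integral T (G T))) (\<Union>\<T>)"
    using finite_mesh abs(2) negligible_mesh_Int
    by (intro has_integral_Union) (auto simp: pairwise_def)
  moreover have "sym_diff (\<Union>\<T>) \<Omega> \<subseteq> frontier \<Omega>"
    unfolding cover using open_domain closure_subset by (auto simp: frontier_def interior_open)
  then have neg: "negligible (sym_diff (\<Union>\<T>) \<Omega>)" "negligible {x \<in> \<Union>\<T> - \<Omega>. F x \<noteq> 0}" "negligible {x \<in> \<Omega> - \<Union>\<T>. F x \<noteq> 0}"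
    by (auto intro!: negligible_subset[OF negligible_frontier_domain])
  ultimately have "F absolutely_integrable_on \<Omega>" and hi: "(F has_integral (\<Sum>T\<in>\<T>. integral T (G T))) \<Omega>"
    using absolutely_integrable_spike_set[OF _ neg(2,3)] has_integral_spike_set_eq[OF neg(2,3)] by blast+
  then show int: "integrable area F" by (intro absolutely_integrable_imp_integrable) auto
  show "(\<integral>x. F x \<partial>area) = (\<Sum>T\<in>\<T>. integral T (G T))"
    using lebesgue_integral_eq_integral[OF int] integral_unique[OF hi] by simp
qed

lemma pw_integrable: "pw F \<Longrightarrow> integrable area F"
proof -
  assume "pw F"
  then obtain G where "\<And>T. T \<in> \<T> \<Longrightarrow> continuous_on T (G T) \<and> (\<forall>x\<in>interior T. F x = G T x)"
    unfolding pw_def by metis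
  then show ?thesis by (intro piecewise_integral(1)[of G]) auto
qed

lemma pw_integral_cong:
  assumes "pw F" "\<And>T x. T \<in> \<T> \<Longrightarrow> x \<in> interior T \<Longrightarrow> F x = F' x"
  shows "(\<integral>x. F x \<partial>area) = (\<integral>x. F' x \<partial>area)"
proof -
  obtain G where G: "\<And>T. T \<in> \<T> \<Longrightarrow> continuous_on T (G T) \<and> (\<forall>x\<in>interior T. F x = G T x)"
    using assms(1) unfolding pw_def by metis
  have "(\<integral>x. F x \<partial>area) = (\<Sum>T\<in>\<T>. integral T (G T))"
    using G by (intro piecewise_integral(2)) auto
  moreover have "(\<integral>x. F' x \<partial>area) = (\<Sum>T\<in>\<T>. integral T (G T))"
    using G assms(2) by (intro piecewise_integral(2)) auto
  ultimately show ?thesis by simp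
qed

lemma pw_integral_add:
  assumes "pw F" "pw F'" "\<And>T x. T \<in> \<T> \<Longrightarrow> x \<in> interior T \<Longrightarrow> H x = F x + F' x"
  shows "(\<integral>x. H x \<partial>area) = (\<integral>x. F x \<partial>area) + (\<integral>x. F' x \<partial>area)"
proof -
  have "(\<integral>x. H x \<partial>area) = (\<integral>x. F x + F' x \<partial>area)"
    using assms(3) by (intro pw_integral_cong[symmetric] pw_add assms(1,2)) auto
  then show ?thesis using pw_integrable assms(1,2) by simp
qed

lemma pw_integral_scale:
  assumes "pw F" "\<And>T x. T \<in> \<T> \<Longrightarrow> x \<in> interior T \<Longrightarrow> H x = c * F x"
  shows "(\<integral>x. H x \<partial>area) = c * (\<integral>x. F x \<partial>area)"
proof -
  have "(\<integral>x. H x \<partial>area) = (\<integral>x. c * F x \<partial>area)"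
    using assms(2) by (intro pw_integral_cong[symmetric] pw_mult pw_const assms(1)) auto
  then show ?thesis by simp
qed

lemma AE_interior_mesh: "AE x in area. \<exists>T\<in>\<T>. x \<in> interior T"
proof -
  let ?N = "\<Union>T\<in>\<T>. frontier T"
  have "negligible ?N"
    using finite_mesh negligible_convex_frontier convex_mesh by (intro negligible_Union) auto
  then have N: "?N \<in> null_sets lebesgue" by (simp add: negligible_iff_null_sets)
  have "AE x in lebesgue. x \<in> \<Omega> \<longrightarrow> (\<exists>T\<in>\<T>. x \<in> interior T)"
  proof (rule AE_I'[OF N], rule subsetI)
    fix x assume "x \<in> {x \<in> space lebesgue. \<not> (x \<in> \<Omega> \<longrightarrow> (\<exists>T\<in>\<T>. x \<in> interior T))}"
    then have x: "x \<in> \<Omega>" and no: "\<not> (\<exists>T\<in>\<T>. x \<in> interior T)" by auto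
    have "x \<in> \<Union>\<T>" using x cover closure_subset by blast
    then obtain T where T: "T \<in> \<T>" "x \<in> T" by blast
    then have "x \<in> frontier T" using no closed_mesh[OF T(1)] by (auto simp: frontier_def)
    then show "x \<in> ?N" using T by blast
  qed
  then show ?thesis by (simp add: AE_restrict_space_iff)
qed

lemma pw_integral_nonneg:
  fixes F :: "plane \<Rightarrow> real"
  assumes "\<And>T x. T \<in> \<T> \<Longrightarrow> x \<in> interior T \<Longrightarrow> 0 \<le> F x"
  shows "0 \<le> (\<integral>x. F x \<partial>area)"
proof (rule Bochner_Integration.integral_nonneg_AE)
  show "AE x in area. 0 \<le> F x"
    using AE_interior_mesh by (rule eventually_mono) (use assms in blast)
qed

text \<open>A nonzero value at an interior point would persist, by continuity, on a nonempty open
  set, which is not a null set.\<close>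

lemma pw_integral_eq_0:
  assumes F: "pw F" and nonneg: "\<And>T x. T \<in> \<T> \<Longrightarrow> x \<in> interior T \<Longrightarrow> 0 \<le> F x"
    and zero: "(\<integral>x. F x \<partial>area) = 0" and x: "T \<in> \<T>" "x \<in> interior T"
  shows "F x = 0"
proof (rule ccontr)
  assume Fx: "F x \<noteq> 0"
  obtain G where G: "continuous_on T G" "\<And>x. x \<in> interior T \<Longrightarrow> F x = G x"
    using F x(1) unfolding pw_def by blast
  have "continuous_on (interior T) G" using G(1) interior_subset continuous_on_subset by blast
  then have op: "open (interior T \<inter> G -` (- {0}))"
    by (intro continuous_open_preimage) auto
  have "AE x in area. 0 \<le> F x"
    using AE_interior_mesh by (rule eventually_mono) (use nonneg in blast)
  then have "AE x in area. F x = 0"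
    using integral_nonneg_eq_0_iff_AE[OF pw_integrable[OF F]] zero by blast
  then have "AE x in lebesgue. x \<in> \<Omega> \<longrightarrow> F x = 0" by (simp add: AE_restrict_space_iff)
  then obtain N where N: "N \<in> null_sets lebesgue" "\<And>x. x \<in> space lebesgue - N \<Longrightarrow> x \<in> \<Omega> \<longrightarrow> F x = 0"
    by (rule AE_E3) blast
  have "interior T \<inter> G -` (- {0}) \<subseteq> N"
    using N(2) interior_mesh_subset[OF x(1)] G(2) by fastforce
  then have "negligible (interior T \<inter> G -` (- {0}))"
    using N(1) negligible_subset by (auto simp: negligible_iff_null_sets)
  then show False using open_not_negligible[OF op] Fx x(2) G(2) by auto
qed

end

section \<open>Piecewise polynomials and their derivatives\<close>

lemma poly_le_1: "p \<in> poly_le 1 \<longleftrightarrow> (\<exists>\<alpha> \<beta>. p = (\<lambda>x. \<alpha> + \<beta> \<bullet> x))"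
proof
  assume "p \<in> poly_le 1"
  then obtain c where c: "\<And>x. p x = (\<Sum>i\<le>1. \<Sum>j\<le>1 - i. c i j * (x $ 1) ^ i * (x $ 2) ^ j)"
    by (auto simp: poly_le_def)
  have "p = (\<lambda>x. c 0 0 + vector [c 1 0, c 0 1] \<bullet> x)"
    by (rule ext) (simp add: c inner_vec_def sum_2)
  then show "\<exists>\<alpha> \<beta>. p = (\<lambda>x. \<alpha> + \<beta> \<bullet> x)" by blast
next
  assume "\<exists>\<alpha> \<beta>. p = (\<lambda>x. \<alpha> + \<beta> \<bullet> x)"
  then obtain \<alpha> \<beta> where p: "p = (\<lambda>x. \<alpha> + \<beta> \<bullet> x)" by blast
  let ?c = "\<lambda>i j :: nat. if i = 1 then \<beta> $ 1 else if j = 1 then \<beta> $ 2 else \<alpha>"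
  have "p x = (\<Sum>i\<le>1. \<Sum>j\<le>1 - i. ?c i j * (x $ 1) ^ i * (x $ 2) ^ j)" for x
    by (simp add: p inner_vec_def sum_2)
  then show "p \<in> poly_le 1" unfolding poly_le_def by (intro CollectI exI[of _ ?c]) blast
qed

definition quadratic :: "real \<Rightarrow> real \<Rightarrow> real \<Rightarrow> real \<Rightarrow> real \<Rightarrow> real \<Rightarrow> plane \<Rightarrow> real" where
  "quadratic a b c d e f x =
     a + b * x $ 1 + c * x $ 2 + d * (x $ 1)\<^sup>2 + e * (x $ 1 * x $ 2) + f * (x $ 2)\<^sup>2"

lemma poly_le_2: "p \<in> poly_le 2 \<longleftrightarrow> (\<exists>a b c d e f. p = quadratic a b c d e f)"
proof
  assume "p \<in> poly_le 2"
  then obtain k where k: "\<And>x. p x = (\<Sum>i\<le>2. \<Sum>j\<le>2 - i. k i j * (x $ 1) ^ i * (x $ 2) ^ j)"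
    by (auto simp: poly_le_def)
  have "p = quadratic (k 0 0) (k 1 0) (k 0 1) (k 2 0) (k 1 1) (k 0 2)"
    by (rule ext) (simp add: k quadratic_def numeral_2_eq_2)
  then show "\<exists>a b c d e f. p = quadratic a b c d e f" by blast
next
  assume "\<exists>a b c d e f. p = quadratic a b c d e f"
  then obtain a b c d e f where p: "p = quadratic a b c d e f" by blast
  let ?k = "\<lambda>i j :: nat. if i = 0 then (if j = 0 then a else if j = 1 then c else f)
     else if i = 1 then (if j = 0 then b else e) else d"
  have "p x = (\<Sum>i\<le>2. \<Sum>j\<le>2 - i. ?k i j * (x $ 1) ^ i * (x $ 2) ^ j)" for x
    by (simp add: p quadratic_def numeral_2_eq_2)
  then show "p \<in> poly_le 2" unfolding poly_le_def by (intro CollectI exI[of _ ?k]) blast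
qed

definition quadratic_deriv :: "real \<Rightarrow> real \<Rightarrow> real \<Rightarrow> real \<Rightarrow> real \<Rightarrow> 2 \<Rightarrow> plane \<Rightarrow> real" where
  "quadratic_deriv b c d e f j x =
     (if j = 1 then b + 2 * d * x $ 1 + e * x $ 2 else c + e * x $ 1 + 2 * f * x $ 2)"

lemma has_real_derivative_quadratic:
  "((\<lambda>t. quadratic a b c d e f (x + t *\<^sub>R axis j 1)) has_real_derivative quadratic_deriv b c d e f j x) (at 0)"
proof -
  have j: "j = 1 \<or> j = 2" using exhaust_2 by blast
  have a: "axis 1 (1::real) $ (2::2) = 0" "axis 2 (1::real) $ (1::2) = 0" by (simp_all add: axis_def)
  show ?thesis
    using j unfolding quadratic_def quadratic_deriv_def
    by (elim disjE) (auto simp: a intro!: derivative_eq_intros)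
qed

lemma poly_le_add: "p \<in> poly_le k \<Longrightarrow> q \<in> poly_le k \<Longrightarrow> (\<lambda>x. p x + q x) \<in> poly_le k"
proof -
  assume "p \<in> poly_le k" "q \<in> poly_le k"
  then obtain c d where "\<forall>x. p x = (\<Sum>i\<le>k. \<Sum>j\<le>k - i. c i j * (x $ 1) ^ i * (x $ 2) ^ j)"
    "\<forall>x. q x = (\<Sum>i\<le>k. \<Sum>j\<le>k - i. d i j * (x $ 1) ^ i * (x $ 2) ^ j)" unfolding poly_le_def by blast
  then show ?thesis
    unfolding poly_le_def
    by (intro CollectI exI[of _ "\<lambda>i j. c i j + d i j"]) (simp add: sum.distrib distrib_right)
qed

lemma poly_le_scale: "p \<in> poly_le k \<Longrightarrow> (\<lambda>x. a * p x) \<in> poly_le k"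
proof -
  assume "p \<in> poly_le k"
  then obtain c where "\<forall>x. p x = (\<Sum>i\<le>k. \<Sum>j\<le>k - i. c i j * (x $ 1) ^ i * (x $ 2) ^ j)"
    unfolding poly_le_def by blast
  then show ?thesis
    unfolding poly_le_def
    by (intro CollectI exI[of _ "\<lambda>i j. a * c i j"]) (simp add: sum_distrib_left mult.assoc)
qed

lemma poly_le_2_mult: "p \<in> poly_le 1 \<Longrightarrow> q \<in> poly_le 1 \<Longrightarrow> (\<lambda>x. p x * q x) \<in> poly_le 2"
proof -
  assume "p \<in> poly_le 1" "q \<in> poly_le 1"
  then obtain \<alpha> \<beta> \<gamma> \<delta> where "p = (\<lambda>x. \<alpha> + \<beta> \<bullet> x)" "q = (\<lambda>x. \<gamma> + \<delta> \<bullet> x)" unfolding poly_le_1 by blast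
  then have "(\<lambda>x. p x * q x) = quadratic (\<alpha> * \<gamma>) (\<alpha> * \<delta> $ 1 + \<gamma> * \<beta> $ 1) (\<alpha> * \<delta> $ 2 + \<gamma> * \<beta> $ 2)
     (\<beta> $ 1 * \<delta> $ 1) (\<beta> $ 1 * \<delta> $ 2 + \<beta> $ 2 * \<delta> $ 1) (\<beta> $ 2 * \<delta> $ 2)"
    by (auto simp: quadratic_def fun_eq_iff inner_vec_def sum_2 algebra_simps power2_eq_square)
  then show ?thesis unfolding poly_le_2 by blast
qed

lemma poly_le_1_subset_2: "p \<in> poly_le 1 \<Longrightarrow> p \<in> poly_le 2"
proof -
  assume "p \<in> poly_le 1"
  moreover have "(\<lambda>x. 1) \<in> poly_le 1" unfolding poly_le_1 by (intro exI[of _ 1] exI[of _ 0]) auto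
  ultimately show ?thesis using poly_le_2_mult by fastforce
qed


lemma sum_fun_apply: "(\<Sum>i\<in>I. f i) x = (\<Sum>i\<in>I. f i x)"
  for f :: "'i \<Rightarrow> 'a \<Rightarrow> 'b::comm_monoid_add"
  by (induction I rule: infinite_finite_induct) auto

lemma poly_on_add: "poly_on k S v \<Longrightarrow> poly_on k S w \<Longrightarrow> poly_on k S (\<lambda>x. v x + w x)"
  unfolding poly_on_def using poly_le_add by (metis (no_types, lifting))

lemma poly_on_scale: "poly_on k S v \<Longrightarrow> poly_on k S (\<lambda>x. a * v x)"
  unfolding poly_on_def using poly_le_scale by (metis (no_types, lifting))

lemma poly_on_1_imp_2: "poly_on 1 S v \<Longrightarrow> poly_on 2 S v"
  unfolding poly_on_def using poly_le_1_subset_2 by blast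

lemma poly_on_0: "poly_on k S (\<lambda>x. 0)"
  unfolding poly_on_def poly_le_def by (intro bexI[of _ "\<lambda>x. 0"] CollectI exI[of _ "\<lambda>i j. 0"]) auto

lemma poly_on_2_mult: "poly_on 1 S v \<Longrightarrow> poly_on 1 S w \<Longrightarrow> poly_on 2 S (\<lambda>x. v x * w x)"
  unfolding poly_on_def using poly_le_2_mult by (metis (no_types, lifting))

lemma poly_on_subset: "poly_on k S v \<Longrightarrow> S' \<subseteq> S \<Longrightarrow> poly_on k S' v"
  unfolding poly_on_def by blast

lemma subspace_V_h: "subspace (V_h \<Omega> \<T>)"
proof (rule subspaceI)
  show "0 \<in> V_h \<Omega> \<T>" by (simp add: V_h_def zero_fun_def poly_on_0)
next
  fix u v assume "u \<in> V_h \<Omega> \<T>" "v \<in> V_h \<Omega> \<T>"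
  then show "u + v \<in> V_h \<Omega> \<T>"
    by (auto simp: V_h_def plus_fun_def intro: continuous_on_add poly_on_add)
next
  fix c v assume "v \<in> V_h \<Omega> \<T>"
  then show "c *\<^sub>R v \<in> V_h \<Omega> \<T>"
    by (auto simp: V_h_def scaleR_fun_def intro!: continuous_intros intro: poly_on_scale)
qed

lemma subspace_Q_h: "subspace (Q_h \<Omega> \<T>)"
proof (rule subspaceI)
  show "0 \<in> Q_h \<Omega> \<T>" by (simp add: Q_h_def zero_fun_def poly_on_0)
next
  fix p q assume "p \<in> Q_h \<Omega> \<T>" "q \<in> Q_h \<Omega> \<T>"
  then show "p + q \<in> Q_h \<Omega> \<T>"
    by (auto simp: Q_h_def plus_fun_def intro: continuous_on_add poly_on_add)
next
  fix c q assume "q \<in> Q_h \<Omega> \<T>"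
  then show "c *\<^sub>R q \<in> Q_h \<Omega> \<T>"
    by (auto simp: Q_h_def scaleR_fun_def intro!: continuous_intros
        intro: poly_on_scale)
qed

lemma affine_zero_on_open:
  fixes U :: "plane set"
  assumes "open U" "U \<noteq> {}" and zero: "\<And>x. x \<in> U \<Longrightarrow> a + b * x $ 1 + c * x $ 2 = 0"
  shows "a = 0 \<and> b = 0 \<and> c = 0"
proof -
  obtain x where x: "x \<in> U" using assms by blast
  then obtain e where e: "0 < e" "ball x e \<subseteq> U" using assms(1) openE by blast
  have "x + (e / 2) *\<^sub>R axis 1 1 \<in> U" "x + (e / 2) *\<^sub>R axis 2 1 \<in> U"
    using e by (auto intro!: subsetD[OF e(2)] simp: dist_norm norm_axis_1)
  from zero[OF this(1)] zero[OF this(2)]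
  have "a + b * x $ 1 + c * x $ 2 + b * (e / 2) = 0" "a + b * x $ 1 + c * x $ 2 + c * (e / 2) = 0"
    by (simp_all add: axis_def algebra_simps)
  then have "b * (e / 2) = 0" "c * (e / 2) = 0" by (metis zero[OF x] add_0)+
  then show ?thesis using e zero[OF x] by auto
qed

lemma local_directional_derivative:
  fixes d :: "'a::real_normed_vector"
  assumes x: "x \<in> interior T" and eq: "\<And>y. y \<in> T \<Longrightarrow> u y = p y"
    and p: "((\<lambda>t. p (x + t *\<^sub>R d)) has_real_derivative D) (at 0)"
  shows "((\<lambda>t. u (x + t *\<^sub>R d)) has_real_derivative D) (at 0)"
proof -
  have "isCont (\<lambda>t. x + t *\<^sub>R d) 0" by (intro continuous_intros)
  then have "((\<lambda>t. x + t *\<^sub>R d) \<longlongrightarrow> x) (nhds 0)"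
    unfolding continuous_at tendsto_nhds_iff by simp
  then have "\<forall>\<^sub>F t in nhds 0. x + t *\<^sub>R d \<in> interior T" using x by (auto simp: tendsto_def)
  then have "\<forall>\<^sub>F t in nhds 0. u (x + t *\<^sub>R d) = p (x + t *\<^sub>R d)"
    by eventually_elim (use eq interior_subset in blast)
  then show ?thesis using iffD2[OF DERIV_cong_ev[OF refl _ refl] p] by simp
qed

lemma partial_deriv_eq:
  assumes "x \<in> interior T" "\<And>y. y \<in> T \<Longrightarrow> v y $ i = quadratic a b c d e f y"
  shows "((\<lambda>t. v (x + t *\<^sub>R axis j 1) $ i) has_real_derivative quadratic_deriv b c d e f j x) (at 0)"
  using assms has_real_derivative_quadratic by (rule local_directional_derivative)

section \<open>Linearity and definiteness of the forms on the finite element spaces\<close>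

context domain_mesh
begin

abbreviation "Vh \<equiv> V_h \<Omega> \<T>"
abbreviation "Qh \<equiv> Q_h \<Omega> \<T>"

lemma continuous_on_V_h: "v \<in> Vh \<Longrightarrow> continuous_on (closure \<Omega>) v"
  and V_h_outside: "v \<in> Vh \<Longrightarrow> x \<notin> closure \<Omega> \<Longrightarrow> v x = 0"
  by (auto simp: V_h_def)

lemma V_h_quadratic:
  assumes "v \<in> Vh" "T \<in> \<T>"
  obtains a b c d e f where "\<And>x. x \<in> T \<Longrightarrow> v x $ i = quadratic a b c d e f x"
proof -
  have "poly_on 2 T (\<lambda>x. v x $ i)" using assms by (auto simp: V_h_def)
  then obtain p where p: "p \<in> poly_le 2" "\<And>x. x \<in> T \<Longrightarrow> v x $ i = p x" by (auto simp: poly_on_def)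
  obtain a b c d e f where "p = quadratic a b c d e f" using p(1) unfolding poly_le_2 by blast
  then show ?thesis using that p(2) by blast
qed

lemma V_h_partial:
  assumes "v \<in> Vh" "T \<in> \<T>"
  obtains D where "\<And>j. continuous_on T (D j)"
    "\<And>j x. x \<in> interior T \<Longrightarrow> ((\<lambda>t. v (x + t *\<^sub>R axis j 1) $ i) has_real_derivative D j x) (at 0)"
proof -
  obtain a b c d e f where "\<And>x. x \<in> T \<Longrightarrow> v x $ i = quadratic a b c d e f x"
    using V_h_quadratic[OF assms] by blast
  then show ?thesis
  proof (intro that)
    show "continuous_on T (quadratic_deriv b c d e f j)" for j
      unfolding quadratic_deriv_def by (cases "j = 1") (auto intro!: continuous_intros)
  qed (rule partial_deriv_eq)
qed

lemma V_h_differentiable: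
  assumes "v \<in> Vh" "T \<in> \<T>" "x \<in> interior T"
  shows "((\<lambda>t. v (x + t *\<^sub>R axis j 1) $ i) has_real_derivative partial_deriv i j v x) (at 0)"
proof -
  obtain D where "((\<lambda>t. v (x + t *\<^sub>R axis j 1) $ i) has_real_derivative D j x) (at 0)"
    using V_h_partial[OF assms(1,2), of i thesis] assms(3) by blast
  moreover from this have "partial_deriv i j v x = D j x"
    unfolding partial_deriv_def by (rule DERIV_imp_deriv)
  ultimately show ?thesis by simp
qed

lemma pw_partial_deriv: "v \<in> Vh \<Longrightarrow> pw (partial_deriv i j v)"
  unfolding pw_def
proof
  fix T assume v: "v \<in> Vh" and T: "T \<in> \<T>"
  obtain D where D: "\<And>j. continuous_on T (D j)"
    "\<And>j x. x \<in> interior T \<Longrightarrow> ((\<lambda>t. v (x + t *\<^sub>R axis j 1) $ i) has_real_derivative D j x) (at 0)"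
    using V_h_partial[OF v T] by blast
  then have "\<forall>x\<in>interior T. partial_deriv i j v x = D j x"
    unfolding partial_deriv_def by (intro ballI DERIV_imp_deriv)
  then show "\<exists>G. continuous_on T G \<and> (\<forall>x\<in>interior T. partial_deriv i j v x = G x)" using D(1) by blast
qed

lemma partial_deriv_add:
  assumes "u \<in> Vh" "v \<in> Vh" "T \<in> \<T>" "x \<in> interior T"
  shows "partial_deriv i j (u + v) x = partial_deriv i j u x + partial_deriv i j v x"
  using DERIV_add[OF V_h_differentiable[OF assms(1,3,4), of j i] V_h_differentiable[OF assms(2,3,4), of j i]]
  unfolding partial_deriv_def[of i j "u + v"] by (intro DERIV_imp_deriv) simp

lemma partial_deriv_scale:
  assumes "u \<in> Vh" "T \<in> \<T>" "x \<in> interior T"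
  shows "partial_deriv i j (c *\<^sub>R u) x = c * partial_deriv i j u x"
  using DERIV_cmult[OF V_h_differentiable[OF assms, of j i], of c]
  unfolding partial_deriv_def[of i j "c *\<^sub>R u"] by (intro DERIV_imp_deriv) simp

lemma pw_strain: "v \<in> Vh \<Longrightarrow> pw (strain i j v)"
  unfolding strain_def divide_inverse by (intro pw_mult pw_add pw_const pw_partial_deriv)

lemma strain_add:
  assumes "u \<in> Vh" "v \<in> Vh" "T \<in> \<T>" "x \<in> interior T"
  shows "strain i j (u + v) x = strain i j u x + strain i j v x"
  using assms by (simp add: strain_def partial_deriv_add add_divide_distrib)

lemma strain_scale:
  assumes "u \<in> Vh" "T \<in> \<T>" "x \<in> interior T"
  shows "strain i j (c *\<^sub>R u) x = c * strain i j u x"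
  using assms by (simp add: strain_def partial_deriv_scale algebra_simps)

lemma pw_divergence: "v \<in> Vh \<Longrightarrow> pw (divergence v)"
  unfolding divergence_def sum_2 by (intro pw_add pw_partial_deriv)

lemma divergence_add:
  assumes "u \<in> Vh" "v \<in> Vh" "T \<in> \<T>" "x \<in> interior T"
  shows "divergence (u + v) x = divergence u x + divergence v x"
  using assms by (simp add: divergence_def partial_deriv_add sum.distrib)

lemma divergence_scale:
  assumes "u \<in> Vh" "T \<in> \<T>" "x \<in> interior T"
  shows "divergence (c *\<^sub>R u) x = c * divergence u x"
  using assms by (simp add: divergence_def partial_deriv_scale sum_distrib_left)

lemma pw_continuous: "continuous_on (closure \<Omega>) q \<Longrightarrow> pw q"
  using cover by (intro pwI[of q]) (auto intro: continuous_on_subset)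

lemma pw_Q_h: "q \<in> Qh \<Longrightarrow> pw q"
  by (rule pw_continuous) (simp add: Q_h_def)

lemma subspace_Q0_h: "subspace (Q0_h \<Omega> \<T>)"
proof (rule subspaceI)
  show "0 \<in> Q0_h \<Omega> \<T>" using subspace_0[OF subspace_Q_h] by (simp add: Q0_h_def zero_fun_def)
next
  fix p q assume "p \<in> Q0_h \<Omega> \<T>" "q \<in> Q0_h \<Omega> \<T>"
  then show "p + q \<in> Q0_h \<Omega> \<T>"
    using pw_integrable[OF pw_Q_h, of p] pw_integrable[OF pw_Q_h, of q]
    by (simp add: Q0_h_def subspace_add[OF subspace_Q_h]) (simp add: plus_fun_def)
next
  fix c q assume "q \<in> Q0_h \<Omega> \<T>"
  then show "c *\<^sub>R q \<in> Q0_h \<Omega> \<T>"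
    by (simp add: Q0_h_def subspace_scale[OF subspace_Q_h]) (simp add: scaleR_fun_def)
qed

text \<open>Additivity and homogeneity of \<open>D\<close> are asked in triangle interiors only,
  because the differential operators have unspecified values on the sides.\<close>

lemma linear_form_integral:
  assumes D: "\<And>v. v \<in> W \<Longrightarrow> pw (D v)" and F: "pw F"
    and add: "\<And>u v T x. u \<in> W \<Longrightarrow> v \<in> W \<Longrightarrow> T \<in> \<T> \<Longrightarrow> x \<in> interior T \<Longrightarrow> D (u + v) x = D u x + D v x"
    and scale: "\<And>c v T x. v \<in> W \<Longrightarrow> T \<in> \<T> \<Longrightarrow> x \<in> interior T \<Longrightarrow> D (c *\<^sub>R v) x = c * D v x"
  shows "linear_form W (\<lambda>v. \<integral>x. D v x * F x \<partial>area)"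
  unfolding linear_form_def
proof (intro conjI ballI allI)
  fix u v assume "u \<in> W" "v \<in> W"
  then show "(\<integral>x. D (u + v) x * F x \<partial>area) =
      (\<integral>x. D u x * F x \<partial>area) + (\<integral>x. D v x * F x \<partial>area)"
    by (intro pw_integral_add pw_mult D F) (simp_all add: add distrib_right)
next
  fix c v assume "v \<in> W"
  then show "(\<integral>x. D (c *\<^sub>R v) x * F x \<partial>area) = c * (\<integral>x. D v x * F x \<partial>area)"
    by (intro pw_integral_scale pw_mult D F) (simp_all add: scale)
qed

lemma linear_form_a:
  assumes u: "u \<in> Vh"
  shows "linear_form (Vh) (a_form \<nu> \<Omega> u)"
proof -
  have "linear_form (Vh) (\<lambda>v. \<integral>x. strain i j v x * strain i j u x \<partial>area)" for i j
    using u by (intro linear_form_integral pw_strain) (simp_all add: strain_add strain_scale)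
  note lf = linear_form_add[OF this] linear_form_scaleR[OF this]
  show ?thesis
    unfolding linear_form_def a_form_def mult.commute[of "strain _ _ u _"]
    by (simp add: lf sum.distrib distrib_left sum_distrib_left mult.left_commute)
qed

lemma a_form_sym: "a_form \<nu> \<Omega> u v = a_form \<nu> \<Omega> v u"
  by (simp add: a_form_def mult.commute)

lemma linear_form_b_left:
  assumes q: "q \<in> Qh"
  shows "linear_form (Vh) (\<lambda>v. b_form \<Omega> v q)"
proof -
  have "linear_form (Vh) (\<lambda>v. \<integral>x. divergence v x * q x \<partial>area)"
    using q by (intro linear_form_integral pw_divergence pw_Q_h)
      (simp_all add: divergence_add divergence_scale)
  then show ?thesis by (simp add: linear_form_def b_form_def)
qed

lemma linear_form_b_right:
  assumes v: "v \<in> Vh"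
  shows "linear_form (Qh) (b_form \<Omega> v)"
proof -
  have "linear_form (Qh) (\<lambda>q. \<integral>x. q x * divergence v x \<partial>area)"
    using v by (intro linear_form_integral pw_divergence pw_Q_h) simp_all
  then show ?thesis by (simp add: linear_form_def b_form_def mult.commute)
qed

lemma linear_form_L2_inner:
  assumes f: "in_L2 \<Omega> f"
  shows "linear_form (Vh) (L2_inner \<Omega> f)"
proof -
  have int: "integrable area (\<lambda>x. f x \<bullet> v x)" if v: "v \<in> Vh" for v
  proof -
    have cont: "continuous_on (closure \<Omega>) v" using v by (simp add: V_h_def)
    obtain B where B: "\<And>x. x \<in> closure \<Omega> \<Longrightarrow> norm (v x) \<le> B"
      using compact_imp_bounded[OF compact_continuous_image[OF cont compact_closure_domain]]
      by (auto simp: bounded_iff)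
    have "v \<in> borel_measurable area"
      using continuous_on_subset[OF cont closure_subset] sets_domain
      by (rule continuous_imp_measurable_on_sets_lebesgue)
    then have meas: "(\<lambda>x. f x \<bullet> v x) \<in> borel_measurable area"
      using f by (intro borel_measurable_inner) (auto simp: in_L2_def)
    \<comment> \<open>The dominating function: \<open>B\<close> bounds \<open>v\<close>, and
      \<open>norm (f x) \<le> 1 + (norm (f x))\<^sup>2\<close>, where the constant is integrable
      because finitely many triangles cover the domain.\<close>
    have fin: "integrable area (\<lambda>x. (1 + (norm (f x))\<^sup>2) * B)"
      using f pw_integrable[OF pw_const, of 1] by (auto simp: in_L2_def)
    show ?thesis
    proof (rule Bochner_Integration.integrable_bound[OF fin meas], rule AE_I2)
      fix x assume "x \<in> space area"
      then have x: "x \<in> closure \<Omega>" using closure_subset by auto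
      have "0 \<le> B" using B[OF x] norm_ge_zero order_trans by blast
      have "2 * norm (f x) \<le> 1 + (norm (f x))\<^sup>2"
        using zero_le_power2[of "norm (f x) - 1"] by (simp add: power2_diff)
      then have "norm (f x) \<le> 1 + (norm (f x))\<^sup>2" using norm_ge_zero[of "f x"] by linarith
      then have "norm (f x) * norm (v x) \<le> (1 + (norm (f x))\<^sup>2) * B"
        using B[OF x] by (intro mult_mono) auto
      then show "norm (f x \<bullet> v x) \<le> norm ((1 + (norm (f x))\<^sup>2) * B)"
        using Cauchy_Schwarz_ineq2[of "f x" "v x"] \<open>0 \<le> B\<close> by (simp add: abs_mult)
    qed
  qed
  show ?thesis
    unfolding linear_form_def L2_inner_def using int by (simp add: inner_add_right)
qed

text \<open>The strain of a quadratic field is affine, so vanishing on an open set kills all its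
  coefficients; the two diagonal and the mixed component together remove every quadratic term and
  leave opposite off-diagonal slopes.\<close>

lemma rigid_on_triangle:
  assumes v: "v \<in> Vh" and T: "T \<in> \<T>"
    and zero: "\<And>i j x. x \<in> interior T \<Longrightarrow> strain i j v x = 0"
  obtains \<alpha> \<beta> \<gamma> where "\<And>x. x \<in> T \<Longrightarrow> v x $ 1 = \<alpha> - \<gamma> * x $ 2 \<and> v x $ 2 = \<beta> + \<gamma> * x $ 1"
proof -
  obtain a b c d e f where q1: "\<And>x. x \<in> T \<Longrightarrow> v x $ 1 = quadratic a b c d e f x"
    using V_h_quadratic[OF v T] by blast
  obtain a' b' c' d' e' f' where q2: "\<And>x. x \<in> T \<Longrightarrow> v x $ 2 = quadratic a' b' c' d' e' f' x"
    using V_h_quadratic[OF v T] by blast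
  have D1: "partial_deriv 1 j v x = quadratic_deriv b c d e f j x" if "x \<in> interior T" for j x
    unfolding partial_deriv_def using partial_deriv_eq[OF that q1] by (rule DERIV_imp_deriv)
  have D2: "partial_deriv 2 j v x = quadratic_deriv b' c' d' e' f' j x" if "x \<in> interior T" for j x
    unfolding partial_deriv_def using partial_deriv_eq[OF that q2] by (rule DERIV_imp_deriv)
  note az = affine_zero_on_open[OF open_interior interior_mesh[OF T]]
  have "b = 0 \<and> 2 * d = 0 \<and> e = 0"
  proof (rule az)
    fix x assume "x \<in> interior T"
    then have "quadratic_deriv b c d e f 1 x = 0" using zero[of x 1 1] by (simp add: strain_def D1)
    then show "b + 2 * d * x $ 1 + e * x $ 2 = 0" by (simp add: quadratic_deriv_def)
  qed
  moreover have "c' = 0 \<and> e' = 0 \<and> 2 * f' = 0"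
  proof (rule az)
    fix x assume "x \<in> interior T"
    then have "quadratic_deriv b' c' d' e' f' 2 x = 0" using zero[of x 2 2] by (simp add: strain_def D2)
    then show "c' + e' * x $ 1 + 2 * f' * x $ 2 = 0" by (simp add: quadratic_deriv_def)
  qed
  moreover have "c + b' = 0 \<and> e + 2 * d' = 0 \<and> 2 * f + e' = 0"
  proof (rule az)
    fix x assume "x \<in> interior T"
    then have "quadratic_deriv b c d e f 2 x + quadratic_deriv b' c' d' e' f' 1 x = 0"
      using zero[of x 1 2] by (simp add: strain_def D1 D2)
    then show "(c + b') + (e + 2 * d') * x $ 1 + (2 * f + e') * x $ 2 = 0"
      by (simp add: quadratic_deriv_def algebra_simps)
  qed
  ultimately show ?thesis
    using that[of a "b'" "a'"] q1 q2 by (auto simp: quadratic_def add_eq_0_iff2)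
qed

lemma finite_mesh_vertices: "finite (vertices)"
proof -
  have "vertices = (\<Union>T\<in>\<T>. corners T)" by (auto simp: mesh_vertices_def corners_def)
  then show ?thesis using finite_mesh corners_simplex(1) by auto
qed

text \<open>Away from the mesh vertices, two triangles that meet share at least two points, so a
  quantity determined by the values of a function at two points propagates from one triangle to
  the next; removing the finitely many vertices does not disconnect the domain.\<close>

lemma constant_data_on_mesh:
  assumes step: "\<And>T T' x y. T \<in> \<T> \<Longrightarrow> T' \<in> \<T> \<Longrightarrow> x \<in> T \<inter> T' \<Longrightarrow> y \<in> T \<inter> T' \<Longrightarrow> x \<noteq> y \<Longrightarrow> c T = c T'"
  shows "T \<in> \<T> \<Longrightarrow> T' \<in> \<T> \<Longrightarrow> c T = c T'"
proof -
  let ?A = "\<Omega> - vertices"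
  define tri where "tri x = (SOME T. T \<in> \<T> \<and> x \<in> T)" for x
  have tri: "tri x \<in> \<T> \<and> x \<in> tri x" if "x \<in> \<Omega>" for x
    unfolding tri_def using that closure_subset[of \<Omega>] cover
    by (intro someI_ex[of "\<lambda>T. T \<in> \<T> \<and> x \<in> T"]) blast
  have c_eq: "c T = c (tri x)" if x: "x \<in> ?A" "x \<in> T" "T \<in> \<T>" for x T
  proof -
    have t: "tri x \<in> \<T>" "x \<in> tri x" using tri x by auto
    have "T \<inter> tri x \<noteq> {x}"
    proof
      assume "T \<inter> tri x = {x}"
      then have "{x} face_of T" using face_mesh[OF x(3) t(1)] by simp
      then have "x \<in> vertices" using x(3) by (auto simp: face_of_singleton mesh_vertices_def)
      then show False using x(1) by simp
    qed
    then obtain y where "y \<in> T \<inter> tri x" "x \<noteq> y" using x(2) t(2) by blast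
    then show ?thesis using step[OF x(3) t(1), of x y] x(2) t(2) by blast
  qed
  have conn: "connected ?A"
    using connected_open_diff_countable[of \<Omega> "vertices"] open_domain connected_domain
      finite_mesh_vertices by (auto intro: countable_finite)
  have loc: "\<forall>x\<in>?A. \<forall>\<^sub>F y in at x within ?A. c (tri x) = c (tri y)"
  proof
    fix x assume x: "x \<in> ?A"
    \<comment> \<open>Outside these triangles, every triangle containing a point \<open>y\<close>
      also contains \<open>x\<close>, so \<open>c_eq\<close> at \<open>x\<close> applies to
      \<open>tri y\<close>.\<close>
    let ?far = "\<Union>{T \<in> \<T>. x \<notin> T}"
    have "closed ?far" using finite_mesh closed_mesh by (intro closed_Union) auto
    then have "\<forall>\<^sub>F y in nhds x. y \<in> - ?far" by (intro eventually_nhds_in_open) auto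
    then have "\<forall>\<^sub>F y in at x within ?A. y \<in> - ?far"
      unfolding eventually_at_filter by eventually_elim auto
    moreover have "\<forall>\<^sub>F y in at x within ?A. y \<in> ?A" by (simp add: eventually_at_filter)
    ultimately show "\<forall>\<^sub>F y in at x within ?A. c (tri x) = c (tri y)"
    proof eventually_elim
      case (elim y)
      then have "x \<in> tri y" "tri y \<in> \<T>" using tri[of y] by auto
      then show ?case using c_eq[OF x, of "tri y"] by simp
    qed
  qed
  show "c T = c T'" if T: "T \<in> \<T>" "T' \<in> \<T>"
  proof -
    have "\<exists>x. x \<in> ?A \<inter> T" if "T \<in> \<T>" for T
    proof -
      have "infinite (interior T)"
        using interior_mesh[OF that] by (metis finite_imp_not_open open_interior)
      then have "interior T - vertices \<noteq> {}"
        using finite_mesh_vertices by (metis finite.emptyI finite_Diff2)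
      then show ?thesis using interior_mesh_subset[OF that] interior_subset by blast
    qed
    then obtain x x' where "x \<in> ?A \<inter> T" "x' \<in> ?A \<inter> T'" using T by meson
    then show ?thesis
      using connected_local_const[OF conn, of x x' "\<lambda>x. c (tri x)"] loc c_eq T by (metis IntD1 IntD2)
  qed
qed

text \<open>An infinitesimal rigid motion of the plane is determined by its values at two distinct
  points: differences of values fix the rotation \<open>\<gamma>\<close>, and then one value fixes
  the translation.\<close>

lemma rigid_on_domain:
  assumes v: "v \<in> Vh"
    and zero: "\<And>T i j x. T \<in> \<T> \<Longrightarrow> x \<in> interior T \<Longrightarrow> strain i j v x = 0"
  obtains \<alpha> \<beta> \<gamma> where "\<And>x. x \<in> closure \<Omega> \<Longrightarrow> v x $ 1 = \<alpha> - \<gamma> * x $ 2 \<and> v x $ 2 = \<beta> + \<gamma> * x $ 1"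
proof -
  have "\<exists>\<alpha> \<beta> \<gamma>. \<forall>x\<in>T. v x $ 1 = \<alpha> - \<gamma> * x $ 2 \<and> v x $ 2 = \<beta> + \<gamma> * x $ 1" if "T \<in> \<T>" for T
    using rigid_on_triangle[OF v that zero[OF that]] by metis
  then obtain \<alpha> \<beta> \<gamma> where
    r: "\<And>T x. T \<in> \<T> \<Longrightarrow> x \<in> T \<Longrightarrow> v x $ 1 = \<alpha> T - \<gamma> T * x $ 2 \<and> v x $ 2 = \<beta> T + \<gamma> T * x $ 1"
    by metis
  have const: "(\<alpha> T, \<beta> T, \<gamma> T) = (\<alpha> T', \<beta> T', \<gamma> T')" if TT: "T \<in> \<T>" "T' \<in> \<T>" for T T'
  proof (rule constant_data_on_mesh[OF _ TT])
    fix T T' x y assume *: "T \<in> \<T>" "T' \<in> \<T>" "x \<in> T \<inter> T'" "y \<in> T \<inter> T'" "x \<noteq> y"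
    have eqs: "\<alpha> T - \<gamma> T * x $ 2 = \<alpha> T' - \<gamma> T' * x $ 2" "\<beta> T + \<gamma> T * x $ 1 = \<beta> T' + \<gamma> T' * x $ 1"
      "\<alpha> T - \<gamma> T * y $ 2 = \<alpha> T' - \<gamma> T' * y $ 2" "\<beta> T + \<gamma> T * y $ 1 = \<beta> T' + \<gamma> T' * y $ 1"
      using r[of T x] r[of T' x] r[of T y] r[of T' y] * by auto
    have "x $ 1 \<noteq> y $ 1 \<or> x $ 2 \<noteq> y $ 2" using *(5) by (auto simp: vec_eq_iff forall_2)
    moreover have "(\<gamma> T - \<gamma> T') * (x $ 1 - y $ 1) = 0" "(\<gamma> T - \<gamma> T') * (x $ 2 - y $ 2) = 0"
      using eqs by (auto simp: algebra_simps)
    ultimately have "\<gamma> T = \<gamma> T'" by auto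
    then show "(\<alpha> T, \<beta> T, \<gamma> T) = (\<alpha> T', \<beta> T', \<gamma> T')" using eqs by simp
  qed
  obtain T0 where T0: "T0 \<in> \<T>" using domain_nonempty cover closure_subset[of \<Omega>] by blast
  show ?thesis
  proof (rule that[of "\<alpha> T0" "\<gamma> T0" "\<beta> T0"])
    fix x assume "x \<in> closure \<Omega>"
    then obtain T where T: "T \<in> \<T>" "x \<in> T" using cover by blast
    then show "v x $ 1 = \<alpha> T0 - \<gamma> T0 * x $ 2 \<and> v x $ 2 = \<beta> T0 + \<gamma> T0 * x $ 1"
      using r[OF T] const[OF T(1) T0] by simp
  qed
qed

lemma strain_square_integral_nonneg: "0 \<le> (\<integral>x. strain i j v x * strain i j v x \<partial>area)"
  by (intro pw_integral_nonneg) simp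

lemma a_form_nonneg: "0 < \<nu> \<Longrightarrow> 0 \<le> a_form \<nu> \<Omega> v v"
  unfolding a_form_def by (simp add: sum_nonneg strain_square_integral_nonneg)

lemma a_form_definite:
  assumes \<nu>: "0 < \<nu>" and v: "v \<in> Vh" and zero: "a_form \<nu> \<Omega> v v = 0"
    and AB: "A \<in> closure \<Omega>" "B \<in> closure \<Omega>" "A \<noteq> B" "v A = 0" "v B = 0"
  shows "v = 0"
proof -
  have "(\<Sum>i\<in>UNIV. \<Sum>j\<in>UNIV. \<integral>x. strain i j v x * strain i j v x \<partial>area) = 0"
    using zero \<nu> by (simp add: a_form_def)
  then have int0: "(\<integral>x. strain i j v x * strain i j v x \<partial>area) = 0" for i j
    by (simp add: sum_nonneg_eq_0_iff sum_nonneg strain_square_integral_nonneg)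
  have strain0: "strain i j v x = 0" if "T \<in> \<T>" "x \<in> interior T" for T i j x
    using pw_integral_eq_0[OF pw_mult[OF pw_strain[OF v] pw_strain[OF v]] _ int0 that] by simp
  obtain \<alpha> \<beta> \<gamma> where
    r: "\<And>x. x \<in> closure \<Omega> \<Longrightarrow> v x $ 1 = \<alpha> - \<gamma> * x $ 2 \<and> v x $ 2 = \<beta> + \<gamma> * x $ 1"
    by (rule rigid_on_domain[OF v strain0]) blast+
  have e: "\<alpha> = \<gamma> * A $ 2" "\<alpha> = \<gamma> * B $ 2" "\<beta> = - \<gamma> * A $ 1" "\<beta> = - \<gamma> * B $ 1"
    using r[OF AB(1)] r[OF AB(2)] AB(4,5) by auto
  have "A $ 1 \<noteq> B $ 1 \<or> A $ 2 \<noteq> B $ 2" using AB(3) by (auto simp: vec_eq_iff forall_2)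
  then have "\<gamma> = 0" using e by auto
  then have "\<alpha> = 0" "\<beta> = 0" using e by auto
  then have "v x = 0" for x
    using r[of x] V_h_outside[OF v, of x] \<open>\<gamma> = 0\<close> by (cases "x \<in> closure \<Omega>") (auto simp: vec_eq_iff forall_2)
  then show ?thesis by (simp add: fun_eq_iff)
qed

section \<open>Finite dimension of the spaces\<close>

definition monomial :: "nat \<Rightarrow> plane \<Rightarrow> real" where
  "monomial k x = [1, x $ 1, x $ 2, (x $ 1)\<^sup>2, x $ 1 * x $ 2, (x $ 2)\<^sup>2] ! k"

text \<open>Each point of the closure is assigned one triangle containing it; the six monomials, cut
  off to these disjoint pieces, span. They may be discontinuous, as only containment in the span
  matters.\<close>

lemma finite_dimensional_pw_poly:
  "\<exists>B. finite B \<and> {q. (\<forall>x. x \<notin> closure \<Omega> \<longrightarrow> q x = 0) \<and> (\<forall>T\<in>\<T>. poly_on 2 T q)} \<subseteq> span B"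
proof -
  define tri where "tri x = (SOME T. T \<in> \<T> \<and> x \<in> T)" for x
  have tri: "tri x \<in> \<T> \<and> x \<in> tri x" if "x \<in> closure \<Omega>" for x
    unfolding tri_def using that cover
    by (intro someI_ex[of "\<lambda>T. T \<in> \<T> \<and> x \<in> T"]) blast
  define b where "b T k x = (if x \<in> closure \<Omega> \<and> tri x = T then monomial k x else 0)" for T k x
  let ?B = "(\<lambda>(T, k). b T k) ` (\<T> \<times> {..<6})"
  have "q \<in> span ?B" if out: "\<And>x. x \<notin> closure \<Omega> \<Longrightarrow> q x = 0" and poly: "\<And>T. T \<in> \<T> \<Longrightarrow> poly_on 2 T q" for q
  proof -
    have "\<exists>c. \<forall>x\<in>T. q x = (\<Sum>k<6. c k * monomial k x)" if T: "T \<in> \<T>" for T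
    proof -
      obtain p where p: "p \<in> poly_le 2" "\<And>x. x \<in> T \<Longrightarrow> q x = p x"
        using poly[OF T] by (auto simp: poly_on_def)
      obtain a0 a1 a2 a3 a4 a5 where "p = quadratic a0 a1 a2 a3 a4 a5"
        using p(1) unfolding poly_le_2 by blast
      then have "\<And>x. x \<in> T \<Longrightarrow> q x = quadratic a0 a1 a2 a3 a4 a5 x" using p(2) by simp
      then show ?thesis
        by (intro exI[of _ "\<lambda>k. [a0, a1, a2, a3, a4, a5] ! k"])
          (simp add: quadratic_def monomial_def eval_nat_numeral)
    qed
    then obtain c where c: "\<And>T x. T \<in> \<T> \<Longrightarrow> x \<in> T \<Longrightarrow> q x = (\<Sum>k<6. c T k * monomial k x)" by metis
    have "q = (\<Sum>T\<in>\<T>. \<Sum>k<6. c T k *\<^sub>R b T k)"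
    proof
      fix x
      show "q x = (\<Sum>T\<in>\<T>. \<Sum>k<6. c T k *\<^sub>R b T k) x"
      proof (cases "x \<in> closure \<Omega>")
        case False
        then show ?thesis by (simp add: sum_fun_apply out b_def)
      next
        case True
        have "(\<Sum>T\<in>\<T>. \<Sum>k<6. c T k *\<^sub>R b T k) x = (\<Sum>T\<in>\<T>. if tri x = T then (\<Sum>k<6. c T k * monomial k x) else 0)"
          unfolding sum_fun_apply using True by (intro sum.cong) (auto simp: b_def)
        also have "\<dots> = q x" using tri[OF True] finite_mesh c[of "tri x" x] by simp
        finally show ?thesis by simp
      qed
    qed
    also have "\<dots> \<in> span ?B" by (intro span_sum span_scale span_base) auto
    finally show ?thesis .
  qed
  then show ?thesis using finite_mesh by (intro exI[of _ ?B]) auto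
qed

lemma finite_dimensional_Q_h: "\<exists>B. finite B \<and> Qh \<subseteq> span B"
proof -
  have "Qh \<subseteq> {q. (\<forall>x. x \<notin> closure \<Omega> \<longrightarrow> q x = 0) \<and> (\<forall>T\<in>\<T>. poly_on 2 T q)}"
    using poly_on_1_imp_2 by (auto simp: Q_h_def)
  then show ?thesis using finite_dimensional_pw_poly by (meson order_trans)
qed

lemma finite_dimensional_V_h: "\<exists>B. finite B \<and> Vh \<subseteq> span B"
proof -
  obtain B where B: "finite B"
    "{q. (\<forall>x. x \<notin> closure \<Omega> \<longrightarrow> q x = 0) \<and> (\<forall>T\<in>\<T>. poly_on 2 T q)} \<subseteq> span B"
    using finite_dimensional_pw_poly by blast
  define L where "L k q = (\<lambda>x. q x *\<^sub>R axis k 1 :: plane)" for k :: 2 and q :: "plane \<Rightarrow> real"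
  have lin: "linear (L k)" for k
    by (rule linearI) (auto simp: L_def fun_eq_iff algebra_simps)
  let ?B = "L 1 ` B \<union> L 2 ` B"
  have "v \<in> span ?B" if v: "v \<in> Vh" for v
  proof -
    have "(\<lambda>x. v x $ k) \<in> span B" for k
      using v B(2) by (intro subsetD[OF B(2)]) (auto simp: V_h_def)
    then have "L k (\<lambda>x. v x $ k) \<in> span (L k ` B)" for k
      by (simp add: linear_span_image[OF lin])
    then have "L 1 (\<lambda>x. v x $ 1) + L 2 (\<lambda>x. v x $ 2) \<in> span ?B"
      by (intro span_add) (meson span_mono subsetD Un_upper1 Un_upper2)+
    moreover have "v = L 1 (\<lambda>x. v x $ 1) + L 2 (\<lambda>x. v x $ 2)"
      by (auto simp: L_def fun_eq_iff vec_eq_iff forall_2 axis_def)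
    ultimately show ?thesis by simp
  qed
  then show ?thesis using B(1) by (intro exI[of _ ?B]) auto
qed

end


lemma poly_on_1: "poly_on 1 S q \<longleftrightarrow> (\<exists>\<alpha> \<beta>. \<forall>x\<in>S. q x = \<alpha> + \<beta> \<bullet> x)"
proof -
  have "poly_on 1 S q \<longleftrightarrow> (\<exists>p. (\<exists>\<alpha> \<beta>. p = (\<lambda>x. \<alpha> + \<beta> \<bullet> x)) \<and> (\<forall>x\<in>S. q x = p x))"
    unfolding poly_on_def Bex_def poly_le_1 ..
  then show ?thesis by auto
qed

section \<open>Bubble functions and the inf-sup condition\<close>

context domain_mesh
begin

lemma poly_on_hat:
  assumes T: "T \<in> \<T>"
  shows "poly_on 1 T (hat z)"
proof -
  obtain \<alpha> \<beta> where "bary T z = (\<lambda>x. \<alpha> + \<beta> \<bullet> x)" using bary_affine[OF T] by blast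
  then show ?thesis
    unfolding poly_on_1 by (intro exI[of _ \<alpha>] exI[of _ \<beta>]) (simp add: hat_eq[OF T])
qed

text \<open>By \<open>interior_if_hat_pos\<close> the hat function of a vertex in the domain is
  positive only inside the domain. Bubbles built with it therefore vanish on the whole
  boundary.\<close>

lemma hat_frontier:
  assumes "z \<in> vertices" "z \<in> \<Omega>" "x \<in> frontier \<Omega>"
  shows "hat z x = 0"
proof -
  have "x \<notin> \<Omega>" using assms(3) open_domain by (auto simp: frontier_def interior_open)
  then show ?thesis
    using interior_if_hat_pos[OF assms(1), of x] assms(2) hat_nonneg[of z x] unfolding interior_cover by force
qed

lemma bubble_V_h: "(\<lambda>x. (hat z x * hat w x) *\<^sub>R d) \<in> Vh"
proof -
  have "poly_on 2 T (\<lambda>x. ((hat z x * hat w x) *\<^sub>R d) $ i)" if "T \<in> \<T>" for T i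
    using poly_on_scale[OF poly_on_2_mult[OF poly_on_hat[OF that] poly_on_hat[OF that]], of "d $ i" z w]
    by (simp add: mult.commute)
  then show ?thesis
    using continuous_on_hat hat_outside unfolding V_h_def cover by (auto intro!: continuous_intros)
qed

text \<open>The product rule, where the slope of an affine function along \<open>w - z\<close> is
  its increment from \<open>z\<close> to \<open>w\<close>. If both are corners of \<open>T\<close>
  and distinct, the coefficients are -1 and 1.\<close>

lemma divergence_bubble:
  assumes T: "T \<in> \<T>" "x \<in> interior T"
  shows "divergence (\<lambda>x. (hat z x * hat w x) *\<^sub>R (w - z)) x =
    (bary T z w - bary T z z) * bary T w x + (bary T w w - bary T w z) * bary T z x"
proof -
  obtain \<alpha> \<beta> \<gamma> \<delta> where ab: "bary T z = (\<lambda>x. \<alpha> + \<beta> \<bullet> x)" "bary T w = (\<lambda>x. \<gamma> + \<delta> \<bullet> x)"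
    using bary_affine[OF T(1)] by metis
  let ?d = "w - z"
  have pd: "partial_deriv i i (\<lambda>x. (hat z x * hat w x) *\<^sub>R ?d) x =
      (\<beta> $ i * (\<gamma> + \<delta> \<bullet> x) + \<delta> $ i * (\<alpha> + \<beta> \<bullet> x)) * ?d $ i" for i
  proof -
    let ?p = "\<lambda>y. (\<alpha> + \<beta> \<bullet> y) * (\<gamma> + \<delta> \<bullet> y) * ?d $ i"
    have "((\<lambda>t. ?p (x + t *\<^sub>R axis i 1)) has_real_derivative
        (\<beta> $ i * (\<gamma> + \<delta> \<bullet> x) + \<delta> $ i * (\<alpha> + \<beta> \<bullet> x)) * ?d $ i) (at 0)"
      by (auto simp: inner_add_right inner_axis intro!: derivative_eq_intros)
    then have "((\<lambda>t. ((hat z (x + t *\<^sub>R axis i 1) * hat w (x + t *\<^sub>R axis i 1)) *\<^sub>R ?d) $ i)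
        has_real_derivative (\<beta> $ i * (\<gamma> + \<delta> \<bullet> x) + \<delta> $ i * (\<alpha> + \<beta> \<bullet> x)) * ?d $ i) (at 0)"
      using T(2) hat_eq[OF T(1)]
      by (intro local_directional_derivative[where u = "\<lambda>y. ((hat z y * hat w y) *\<^sub>R ?d) $ i"]) (auto simp: ab)
    then show ?thesis unfolding partial_deriv_def by (rule DERIV_imp_deriv)
  qed
  have "\<beta> \<bullet> ?d = \<beta> $ 1 * ?d $ 1 + \<beta> $ 2 * ?d $ 2" "\<delta> \<bullet> ?d = \<delta> $ 1 * ?d $ 1 + \<delta> $ 2 * ?d $ 2"
    by (simp_all add: inner_vec_def sum_2)
  then have "divergence (\<lambda>x. (hat z x * hat w x) *\<^sub>R ?d) x =
      (\<beta> \<bullet> ?d) * (\<gamma> + \<delta> \<bullet> x) + (\<delta> \<bullet> ?d) * (\<alpha> + \<beta> \<bullet> x)"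
    unfolding divergence_def sum_2 pd by algebra
  then show ?thesis by (simp add: ab inner_diff_right)
qed

text \<open>The affine map exchanging the corners \<open>z\<close> and \<open>w\<close> preserves \<open>T\<close> and Lebesgue measure and
  changes the sign of \<open>bary T z - bary T w\<close>.\<close>

lemma integral_swap:
  assumes T: "T \<in> \<T>" and zw: "z \<in> corners T" "w \<in> corners T" "z \<noteq> w"
    and p: "\<And>x. x \<in> T \<Longrightarrow> p x = \<pi>0 + \<pi> \<bullet> x"
  shows "integral T (\<lambda>x. (bary T z x - bary T w x) * p x) =
    (p z - p w) / 2 * integral T (\<lambda>x. (bary T z x - bary T w x)\<^sup>2)"
proof -
  define l where "l x = bary T z x - bary T w x" for x
  obtain \<alpha> \<beta> \<gamma> \<delta> where ab: "bary T z = (\<lambda>x. \<alpha> + \<beta> \<bullet> x)" "bary T w = (\<lambda>x. \<gamma> + \<delta> \<bullet> x)"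
    using bary_affine[OF T] by metis
  have l_eq: "l x = (\<alpha> - \<gamma>) + (\<beta> - \<delta>) \<bullet> x" for x by (simp add: l_def ab inner_diff_left)
  have lzw: "l z = 1" "l w = - 1" using bary_corner[OF T] zw by (auto simp: l_def)
  have b2: "(\<beta> - \<delta>) \<bullet> (z - w) = 2" using lzw by (simp add: l_eq inner_diff_right)
  \<comment> \<open>Since \<open>l z = 1\<close> and \<open>l w = - 1\<close>, this affine map
    exchanges the two corners and fixes the points where \<open>l\<close> vanishes;
    \<open>\<sigma>'\<close> is its linear part.\<close>
  define \<sigma> where "\<sigma> x = x - l x *\<^sub>R (z - w)" for x
  define \<sigma>' where "\<sigma>' h = h - ((\<beta> - \<delta>) \<bullet> h) *\<^sub>R (z - w)" for h
  have aff: "\<epsilon> + \<zeta> \<bullet> \<sigma> x = (\<epsilon> + \<zeta> \<bullet> x) - l x * ((\<epsilon> + \<zeta> \<bullet> z) - (\<epsilon> + \<zeta> \<bullet> w))" for \<epsilon> \<zeta> x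
    by (simp add: \<sigma>_def inner_diff_right)
  have l\<sigma>: "l (\<sigma> x) = - l x" for x
    using aff[of "\<alpha> - \<gamma>" "\<beta> - \<delta>" x] lzw unfolding l_eq[symmetric] by simp
  have \<sigma>\<sigma>: "\<sigma> (\<sigma> x) = x" for x
    using l\<sigma>[of x] by (simp add: \<sigma>_def[of "\<sigma> x"]) (simp add: \<sigma>_def)
  have bary_\<sigma>: "bary T s (\<sigma> x) = bary T s x - l x * (bary T s z - bary T s w)" for s x
  proof -
    obtain \<epsilon> \<zeta> where "bary T s = (\<lambda>x. \<epsilon> + \<zeta> \<bullet> x)" using bary_affine[OF T] by blast
    then show ?thesis using aff by simp
  qed
  have \<sigma>T: "\<sigma> x \<in> T" if x: "x \<in> T" for x
    unfolding mem_mesh_iff[OF T]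
  proof
    fix s assume s: "s \<in> corners T"
    have "bary T s (\<sigma> x) = bary T (if s = z then w else if s = w then z else s) x"
      using zw bary_corner[OF T zw(1), of s] bary_corner[OF T zw(2), of s] by (auto simp: bary_\<sigma> l_def)
    then show "0 \<le> bary T s (\<sigma> x)" using bary_nonneg[OF T x] by simp
  qed
  have image: "\<sigma> ` T = T" using \<sigma>T \<sigma>\<sigma> by (metis image_subsetI subset_antisym subsetI image_eqI)
  have lin: "linear \<sigma>'" unfolding \<sigma>'_def
    by (rule linearI) (auto simp: algebra_simps inner_add_right)
  have deriv: "(\<sigma> has_derivative \<sigma>') (at x within T)" for x
    unfolding \<sigma>_def \<sigma>'_def l_eq by (auto intro!: derivative_eq_intros)
  have "\<sigma>' \<circ> \<sigma>' = id"
  proof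
    fix h
    have "(\<beta> - \<delta>) \<bullet> \<sigma>' h = - ((\<beta> - \<delta>) \<bullet> h)" unfolding \<sigma>'_def inner_diff_right[of _ h] inner_scaleR_right b2 by simp
    then show "(\<sigma>' \<circ> \<sigma>') h = id h" by (simp add: \<sigma>'_def[of "\<sigma>' h"]) (simp add: \<sigma>'_def)
  qed
  \<comment> \<open>The linear part is an involution, so its determinant has square 1 and the change
    of variables carries no factor.\<close>
  then have "det (matrix \<sigma>') * det (matrix \<sigma>') = 1"
    using matrix_compose[OF lin lin] by (metis det_mul det_I matrix_id_mat_1)
  then have det: "\<bar>det (matrix \<sigma>')\<bar> = 1"
    by (metis abs_mult_self_eq abs_ge_zero abs_mult abs_one mult_eq_1_iff real_sqrt_abs2 real_sqrt_one)
  have change: "integral T (\<lambda>x. F (\<sigma> x)) = integral T F" if F: "continuous_on T F" for F :: "plane \<Rightarrow> real"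
  proof -
    \<comment> \<open>The scalar integrand is placed in the first coordinate, since the change of
      variables theorem used below has values in \<open>real^n\<close>; the coordinate is read off
      at the end.\<close>
    let ?F = "\<lambda>x. F x *\<^sub>R (axis 1 1 :: plane)"
    have Fabs: "F absolutely_integrable_on T"
      using compact_absolutely_integrable[OF compact_mesh[OF T] F] .
    then have abs: "?F absolutely_integrable_on T" by (rule absolutely_integrable_scaleR_right[rotated])
    have inj: "inj_on \<sigma> T" using \<sigma>\<sigma> by (metis inj_on_inverseI)
    have "T \<in> sets lebesgue" using closed_mesh[OF T] by auto
    then have "integral T (\<lambda>x. \<bar>det (matrix \<sigma>')\<bar> *\<^sub>R ?F (\<sigma> x)) = integral T ?F"
      using has_absolute_integral_change_of_variables[of T \<sigma> "\<lambda>x. \<sigma>'" ?F "integral T ?F"] deriv inj abs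
      by (auto simp: image)
    then have eq: "integral T (\<lambda>x. ?F (\<sigma> x)) = integral T ?F" by (simp add: det)
    have \<sigma>c: "continuous_on T \<sigma>" unfolding \<sigma>_def l_eq by (intro continuous_intros)
    then have "continuous_on T (\<lambda>x. F (\<sigma> x))"
      using F image by (intro continuous_on_compose2[OF F \<sigma>c]) auto
    then have "(\<lambda>x. F (\<sigma> x)) integrable_on T" "F integrable_on T"
      using compact_absolutely_integrable[OF compact_mesh[OF T]] Fabs set_lebesgue_integral_eq_integral(1) by blast+
    then have "(?F has_integral integral T F *\<^sub>R axis 1 1) T"
      "((\<lambda>x. ?F (\<sigma> x)) has_integral integral T (\<lambda>x. F (\<sigma> x)) *\<^sub>R axis 1 1) T"
      by (auto intro!: has_integral_scaleR_left integrable_integral)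
    then have "integral T (\<lambda>x. F (\<sigma> x)) *\<^sub>R (axis 1 1 :: plane) = integral T F *\<^sub>R axis 1 1"
      using eq by (simp add: integral_unique)
    then have "(integral T (\<lambda>x. F (\<sigma> x)) *\<^sub>R (axis 1 1 :: plane)) $ 1 = (integral T F *\<^sub>R (axis 1 1 :: plane)) $ 1"
      by (simp only:)
    then show ?thesis by simp
  qed
  have lc: "continuous_on T l" unfolding l_eq[abs_def] by (intro continuous_intros)
  have pc: "continuous_on T p"
    by (rule continuous_on_eq[of _ "\<lambda>x. \<pi>0 + \<pi> \<bullet> x"]) (auto simp: p intro!: continuous_intros)
  have int: "(\<lambda>x. l x * p x) integrable_on T" "(\<lambda>x. (l x)\<^sup>2) integrable_on T"
    using lc pc by (auto intro!: set_lebesgue_integral_eq_integral(1) compact_absolutely_integrable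
        compact_mesh[OF T] continuous_intros)
  have zwT: "z \<in> T" "w \<in> T" using zw corners_subset by blast+
  \<comment> \<open>Under the swap \<open>l\<close> changes sign and \<open>p\<close> loses
    \<open>l x * (p z - p w)\<close>, so the integral reappears with a minus sign; solving for it
    produces the division by 2.\<close>
  have "integral T (\<lambda>x. l x * p x) = integral T (\<lambda>x. l (\<sigma> x) * p (\<sigma> x))"
    using change[of "\<lambda>x. l x * p x"] lc pc by (simp add: continuous_on_mult)
  also have "\<dots> = integral T (\<lambda>x. (p z - p w) * (l x)\<^sup>2 - l x * p x)"
  proof (rule integral_cong)
    fix x assume x: "x \<in> T"
    have "p (\<sigma> x) = p x - l x * (p z - p w)"
      using aff[of \<pi>0 \<pi> x] p[OF \<sigma>T[OF x]] p[OF x] p[OF zwT(1)] p[OF zwT(2)] by simp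
    then show "l (\<sigma> x) * p (\<sigma> x) = (p z - p w) * (l x)\<^sup>2 - l x * p x"
      unfolding l\<sigma> by algebra
  qed
  also have "\<dots> = (p z - p w) * integral T (\<lambda>x. (l x)\<^sup>2) - integral T (\<lambda>x. l x * p x)"
    by (intro integral_unique has_integral_diff has_integral_mult_right integrable_integral int)
  finally show ?thesis by (simp add: l_def)
qed

text \<open>Triangles with both corners contribute by \<open>integral_swap\<close>, all with the
  same factor, and on the others the divergence vanishes; so the squares add up to the norm of the
  divergence.\<close>

lemma b_form_bubble:
  assumes q: "q \<in> Qh" and zw: "z \<in> vertices" "w \<in> vertices" "z \<noteq> w"
  defines "v \<equiv> \<lambda>x. (hat z x * hat w x) *\<^sub>R (w - z)"
  shows "b_form \<Omega> v q = - ((q z - q w) / 2 * (\<integral>x. (divergence v x)\<^sup>2 \<partial>area))"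
proof -
  define d where "d T x = (if z \<in> corners T \<and> w \<in> corners T then bary T z x - bary T w x else 0)" for T x
  have div: "divergence v x = d T x" if T: "T \<in> \<T>" "x \<in> interior T" for T x
    using divergence_bubble[OF T, of z w] bary_no_corner[OF T(1), of z] bary_no_corner[OF T(1), of w]
      bary_corner[OF T(1)] zw(3) unfolding v_def d_def by auto
  have dc: "continuous_on T (d T)" if "T \<in> \<T>" for T
    unfolding d_def
    by (cases "z \<in> corners T \<and> w \<in> corners T") (auto intro!: continuous_on_diff continuous_on_bary[OF that])
  have qc: "continuous_on T q" if "T \<in> \<T>" for T
    using q that cover by (auto simp: Q_h_def intro: continuous_on_subset)
  have "(\<integral>x. divergence v x * q x \<partial>area) = (\<Sum>T\<in>\<T>. integral T (\<lambda>x. d T x * q x))"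
    using dc qc div by (intro piecewise_integral(2)) (auto intro: continuous_on_mult)
  also have "\<dots> = (\<Sum>T\<in>\<T>. (q z - q w) / 2 * integral T (\<lambda>x. (d T x)\<^sup>2))"
  proof (rule sum.cong)
    fix T assume T: "T \<in> \<T>"
    show "integral T (\<lambda>x. d T x * q x) = (q z - q w) / 2 * integral T (\<lambda>x. (d T x)\<^sup>2)"
    proof (cases "z \<in> corners T \<and> w \<in> corners T")
      case True
      have "poly_on 1 T q" using q T by (simp add: Q_h_def)
      then obtain \<pi>0 \<pi> where "\<And>x. x \<in> T \<Longrightarrow> q x = \<pi>0 + \<pi> \<bullet> x" unfolding poly_on_1 by blast
      then show ?thesis using integral_swap[OF T, of z w q] True zw(3) by (simp add: d_def)
    qed (auto simp: d_def)
  qed simp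
  also have "\<dots> = (q z - q w) / 2 * (\<Sum>T\<in>\<T>. integral T (\<lambda>x. (d T x)\<^sup>2))"
    by (simp add: sum_distrib_left)
  also have "(\<Sum>T\<in>\<T>. integral T (\<lambda>x. (d T x)\<^sup>2)) = (\<integral>x. (divergence v x)\<^sup>2 \<partial>area)"
    using dc div by (intro piecewise_integral(2)[symmetric]) (auto intro: continuous_on_power)
  finally show ?thesis by (simp add: b_form_def)
qed

lemma inf_sup:
  assumes inner: "\<And>T. T \<in> \<T> \<Longrightarrow> \<exists>x\<in>corners T. x \<notin> frontier \<Omega>"
    and q: "q \<in> Q0_h \<Omega> \<T>"
    and zero: "\<And>v. v \<in> Vh \<Longrightarrow> \<forall>x\<in>frontier \<Omega>. v x = 0 \<Longrightarrow> b_form \<Omega> v q = 0"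
  shows "q = 0"
proof -
  have qQ: "q \<in> Qh" using q by (simp add: Q0_h_def)
  have "\<exists>c. \<forall>x\<in>T. q x = c" if T: "T \<in> \<T>" for T
  proof -
    obtain z where z: "z \<in> corners T" "z \<notin> frontier \<Omega>" using inner[OF T] by blast
    have zV: "z \<in> vertices" using z(1) T by (auto simp: mesh_vertices_def corners_def)
    have "z \<in> closure \<Omega>" using z(1) corners_subset cover T by blast
    then have z\<Omega>: "z \<in> \<Omega>" using z(2) open_domain by (simp add: frontier_def interior_open)
    have eq: "q w = q z" if w: "w \<in> corners T" for w
    proof (cases "w = z")
      case False
      let ?v = "\<lambda>x. (hat z x * hat w x) *\<^sub>R (w - z)"
      have wV: "w \<in> vertices" using w T by (auto simp: mesh_vertices_def corners_def)
      have "b_form \<Omega> ?v q = 0"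
        using hat_frontier[OF zV z\<Omega>] by (intro zero bubble_V_h) auto
      \<comment> \<open>Otherwise the two coordinates would agree throughout \<open>T\<close> by
        continuity, while at \<open>z\<close> they are 1 and 0.\<close>
      moreover have "(\<integral>x. (divergence ?v x)\<^sup>2 \<partial>area) \<noteq> 0"
      proof
        assume 0: "(\<integral>x. (divergence ?v x)\<^sup>2 \<partial>area) = 0"
        have pw: "pw (\<lambda>x. (divergence ?v x)\<^sup>2)"
          unfolding power2_eq_square using bubble_V_h by (intro pw_mult pw_divergence)
        have div0: "bary T z x - bary T w x = 0" if x: "x \<in> interior T" for x
        proof -
          have "divergence ?v x = 0" using pw_integral_eq_0[OF pw _ 0 T x] by simp
          then show ?thesis
            using divergence_bubble[OF T x, of z w] bary_corner[OF T z(1)] bary_corner[OF T w] False by simp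
        qed
        have "continuous_on (closure (interior T)) (\<lambda>x. bary T z x - bary T w x)"
          by (intro continuous_on_diff continuous_on_bary[OF T])
        then have "bary T z z - bary T w z = 0"
          using continuous_constant_on_closure[of "interior T" _ 0 z] div0 z(1) corners_subset
          unfolding closure_interior_mesh[OF T] by blast
        then show False using bary_corner[OF T z(1)] False by simp
      qed
      ultimately show ?thesis using b_form_bubble[OF qQ zV wV] False by auto
    qed simp
    have "poly_on 1 T q" using qQ T by (simp add: Q_h_def)
    then obtain \<alpha> \<beta> where ab: "\<And>x. x \<in> T \<Longrightarrow> q x = \<alpha> + \<beta> \<bullet> x" unfolding poly_on_1 by blast
    have "q x = q z" if x: "x \<in> T" for x
    proof -
      have "q x = (\<Sum>s\<in>corners T. bary T s x * (\<alpha> + \<beta> \<bullet> s))"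
        unfolding ab[OF x] by (rule affine_bary[OF T])
      also have "\<dots> = (\<Sum>s\<in>corners T. bary T s x * q z)"
        using eq ab corners_subset by (intro sum.cong) (auto simp flip: eq ab simp: subset_iff)
      also have "\<dots> = q z" by (simp add: bary_sum[OF T] flip: sum_distrib_right)
      finally show ?thesis .
    qed
    then show ?thesis by blast
  qed
  then obtain c where c: "\<And>T x. T \<in> \<T> \<Longrightarrow> x \<in> T \<Longrightarrow> q x = c T" by metis
  have const: "c T = c T'" if "T \<in> \<T>" "T' \<in> \<T>" for T T'
    using constant_data_on_mesh[OF _ that, of c] c by (metis IntD1 IntD2)
  obtain T0 where T0: "T0 \<in> \<T>" using domain_nonempty cover closure_subset[of \<Omega>] by blast
  have q_eq: "q x = c T0" if "x \<in> closure \<Omega>" for x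
    using that c const[OF _ T0] unfolding cover[symmetric] by auto
  \<comment> \<open>Multiplying the mean value condition by the constant value of \<open>q\<close>
    makes the integrand a square, so the zero criterion for nonnegative integrands applies.\<close>
  have int0: "(\<integral>x. c T0 * q x \<partial>area) = 0" using q by (simp add: Q0_h_def)
  have pwc: "pw (\<lambda>x. c T0 * q x)" by (intro pw_mult pw_const pw_Q_h qQ)
  obtain x0 where x0: "x0 \<in> interior T0" using interior_mesh[OF T0] by blast
  have cl: "x \<in> closure \<Omega>" if "T \<in> \<T>" "x \<in> interior T" for T x
    using that cover interior_subset by blast
  have nonneg: "0 \<le> c T0 * q x" if "T \<in> \<T>" "x \<in> interior T" for T x
    using q_eq[OF cl[OF that]] by simp
  have "c T0 * q x0 = 0" by (rule pw_integral_eq_0[OF pwc nonneg int0 T0 x0])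
  then have "c T0 = 0" using q_eq[OF cl[OF T0 x0]] by simp
  then have "q x = 0" for x
    using q_eq[of x] qQ by (cases "x \<in> closure \<Omega>") (auto simp: Q_h_def)
  then show ?thesis by (simp add: fun_eq_iff)
qed

end


section \<open>Boundaries of polygonal domains\<close>

text \<open>Sides are appended one at a time; for \<open>k < length vs\<close> the closing side is
  still absent, so a new side meets the earlier ones at most in its starting vertex and the path
  remains an arc.\<close>

lemma polygon_arc:
  assumes vs: "simple_polygon vs" and k: "1 \<le> k" "k < length vs"
  shows "\<exists>g. arc g \<and> path_image g = (\<Union>i<k. polygon_side vs i) \<and> pathstart g = vs ! 0 \<and> pathfinish g = vs ! k"
  using k
proof (induction k rule: nat_induct_at_least)
  case base
  have "distinct vs" using vs by (simp add: simple_polygon_def)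
  moreover have "0 < length vs" using base by linarith
  ultimately have "vs ! 0 \<noteq> vs ! 1" using nth_eq_iff_index_eq[of vs 0 1] base by linarith
  then show ?case
    using base by (intro exI[of _ "linepath (vs ! 0) (vs ! 1)"])
      (simp add: polygon_side_def lessThan_Suc)
next
  case (Suc k)
  then obtain g where g: "arc g" "path_image g = (\<Union>i<k. polygon_side vs i)"
    "pathstart g = vs ! 0" "pathfinish g = vs ! k" by auto
  let ?h = "linepath (vs ! k) (vs ! Suc k)"
  have d: "vs ! i = vs ! j \<longleftrightarrow> i = j" if "i < length vs" "j < length vs" for i j
    using vs that by (simp add: simple_polygon_def nth_eq_iff_index_eq)
  have h: "path_image ?h = polygon_side vs k" using Suc by (simp add: polygon_side_def)
  have "polygon_side vs i \<inter> polygon_side vs k \<subseteq> {vs ! k}" if i: "i < k" for i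
  proof -
    have "polygon_side vs i \<inter> polygon_side vs k =
        {vs ! i, vs ! (Suc i mod length vs)} \<inter> {vs ! k, vs ! (Suc k mod length vs)}"
      using vs i Suc by (simp add: simple_polygon_def)
    then show ?thesis using i Suc by (auto simp: d)
  qed
  then have "path_image g \<inter> path_image ?h \<subseteq> {vs ! k}" unfolding h g(2) by blast
  then have "arc (g +++ ?h)"
    using g Suc by (intro arc_join arc_linepath) (auto simp: d)
  moreover have "path_image (g +++ ?h) = (\<Union>i<Suc k. polygon_side vs i)"
    using g h by (subst path_image_join) (auto simp: lessThan_Suc)
  ultimately show ?case using g by (intro exI[of _ "g +++ ?h"]) simp
qed

text \<open>The closing side meets the arc of the other sides only in its two ends and turns it into
  a simple loop. This makes Jordan separation applicable to the boundary polygons.\<close>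

lemma polygon_curve_homeomorphic_circle:
  assumes vs: "simple_polygon vs"
  shows "polygon_curve vs homeomorphic sphere (0::plane) 1"
proof -
  define n where "n = length vs - 1"
  have n: "2 \<le> n" "length vs = Suc n" using vs by (auto simp: simple_polygon_def n_def)
  obtain g where g: "arc g" "path_image g = (\<Union>i<n. polygon_side vs i)"
    "pathstart g = vs ! 0" "pathfinish g = vs ! n"
    using polygon_arc[OF vs, of n] n by auto
  let ?h = "linepath (vs ! n) (vs ! 0)"
  have h: "path_image ?h = polygon_side vs n" using n by (simp add: polygon_side_def)
  have "polygon_side vs i \<inter> polygon_side vs n \<subseteq> {vs ! 0, vs ! n}" if "i < n" for i
  proof -
    have "polygon_side vs i \<inter> polygon_side vs n =
        {vs ! i, vs ! (Suc i mod length vs)} \<inter> {vs ! n, vs ! (Suc n mod length vs)}"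
      using vs that n by (simp add: simple_polygon_def)
    then show ?thesis using n by auto
  qed
  then have "path_image g \<inter> path_image ?h \<subseteq> {pathstart g, pathstart ?h}"
    unfolding h g(2,3) by (simp, blast)
  moreover have "vs ! n \<noteq> vs ! 0" using vs n by (simp add: simple_polygon_def nth_eq_iff_index_eq)
  ultimately have "simple_path (g +++ ?h)"
    using g by (intro simple_path_join_loop arc_linepath) auto
  moreover have "path_image (g +++ ?h) = polygon_curve vs"
    using g h n by (subst path_image_join) (auto simp: polygon_curve_def lessThan_Suc)
  ultimately have "polygon_curve vs homeomorphic sphere (0::complex) 1"
    using homeomorphic_simple_path_image_circle[of "g +++ ?h" 1 0] g by simp
  moreover have "sphere (0::complex) 1 homeomorphic sphere (0::plane) 1"
    by (rule homeomorphic_spheres_gen) auto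
  ultimately show ?thesis by (rule homeomorphic_trans)
qed

text \<open>A connected open set that does not meet a Jordan curve lies on one side of it, and every
  point of the curve is a limit of points from the other side.\<close>

lemma frontier_polygonal_domain:
  assumes dom: "polygonal_domain \<Omega> P"
  shows "frontier \<Omega> \<inter> interior (closure \<Omega>) = {}"
proof -
  have \<Omega>: "open \<Omega>" "connected \<Omega>" "\<Omega> \<noteq> {}" and fr: "frontier \<Omega> = (\<Union>vs\<in>P. polygon_curve vs)"
    using dom by (auto simp: polygonal_domain_def)
  have "x \<notin> interior (closure \<Omega>)" if vs: "vs \<in> P" and x: "x \<in> polygon_curve vs" for vs x
  proof -
    let ?C = "polygon_curve vs"
    have hom: "?C homeomorphic sphere (0::plane) 1"
      using dom vs by (intro polygon_curve_homeomorphic_circle) (simp add: polygonal_domain_def)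
    have "\<Omega> \<inter> frontier \<Omega> = {}" using \<Omega>(1) by (auto simp: frontier_def interior_open)
    then have "\<Omega> \<subseteq> - ?C" using fr vs by blast
    then obtain U where U: "U \<in> components (- ?C)" "\<Omega> \<subseteq> U"
      using exists_component_superset \<Omega> by (metis Compl_empty_eq UNIV_I empty_iff subset_empty)
    have "\<not> connected (- ?C)" using Jordan_Brouwer_separation[OF hom] by simp
    then have "components (- ?C) \<noteq> {U}"
      using in_components_connected[OF U(1)] Union_components[of "- ?C"] by force
    then obtain U' where U': "U' \<in> components (- ?C)" "U' \<noteq> U" using U(1) by blast
    have "compact ?C" using hom homeomorphic_compactness compact_sphere by blast
    then have "open U'" using U'(1) open_components compact_imp_closed by blast
    moreover have "U' \<inter> U = {}" using components_nonoverlap[OF U'(1) U(1)] U'(2) by blast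
    then have "U' \<inter> \<Omega> = {}" using U(2) by blast
    ultimately have disj: "U' \<inter> closure \<Omega> = {}" by (simp add: open_Int_closure_eq_empty)
    have "frontier U' = ?C" using Jordan_Brouwer_frontier[OF hom U'(1)] by simp
    then have "x \<in> closure U'" using x by (auto simp: frontier_def)
    then show ?thesis
      using disj interior_subset[of "closure \<Omega>"] open_Int_closure_eq_empty[of "interior (closure \<Omega>)" U'] by blast
  qed
  then show ?thesis unfolding fr by blast
qed

lemma negligible_frontier_polygonal_domain:
  assumes "polygonal_domain \<Omega> P"
  shows "negligible (frontier \<Omega>)"
proof -
  have "negligible (closed_segment a b)" for a b :: plane
    using interior_closed_segment_ge2[of a b] by (simp add: negligible_convex_interior)
  then show ?thesis
    using assms unfolding polygonal_domain_def polygon_curve_def polygon_side_def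
    by (auto intro!: negligible_Union)
qed


section \<open>Nodes on the slip boundary\<close>

lemma quadratic_on_line:
  assumes "p \<in> poly_le 2"
  obtains c0 c1 c2 where "\<And>t. p (a + t *\<^sub>R d) = c0 + c1 * t + c2 * t\<^sup>2"
proof -
  obtain k0 k1 k2 k3 k4 k5 where p: "p = quadratic k0 k1 k2 k3 k4 k5"
    using assms unfolding poly_le_2 by blast
  show ?thesis
    by (rule that[of "quadratic k0 k1 k2 k3 k4 k5 a"
          "k1 * d $ 1 + k2 * d $ 2 + 2 * k3 * a $ 1 * d $ 1 + k4 * (a $ 1 * d $ 2 + a $ 2 * d $ 1)
            + 2 * k5 * a $ 2 * d $ 2"
          "k3 * (d $ 1)\<^sup>2 + k4 * (d $ 1 * d $ 2) + k5 * (d $ 2)\<^sup>2"])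
      (simp add: p quadratic_def algebra_simps power2_eq_square)
qed

text \<open>Along the segment the function is a quadratic in one variable with zeros at the
  parameters 0, 1/2 and 1.\<close>

lemma quadratic_zero_on_segment:
  assumes p: "poly_on 2 (closed_segment a b) p"
    and zero: "p a = 0" "p (midpoint a b) = 0" "p b = 0" and x: "x \<in> closed_segment a b"
  shows "p x = 0"
proof -
  obtain q where q: "q \<in> poly_le 2" "\<And>x. x \<in> closed_segment a b \<Longrightarrow> p x = q x"
    using p by (auto simp: poly_on_def)
  obtain c0 c1 c2 where c: "\<And>t. q (a + t *\<^sub>R (b - a)) = c0 + c1 * t + c2 * t\<^sup>2"
    using quadratic_on_line[OF q(1)] by blast
  have mid: "midpoint a b = a + (1/2) *\<^sub>R (b - a)"
    by (simp add: vec_eq_iff midpoint_def field_simps)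
  have "q a = 0" "q b = 0" "q (midpoint a b) = 0" using q(2) zero by auto
  then have "c0 = 0" "c0 + c1 + c2 = 0" "c0 + c1 / 2 + c2 / 4 = 0"
    using c[of 0] c[of 1] c[of "1/2"] unfolding mid by (simp_all add: power2_eq_square)
  then have "c0 = 0" "c1 = 0" "c2 = 0" by auto
  moreover obtain t where "x = a + t *\<^sub>R (b - a)"
    using x by (auto simp: in_segment algebra_simps)
  ultimately have "q x = 0" using c by simp
  then show ?thesis using q(2)[OF x] by simp
qed

text \<open>\<open>endpoints\<close> makes \<open>A\<close> and \<open>B\<close> Dirichlet nodes,
  which serve definiteness as well as the quadrature.\<close>

locale boundary_mesh = domain_mesh +
  fixes \<Gamma>0 \<Gamma>1 :: "plane set" and A B :: plane and m :: nat and M :: "nat \<Rightarrow> plane"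
  assumes boundary: "frontier \<Omega> = closure \<Gamma>0 \<union> closure \<Gamma>1" "\<Gamma>0 \<inter> \<Gamma>1 = {}"
      "openin (top_of_set (frontier \<Omega>)) \<Gamma>1"
    and side: "closure \<Gamma>1 = closed_segment A B" "\<Gamma>1 = open_segment A B" "A \<noteq> B"
    and endpoints: "A \<in> closure \<Gamma>0" "B \<in> closure \<Gamma>0"
    and nodes: "side_vertices \<T> A B m M"
begin

text \<open>Parameters outside the unit interval are allowed, because a triangle side meeting
  \<open>\<Gamma>1\<close> is not known in advance to stay within it.\<close>

definition line :: "real \<Rightarrow> plane" where
  "line t = A + t *\<^sub>R (B - A)"

lemma line_inject: "line s = line t \<longleftrightarrow> s = t"
  using side(3) by (simp add: line_def)

lemma line_affine: "line ((1 - u) * s + u * t) = (1 - u) *\<^sub>R line s + u *\<^sub>R line t"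
  by (simp add: line_def algebra_simps)

lemma line_01: "line 0 = A" "line 1 = B"
  by (simp_all add: line_def)

lemma mem_closed_segment_line: "x \<in> closed_segment A B \<longleftrightarrow> (\<exists>t. 0 \<le> t \<and> t \<le> 1 \<and> x = line t)"
  by (auto simp: in_segment line_def algebra_simps)

lemma mem_slip: "x \<in> \<Gamma>1 \<longleftrightarrow> (\<exists>t. 0 < t \<and> t < 1 \<and> x = line t)"
  using side(3) unfolding side(2) by (auto simp: in_segment line_def algebra_simps)

lemma open_segment_line:
  assumes "s < t"
  shows "line u \<in> open_segment (line s) (line t) \<longleftrightarrow> s < u \<and> u < t"
proof
  assume "line u \<in> open_segment (line s) (line t)"
  then obtain k where k: "0 < k" "k < 1" "line u = line ((1 - k) * s + k * t)"
    by (auto simp: in_segment line_affine)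
  then have u: "u = s + k * (t - s)" by (simp add: line_inject algebra_simps)
  have "0 < k * (t - s)" "k * (t - s) < 1 * (t - s)" using k assms by (auto intro: mult_strict_right_mono)
  then show "s < u \<and> u < t" using u by simp
next
  assume u: "s < u \<and> u < t"
  define k where "k = (u - s) / (t - s)"
  have k: "0 < k" "k < 1" "k * (t - s) = u - s" using u by (auto simp: k_def)
  then have "(1 - k) * s + k * t = u" by (simp add: algebra_simps)
  then show "line u \<in> open_segment (line s) (line t)"
    using assms k by (auto simp: in_segment line_inject simp flip: line_affine)
qed

lemma slip_frontier: "\<Gamma>1 \<subseteq> frontier \<Omega>"
  using boundary(3) by (auto dest: openin_imp_subset)

lemma slip_closure: "\<Gamma>1 \<subseteq> closure \<Omega>"
  using slip_frontier by (auto simp: frontier_def)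

lemma slip_not_interior: "x \<in> \<Gamma>1 \<Longrightarrow> T \<in> \<T> \<Longrightarrow> x \<notin> interior T"
  using slip_frontier interior_mesh_subset open_domain by (auto simp: frontier_def interior_open)

text \<open>A relatively open set disjoint from \<open>\<Gamma>0\<close> also avoids its closure.
  Hence nodal functions of slip nodes respect the Dirichlet conditions.\<close>

lemma slip_not_closure_Dirichlet: "x \<in> \<Gamma>1 \<Longrightarrow> x \<notin> closure \<Gamma>0"
proof
  assume x: "x \<in> \<Gamma>1" "x \<in> closure \<Gamma>0"
  obtain U where U: "open U" "\<Gamma>1 = U \<inter> frontier \<Omega>"
    using boundary(3) by (auto simp: openin_open)
  then have "U \<inter> \<Gamma>0 \<noteq> {}" using x open_Int_closure_eq_empty[of U \<Gamma>0] by blast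
  moreover have "\<Gamma>0 \<subseteq> frontier \<Omega>" using boundary(1) closure_subset by blast
  ultimately show False using U(2) boundary(2) by blast
qed

lemma interior_if_bary_pos:
  assumes T: "T \<in> \<T>" and pos: "\<And>s. s \<in> corners T \<Longrightarrow> 0 < bary T s x"
  shows "x \<in> interior T"
proof (rule interiorI)
  show "open (\<Inter>s\<in>corners T. {x. 0 < bary T s x})"
  proof (rule open_INT[OF corners_simplex(1)[OF T]], rule ballI)
    fix s
    show "open {x. 0 < bary T s x}"
      using continuous_on_bary[OF T] by (intro open_Collect_less continuous_on_const)
  qed
  show "x \<in> (\<Inter>s\<in>corners T. {x. 0 < bary T s x})" using pos by auto
  show "(\<Inter>s\<in>corners T. {x. 0 < bary T s x}) \<subseteq> T"
    using mem_mesh_iff[OF T] by (auto intro: less_imp_le)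
qed

lemma corners_insert:
  assumes T: "T \<in> \<T>" and ab: "a \<in> corners T" "b \<in> corners T" "a \<noteq> b"
  obtains c where "corners T = {a, b, c}" "c \<noteq> a" "c \<noteq> b"
proof -
  have "card (corners T - {a, b}) = 1"
    using corners_simplex(1,2)[OF T] ab by (simp add: card_Diff_subset)
  then obtain c where "corners T - {a, b} = {c}" by (auto simp: card_1_singleton_iff)
  then show ?thesis using that[of c] ab by blast
qed

lemma bary_line: "T \<in> \<T> \<Longrightarrow> bary T s (line t) = (1 - t) * bary T s A + t * bary T s B"
  using bary_affine[of T s] by (auto simp: line_def inner_add_right inner_diff_right algebra_simps)

lemma bary_open_segment:
  assumes T: "T \<in> \<T>" and ab: "a \<in> corners T" "b \<in> corners T" "a \<noteq> b" and x: "x \<in> open_segment a b"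
  shows "0 < bary T a x" "0 < bary T b x" "c \<noteq> a \<Longrightarrow> c \<noteq> b \<Longrightarrow> bary T c x = 0"
proof -
  obtain u where u: "0 < u" "u < 1" "x = (1 - u) *\<^sub>R a + u *\<^sub>R b" using x by (auto simp: in_segment)
  have "bary T s x = (1 - u) * bary T s a + u * bary T s b" for s
  proof -
    obtain \<alpha> \<beta> where "bary T s = (\<lambda>x. \<alpha> + \<beta> \<bullet> x)" using bary_affine[OF T] by blast
    then show ?thesis unfolding u(3) by (simp add: inner_add_right algebra_simps)
  qed
  then show "0 < bary T a x" "0 < bary T b x" "c \<noteq> a \<Longrightarrow> c \<noteq> b \<Longrightarrow> bary T c x = 0"
    using u ab bary_corner[OF T ab(1)] bary_corner[OF T ab(2)] by auto
qed

text \<open>If the side crossed the open segment \<open>\<Gamma>1\<close> transversally, some nearby point of \<open>\<Gamma>1\<close> would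
  lie in the interior of the triangle.\<close>

lemma side_along_slip:
  assumes T: "T \<in> \<T>" and ab: "a \<in> corners T" "b \<in> corners T" "a \<noteq> b"
    and x: "x \<in> open_segment a b" "x \<in> \<Gamma>1"
  shows "\<exists>s t. a = line s \<and> b = line t"
proof -
  obtain c where c: "corners T = {a, b, c}" "c \<noteq> a" "c \<noteq> b" using corners_insert[OF T ab] .
  obtain r where r: "0 < r" "r < 1" "x = line r" using x(2) mem_slip by blast
  note pos = bary_open_segment[OF T ab x(1)]
  define \<kappa> where "\<kappa> = bary T c B - bary T c A"
  \<comment> \<open>\<open>x\<close> lies on the side opposite to \<open>c\<close>, so the
    coordinate of \<open>c\<close> vanishes at parameter \<open>r\<close> and is linear along the
    slip line, with slope \<open>\<kappa>\<close>.\<close>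
  have bc: "bary T c (line (r + \<delta>)) = \<delta> * \<kappa>" for \<delta>
    using bary_line[OF T, of c r] bary_line[OF T, of c "r + \<delta>"] pos(3)[OF c(2,3)] r(3)
    by (simp add: \<kappa>_def algebra_simps)
  have "\<kappa> = 0"
  proof (rule ccontr)
    assume \<kappa>: "\<kappa> \<noteq> 0"
    \<comment> \<open>Moving in the direction \<open>sgn \<kappa>\<close> makes the coordinate of
      \<open>c\<close> positive while the other two stay positive by continuity; a slip point would
      be interior to \<open>T\<close>.\<close>
    have cont: "isCont (\<lambda>\<delta>. bary T s (line (r + \<delta> * sgn \<kappa>))) 0" for s
      unfolding bary_line[OF T] by (intro continuous_intros)
    have "\<forall>\<^sub>F \<delta> in at_right 0. 0 < bary T s (line (r + \<delta> * sgn \<kappa>))" if "s = a \<or> s = b" for s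
    proof (rule order_tendstoD(1))
      show "((\<lambda>\<delta>. bary T s (line (r + \<delta> * sgn \<kappa>))) \<longlongrightarrow> bary T s (line (r + 0 * sgn \<kappa>))) (at_right 0)"
        using cont[of s] unfolding isCont_def by (rule tendsto_within_subset) simp
      show "0 < bary T s (line (r + 0 * sgn \<kappa>))" using that pos(1,2) r(3) by auto
    qed
    then have "\<forall>\<^sub>F \<delta> in at_right 0. 0 < bary T a (line (r + \<delta> * sgn \<kappa>))"
      "\<forall>\<^sub>F \<delta> in at_right 0. 0 < bary T b (line (r + \<delta> * sgn \<kappa>))" by auto
    moreover have "((\<lambda>\<delta>. r + \<delta> * sgn \<kappa>) \<longlongrightarrow> r + 0 * sgn \<kappa>) (at_right 0)" by (intro tendsto_intros)
    then have "\<forall>\<^sub>F \<delta> in at_right 0. 0 < r + \<delta> * sgn \<kappa>" "\<forall>\<^sub>F \<delta> in at_right 0. r + \<delta> * sgn \<kappa> < 1"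
      using r by (auto intro: order_tendstoD)
    moreover have "\<forall>\<^sub>F \<delta> in at_right 0. (0::real) < \<delta>" by (simp add: eventually_at_filter)
    ultimately have "\<forall>\<^sub>F \<delta> in at_right (0::real). False"
    proof eventually_elim
      case (elim \<delta>)
      have "0 < bary T c (line (r + \<delta> * sgn \<kappa>))"
        using elim(5) \<kappa> unfolding bc by (simp add: mult.assoc abs_sgn[symmetric] mult.commute[of "sgn \<kappa>"])
      then have "line (r + \<delta> * sgn \<kappa>) \<in> interior T"
        using elim(1,2) c(1) by (intro interior_if_bary_pos[OF T]) auto
      then show False using slip_not_interior[OF _ T] elim(3,4) mem_slip by blast
    qed
    then show False by simp
  qed
  then have "bary T c (line t) = 0" for t using bc[of "t - r"] by simp
  then have onab: "line t = a + bary T b (line t) *\<^sub>R (b - a)" for t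
  proof -
    assume "\<And>t. bary T c (line t) = 0"
    then have "bary T a (line t) + bary T b (line t) = 1"
      "bary T a (line t) *\<^sub>R a + bary T b (line t) *\<^sub>R b = line t"
      using bary_sum[OF T, of "line t"] bary_point[OF T, of "line t"] c ab(3) by auto
    then have "bary T a (line t) = 1 - bary T b (line t)"
      "line t = bary T a (line t) *\<^sub>R a + bary T b (line t) *\<^sub>R b" by simp_all
    then have "line t = (1 - bary T b (line t)) *\<^sub>R a + bary T b (line t) *\<^sub>R b" by (simp only:)
    also have "\<dots> = a + bary T b (line t) *\<^sub>R (b - a)" by (simp add: algebra_simps)
    finally show ?thesis .
  qed
  \<comment> \<open>The slip line lies in the line through \<open>a\<close> and \<open>b\<close>;
    inverting its affine parametrisation expresses \<open>a\<close> and \<open>b\<close> by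
    parameters of \<open>line\<close>.\<close>
  define \<beta>0 \<beta>1 where "\<beta>0 = bary T b A" and "\<beta>1 = bary T b B"
  have AB: "A = a + \<beta>0 *\<^sub>R (b - a)" "B = a + \<beta>1 *\<^sub>R (b - a)"
    using onab[of 0] onab[of 1] by (simp_all add: line_01 \<beta>0_def \<beta>1_def)
  have ne: "\<beta>1 - \<beta>0 \<noteq> 0" using AB side(3) by auto
  have "B - A = (a + \<beta>1 *\<^sub>R (b - a)) - (a + \<beta>0 *\<^sub>R (b - a))" using AB by (simp only:)
  then have BA: "B - A = (\<beta>1 - \<beta>0) *\<^sub>R (b - a)" by (simp add: scaleR_left_diff_distrib)
  have "b - a = (1 / (\<beta>1 - \<beta>0)) *\<^sub>R (B - A)" unfolding BA using ne by simp
  then have ba: "k *\<^sub>R (b - a) = (k / (\<beta>1 - \<beta>0)) *\<^sub>R (B - A)" for k by simp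
  have aA: "A - \<beta>0 *\<^sub>R (b - a) = a" using AB(1) by (metis add_diff_cancel_right')
  have "A + (1 - \<beta>0) *\<^sub>R (b - a) = (A - \<beta>0 *\<^sub>R (b - a)) + (b - a)"
    by (simp add: scaleR_left_diff_distrib)
  also have "\<dots> = b" unfolding aA by simp
  finally have "a = A - \<beta>0 *\<^sub>R (b - a)" "b = A + (1 - \<beta>0) *\<^sub>R (b - a)" using aA by simp_all
  then have "a = line (- \<beta>0 / (\<beta>1 - \<beta>0))" "b = line ((1 - \<beta>0) / (\<beta>1 - \<beta>0))"
    unfolding ba by (simp_all add: line_def)
  then show ?thesis by blast
qed

section \<open>Order of the nodes along the slip side\<close>

definition par :: "nat \<Rightarrow> real" where
  "par i = (SOME t. 0 \<le> t \<and> t \<le> 1 \<and> M i = line t)"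

lemma par:
  assumes "i \<in> {1..Suc m}"
  shows "0 \<le> par i" "par i \<le> 1" "M i = line (par i)"
proof -
  have "M i \<in> closed_segment A B" using nodes assms by (auto simp: side_vertices_def)
  then have "\<exists>t. 0 \<le> t \<and> t \<le> 1 \<and> M i = line t" by (simp add: mem_closed_segment_line)
  from someI_ex[OF this] show "0 \<le> par i" "par i \<le> 1" "M i = line (par i)" by (auto simp: par_def)
qed

lemma M_vertex: "i \<in> {1..Suc m} \<Longrightarrow> M i \<in> vertices"
  using nodes by (auto simp: side_vertices_def)

lemma M_ends: "M 1 = A" "M (Suc m) = B"
  using nodes by (auto simp: side_vertices_def)

lemma vertex_on_side: "x \<in> vertices \<Longrightarrow> x \<in> closed_segment A B \<Longrightarrow> \<exists>i\<in>{1..Suc m}. x = M i"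
proof -
  assume "x \<in> vertices" "x \<in> closed_segment A B"
  then have "x \<in> M ` {1..Suc m}" using nodes unfolding side_vertices_def by blast
  then show ?thesis by blast
qed

lemma par_less:
  assumes "i \<in> {1..Suc m}" "j \<in> {1..Suc m}" "i < j"
  shows "par i < par j"
proof -
  have d: "dist A (line t) = \<bar>t\<bar> * dist A B" for t
    by (simp add: line_def dist_norm norm_minus_commute)
  have "dist A (M i) < dist A (M j)" using nodes assms unfolding side_vertices_def by blast
  then show ?thesis
    using side(3) par[OF assms(1)] par[OF assms(2)] by (simp add: d)
qed

lemma par_less_iff: "i \<in> {1..Suc m} \<Longrightarrow> j \<in> {1..Suc m} \<Longrightarrow> par i < par j \<longleftrightarrow> i < j"
  using par_less by (metis less_asym linorder_neqE_nat order_less_irrefl)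

lemma par_ends: "par 1 = 0" "par (Suc m) = 1"
proof -
  have "line (par 1) = line 0" "line (par (Suc m)) = line 1"
    using par(3)[of 1] par(3)[of "Suc m"] M_ends line_01 by simp_all
  then show "par 1 = 0" "par (Suc m) = 1" by (simp_all only: line_inject)
qed

text \<open>A mesh vertex strictly between \<open>a\<close> and \<open>b\<close> would be a corner
  of \<open>T\<close> by conformity, yet not extreme. So no \<open>M k\<close> lies between them,
  which keeps the side within the slip side and makes its ends consecutive.\<close>

lemma edge_on_slip:
  assumes T: "T \<in> \<T>" and ab: "a \<in> corners T" "b \<in> corners T" "a \<noteq> b"
    and x: "x \<in> open_segment a b" "x \<in> \<Gamma>1"
  shows "\<exists>i\<in>{1..m}. {a, b} = {M i, M (Suc i)} \<and> x \<in> open_segment (M i) (M (Suc i))"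
proof -
  have *: "\<exists>i\<in>{1..m}. a = M i \<and> b = M (Suc i)"
    if ab: "a \<in> corners T" "b \<in> corners T" "x \<in> open_segment a b" and st: "a = line s" "b = line t" "s < t" for a b s t
  proof -
    obtain r where r: "0 < r" "r < 1" "x = line r" using x(2) mem_slip by blast
    have rst: "s < r" "r < t" using open_segment_line[OF st(3)] ab(3) st r(3) by auto
    have gap: "\<not> (s < par k \<and> par k < t)" if k: "k \<in> {1..Suc m}" for k
    proof
      assume "s < par k \<and> par k < t"
      then have Mk: "M k \<in> open_segment a b" using open_segment_line[OF st(3)] st par(3)[OF k] by simp
      have abT: "a \<in> T" "b \<in> T" using ab corners_subset by auto
      then have "M k \<in> T"
        using Mk closed_segment_subset[OF _ _ convex_mesh[OF T]] open_closed_segment by blast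
      then have "M k \<in> corners T" using corner_of_mesh_vertex[OF M_vertex[OF k] T] by blast
      then have "M k extreme_point_of T" by (simp add: corners_def)
      then show False using Mk abT by (auto simp: extreme_point_of_def)
    qed
    \<comment> \<open>\<open>A\<close> and \<open>B\<close> are mesh vertices with parameters 0 and
      1; since the side contains a slip point, reaching beyond them would put one of them strictly
      inside it.\<close>
    have "0 \<le> s" "t \<le> 1" using gap[of 1] gap[of "Suc m"] par_ends rst r by auto
    then have "a \<in> closed_segment A B" "b \<in> closed_segment A B"
      using st unfolding mem_closed_segment_line by (auto intro: exI[of _ s] exI[of _ t])
    moreover have "a \<in> vertices" "b \<in> vertices"
      using ab T by (auto simp: mesh_vertices_def corners_def)
    ultimately obtain k l where kl: "k \<in> {1..Suc m}" "a = M k" "l \<in> {1..Suc m}" "b = M l"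
      using vertex_on_side by metis
    have pkl: "s = par k" "t = par l" using kl st par(3) by (auto simp: line_inject)
    then have "k < l" using st(3) par_less_iff kl by simp
    moreover have "\<not> Suc k < l"
    proof
      assume "Suc k < l"
      then show False using gap[of "Suc k"] par_less[of k "Suc k"] par_less[of "Suc k" l] kl pkl by auto
    qed
    ultimately show ?thesis using kl by (intro bexI[of _ k]) (auto simp: not_less less_eq_Suc_le)
  qed
  obtain s t where st: "a = line s" "b = line t" using side_along_slip[OF T ab x] by blast
  then have "s \<noteq> t" using ab(3) by auto
  then consider "s < t" | "t < s" by linarith
  then show ?thesis
  proof cases
    case 1
    obtain i where "i \<in> {1..m}" "a = M i" "b = M (Suc i)" using *[OF ab(1,2) x(1) st 1] by blast
    then show ?thesis using x(1) by auto
  next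
    case 2
    have xba: "x \<in> open_segment b a" using x(1) by (simp add: open_segment_commute)
    obtain i where "i \<in> {1..m}" "b = M i" "a = M (Suc i)" using *[OF ab(2,1) xba st(2,1) 2] by blast
    then show ?thesis using xba by auto
  qed
qed

text \<open>A slip point is interior to no triangle, so in a triangle containing it some barycentric
  coordinate vanishes and the point lies on the opposite side.\<close>

lemma edge_through_slip_point:
  assumes x: "x \<in> \<Gamma>1" "x \<notin> vertices"
  shows "\<exists>i\<in>{1..m}. x \<in> open_segment (M i) (M (Suc i)) \<and>
    (\<exists>T\<in>\<T>. M i \<in> corners T \<and> M (Suc i) \<in> corners T)"
proof -
  obtain T where T: "T \<in> \<T>" "x \<in> T" using x slip_closure cover by blast
  have nonneg: "0 \<le> bary T s x" for s using bary_nonneg[OF T] .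
  have "x \<notin> interior T" using slip_not_interior[OF x(1) T(1)] .
  then obtain c where c: "c \<in> corners T" "bary T c x = 0"
    using interior_if_bary_pos[OF T(1), of x] nonneg by (metis order_less_le)
  have "card (corners T - {c}) = 2" using corners_simplex(1,2)[OF T(1)] c by simp
  then obtain a b where ab: "corners T - {c} = {a, b}" "a \<noteq> b" by (auto simp: card_2_iff)
  then have C: "corners T = {c, a, b}" "c \<noteq> a" "c \<noteq> b" using c by auto
  have sum: "bary T a x + bary T b x = 1" "bary T a x *\<^sub>R a + bary T b x *\<^sub>R b = x"
    using bary_sum[OF T(1), of x] bary_point[OF T(1), of x] c(2) C ab(2) by auto
  have abc: "a \<in> corners T" "b \<in> corners T" using C by auto
  have xne: "x \<noteq> a" "x \<noteq> b" using x(2) abc T(1) by (auto simp: mesh_vertices_def corners_def)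
  have "bary T a x \<noteq> 0" "bary T b x \<noteq> 0" using sum xne by auto
  then have "0 < bary T a x" "0 < bary T b x" using nonneg by (simp_all add: less_le)
  then have pos: "0 < bary T b x" "bary T b x < 1" and "bary T a x = 1 - bary T b x" using sum(1) by linarith+
  then have "x = (1 - bary T b x) *\<^sub>R a + bary T b x *\<^sub>R b" using sum(2) by simp
  then have "x \<in> open_segment a b" using pos ab(2) by (auto simp: in_segment)
  then obtain i where i: "i \<in> {1..m}" "{a, b} = {M i, M (Suc i)}" "x \<in> open_segment (M i) (M (Suc i))"
    using edge_on_slip[OF T(1) abc ab(2) _ x(1)] by blast
  moreover have "M i \<in> corners T" "M (Suc i) \<in> corners T" using i(2) abc by (auto simp: doubleton_eq_iff)
  ultimately show ?thesis using T(1) by blast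
qed

lemma half_node_line: "i \<in> {1..m} \<Longrightarrow> half_node M i = line ((par i + par (Suc i)) / 2)"
proof -
  assume "i \<in> {1..m}"
  then have "M i = line (par i)" "M (Suc i) = line (par (Suc i))" using par(3)[of i] par(3)[of "Suc i"] by auto
  then show ?thesis
    using line_affine[of "1/2" "par i" "par (Suc i)"]
    by (simp add: half_node_def midpoint_def scaleR_add_right add_divide_distrib)
qed

lemma par_Suc: "i \<in> {1..m} \<Longrightarrow> par i < par (Suc i)"
  by (rule par_less) auto

lemma slip_half_node: "i \<in> {1..m} \<Longrightarrow> half_node M i \<in> \<Gamma>1"
  using half_node_line par_Suc[of i] par(1)[of i] par(2)[of "Suc i"] unfolding mem_slip
  by (intro exI[of _ "(par i + par (Suc i)) / 2"]) auto

lemma gap_not_vertex: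
  assumes i: "i \<in> {1..m}" and x: "x = line t" "par i < t" "t < par (Suc i)"
  shows "x \<notin> vertices"
proof
  assume "x \<in> vertices"
  moreover have "x \<in> closed_segment A B"
    using x par(1)[of i] par(2)[of "Suc i"] i unfolding mem_closed_segment_line by (intro exI[of _ t]) auto
  ultimately obtain k where k: "k \<in> {1..Suc m}" "x = M k" using vertex_on_side by blast
  then have "t = par k" using x(1) par(3)[OF k(1)] by (simp add: line_inject)
  then have "i < k" "k < Suc i" using x i k by (simp_all add: par_less_iff[symmetric])
  then show False by simp
qed

lemma half_node_not_vertex: "i \<in> {1..m} \<Longrightarrow> half_node M i \<notin> vertices"
  using half_node_line par_Suc[of i] gap_not_vertex by simp

text \<open>The triangle side through the midpoint between \<open>M i\<close> and
  \<open>M (Suc i)\<close> joins some \<open>M k\<close> and \<open>M (Suc k)\<close>, and the order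
  of the parameters leaves only \<open>k = i\<close>.\<close>

lemma slip_triangle:
  assumes i: "i \<in> {1..m}"
  shows "\<exists>T\<in>\<T>. M i \<in> corners T \<and> M (Suc i) \<in> corners T"
proof -
  obtain k where k: "k \<in> {1..m}" "half_node M i \<in> open_segment (M k) (M (Suc k))"
    and T: "\<exists>T\<in>\<T>. M k \<in> corners T \<and> M (Suc k) \<in> corners T"
    using edge_through_slip_point[OF slip_half_node[OF i] half_node_not_vertex[OF i]] by blast
  have Mk: "M k = line (par k)" "M (Suc k) = line (par (Suc k))" using k par(3) by auto
  have "par k < (par i + par (Suc i)) / 2" "(par i + par (Suc i)) / 2 < par (Suc k)"
    using k(2) open_segment_line[OF par_Suc[OF k(1)]] unfolding half_node_line[OF i] Mk by auto
  then have "par k < par (Suc i)" "par i < par (Suc k)" using par_Suc[OF i] by auto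
  then have "k < Suc i" "i < Suc k" using i k by (simp_all add: par_less_iff)
  then have "k = i" by simp
  then show ?thesis using T by simp
qed

lemma M_inject: "i \<in> {1..Suc m} \<Longrightarrow> j \<in> {1..Suc m} \<Longrightarrow> M i = M j \<longleftrightarrow> i = j"
  using par(3) par_less_iff by (metis line_inject linorder_neqE_nat order_less_irrefl)

lemma corners_edge:
  assumes T: "T \<in> \<T>" and ab: "a \<in> corners T" "b \<in> corners T" "a \<noteq> b"
  shows "closed_segment a b \<in> mesh_sides \<T>"
proof -
  have "convex hull {a, b} face_of convex hull (corners T)"
    unfolding face_of_convex_hull_affine_independent[OF corners_simplex(3)[OF T]]
    using ab by (intro exI[of _ "{a, b}"]) auto
  then have "closed_segment a b face_of T"
    by (simp only: segment_convex_hull corners_simplex(4)[OF T, symmetric])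
  then have "closed_segment a b edge_of T"
    using ab(3) by (simp add: edge_of_def segment_convex_hull aff_dim_convex_hull aff_dim_2)
  then show ?thesis using T by (auto simp: mesh_sides_def)
qed

lemma mesh_side_corners:
  assumes "closed_segment a b \<in> mesh_sides \<T>"
  obtains T where "T \<in> \<T>" "a \<in> corners T" "b \<in> corners T" "a \<noteq> b"
proof -
  obtain T where T: "T \<in> \<T>" "closed_segment a b edge_of T" using assms by (auto simp: mesh_sides_def)
  have ab: "a \<noteq> b" using T(2) by (auto simp: edge_of_def)
  have "x \<in> corners T" if "x extreme_point_of closed_segment a b" for x
    using that T(2) extreme_point_of_face[of "closed_segment a b" T x] by (auto simp: edge_of_def corners_def)
  then show ?thesis using that[OF T(1)] ab by (simp add: extreme_point_of_segment)
qed

lemma half_node_mesh_node: "i \<in> {1..m} \<Longrightarrow> half_node M i \<in> mesh_nodes \<T>"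
proof -
  assume i: "i \<in> {1..m}"
  obtain T where T: "T \<in> \<T>" "M i \<in> corners T" "M (Suc i) \<in> corners T" using slip_triangle[OF i] by blast
  have "M i \<noteq> M (Suc i)" using M_inject[of i "Suc i"] i by auto
  then have "closed_segment (M i) (M (Suc i)) \<in> mesh_sides \<T>" using corners_edge[OF T] by blast
  then show ?thesis unfolding mesh_nodes_def half_node_def by blast
qed

text \<open>Midpoints on \<open>\<Gamma>1\<close> come from mesh sides that
  \<open>edge_on_slip\<close> identifies. Vertex indices run from 2 to \<open>m\<close> because
  \<open>M 1\<close> and \<open>M (Suc m)\<close> are the ends excluded from
  \<open>\<Gamma>1\<close>.\<close>

lemma slip_nodes:
  assumes x: "x \<in> \<Gamma>1" "x \<in> mesh_nodes \<T>"
  shows "(\<exists>i\<in>{2..m}. x = M i) \<or> (\<exists>i\<in>{1..m}. x = half_node M i)"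
proof (cases "x \<in> vertices")
  case True
  have "x \<in> closed_segment A B" "x \<noteq> A" "x \<noteq> B" using x(1) side(1,2) closure_subset[of \<Gamma>1] by (auto simp: open_segment_def)
  then obtain i where i: "i \<in> {1..Suc m}" "x = M i" using vertex_on_side[OF True] by blast
  moreover have "i \<noteq> 1" "i \<noteq> Suc m" using i \<open>x \<noteq> A\<close> \<open>x \<noteq> B\<close> M_ends by auto
  ultimately have "i \<in> {2..m}" by auto
  then show ?thesis using i by blast
next
  case False
  then obtain a b where ab: "x = midpoint a b" "closed_segment a b \<in> mesh_sides \<T>"
    using x(2) by (auto simp: mesh_nodes_def)
  obtain T where T: "T \<in> \<T>" "a \<in> corners T" "b \<in> corners T" "a \<noteq> b" using mesh_side_corners[OF ab(2)] .
  have "x \<in> open_segment a b" using T(4) by (simp add: ab(1))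
  then obtain i where i: "i \<in> {1..m}" "{a, b} = {M i, M (Suc i)}" using edge_on_slip[OF T _ x(1)] by blast
  then have "x = half_node M i" unfolding ab(1) half_node_def by (auto simp: doubleton_eq_iff midpoint_sym)
  then show ?thesis using i(1) by blast
qed

lemma slip_M: "i \<in> {2..m} \<Longrightarrow> M i \<in> \<Gamma>1"
  using par(3)[of i] par_less[of 1 i] par_less[of i "Suc m"] par_ends unfolding mem_slip
  by (intro exI[of _ "par i"]) auto

end


text \<open>Each polygon side adjacent to \<open>S\<close> meets it only in the common vertex, so
  the rest of that side lies in \<open>closure \<Gamma>\<close>, which is closed and hence contains
  the vertex.\<close>

lemma polygon_side_ends:
  assumes dom: "polygonal_domain \<Omega> P" and whole: "\<exists>vs\<in>P. \<exists>i<length vs. S = polygon_side vs i"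
    and bd: "frontier \<Omega> = closure \<Gamma> \<union> S" and S: "S = closed_segment A B"
  shows "A \<in> closure \<Gamma> \<and> B \<in> closure \<Gamma>"
proof -
  obtain vs i where vs: "vs \<in> P" "i < length vs" "S = polygon_side vs i" using whole by blast
  have poly: "simple_polygon vs" and sub: "polygon_curve vs \<subseteq> frontier \<Omega>"
    using dom vs(1) by (auto simp: polygonal_domain_def)
  let ?N = "length vs"
  have N: "3 \<le> ?N" "distinct vs" using poly by (auto simp: simple_polygon_def)
  have meet: "polygon_side vs k \<inter> polygon_side vs l =
      {vs ! k, vs ! (Suc k mod ?N)} \<inter> {vs ! l, vs ! (Suc l mod ?N)}"
    if "k < ?N" "l < ?N" "k \<noteq> l" for k l
    using poly that unfolding simple_polygon_def by blast
  have neighbour: "a \<in> closure \<Gamma>"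
    if k: "k < ?N" "k \<noteq> i" and seg: "polygon_side vs k = closed_segment a c" "a \<noteq> c"
      and int: "polygon_side vs k \<inter> S = {a}" for a c k
  proof -
    have "closed_segment a c \<subseteq> frontier \<Omega>" using sub k seg(1) by (auto simp: polygon_curve_def)
    then have "open_segment a c \<subseteq> closure \<Gamma>"
      using bd int seg(1) by (auto simp: open_segment_def)
    then have "closure (open_segment a c) \<subseteq> closure \<Gamma>" by (rule closure_minimal) simp
    then have "closed_segment a c \<subseteq> closure \<Gamma>" unfolding closure_open_segment using seg(2) by simp
    then show ?thesis using ends_in_segment(1) by blast
  qed
  let ?j = "Suc i mod ?N"
  have d: "vs ! k = vs ! l \<longleftrightarrow> k = l" if "k < ?N" "l < ?N" for k l
    using N(2) that by (simp add: nth_eq_iff_index_eq)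
  have j: "?j < ?N" "?j \<noteq> i" using vs(2) N by (auto simp: mod_Suc)
  have jj: "Suc ?j mod ?N < ?N" "Suc ?j mod ?N \<noteq> ?j" "Suc ?j mod ?N \<noteq> i"
    using vs(2) N by (auto simp: mod_Suc split: if_splits)
  have "vs ! ?j \<in> closure \<Gamma>"
  proof (rule neighbour[OF j])
    show "polygon_side vs ?j = closed_segment (vs ! ?j) (vs ! (Suc ?j mod ?N))" by (simp add: polygon_side_def)
    show "vs ! ?j \<noteq> vs ! (Suc ?j mod ?N)" using j jj by (simp add: d)
    show "polygon_side vs ?j \<inter> S = {vs ! ?j}"
      unfolding vs(3) meet[OF j(1) vs(2) j(2)] using j jj vs(2) by (auto simp: d)
  qed
  \<comment> \<open>The cyclic predecessor of \<open>i\<close>; with at least three sides it differs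
    from the successor, so it shares a single vertex with the slip side.\<close>
  moreover define p where "p = (if i = 0 then ?N - 1 else i - 1)"
  have p: "p < ?N" "p \<noteq> i" "Suc p mod ?N = i" "p \<noteq> ?j"
    using vs(2) N by (auto simp: p_def mod_Suc split: if_splits)
  have "vs ! i \<in> closure \<Gamma>"
  proof (rule neighbour[OF p(1,2)])
    show "polygon_side vs p = closed_segment (vs ! i) (vs ! p)"
      by (simp add: polygon_side_def p(3) closed_segment_commute)
    show "vs ! i \<noteq> vs ! p" using p vs(2) by (simp add: d)
    show "polygon_side vs p \<inter> S = {vs ! i}"
      unfolding vs(3) meet[OF p(1) vs(2) p(2)] p(3) using p j vs(2) by (auto simp: d)
  qed
  moreover have "closed_segment A B = closed_segment (vs ! i) (vs ! ?j)"
    using vs(3) S by (simp add: polygon_side_def)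
  then have "{A, B} = {vs ! i, vs ! ?j}" by simp
  ultimately show ?thesis by (auto simp: doubleton_eq_iff)
qed

section \<open>The finite element problem as an instance of the abstract one\<close>

lemma tangent_unit: "norm n = 1 \<Longrightarrow> tangent n \<bullet> tangent n = 1"
  by (simp add: tangent_def inner_vec_def sum_2 norm_eq_1)

lemma tangent_orthogonal: "tangent n \<bullet> n = 0"
  by (simp add: tangent_def inner_vec_def sum_2)

locale friction_mesh = boundary_mesh +
  fixes n :: plane and \<nu> :: real and f :: "plane \<Rightarrow> plane" and g :: "plane \<Rightarrow> real"
  assumes unit_normal: "norm n = 1" and viscosity: "0 < \<nu>" and force: "in_L2 \<Omega> f"
    and threshold: "continuous_on (closure \<Gamma>1) g" "\<And>x. x \<in> \<Gamma>1 \<Longrightarrow> 0 < g x"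
    and inner_corner: "\<And>T. T \<in> \<T> \<Longrightarrow> \<exists>x\<in>corners T. x \<notin> frontier \<Omega>"
begin

definition X :: "plane set" where
  "X = \<Gamma>1 \<inter> mesh_nodes \<T>"

abbreviation "V \<equiv> V_nh \<Omega> \<Gamma>0 \<Gamma>1 n \<T>"
abbreviation "Q \<equiv> Q0_h \<Omega> \<T>"
abbreviation "tang \<equiv> tang_comp \<Gamma>1 n"

lemma X_eq: "X = M ` {2..m} \<union> half_node M ` {1..m}"
proof
  show "X \<subseteq> M ` {2..m} \<union> half_node M ` {1..m}" using slip_nodes by (auto simp: X_def)
  show "M ` {2..m} \<union> half_node M ` {1..m} \<subseteq> X"
  proof -
    have "M i \<in> mesh_nodes \<T>" if "i \<in> {2..m}" for i
      using M_vertex[of i] that by (auto simp: mesh_nodes_def)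
    then show ?thesis using slip_M slip_half_node half_node_mesh_node unfolding X_def by blast
  qed
qed

lemma finite_X: "finite X"
  by (simp add: X_eq)

lemma ends_not_X: "A \<notin> X" "B \<notin> X"
proof -
  have "A \<notin> \<Gamma>1" "B \<notin> \<Gamma>1" unfolding side(2) open_segment_def by auto
  then show "A \<notin> X" "B \<notin> X" by (simp_all add: X_def)
qed

lemma ends_nodes: "A \<in> mesh_nodes \<T>" "B \<in> mesh_nodes \<T>"
  using M_vertex[of 1] M_vertex[of "Suc m"] M_ends by (auto simp: mesh_nodes_def)

lemma M_cases: "i \<in> {1..Suc m} \<Longrightarrow> M i \<in> X \<or> M i = A \<or> M i = B"
proof -
  assume "i \<in> {1..Suc m}"
  then consider "i = 1" | "i = Suc m" | "i \<in> {2..m}" by (cases "i = 1"; cases "i = Suc m") auto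
  then show ?thesis using M_ends by cases (auto simp: X_eq)
qed

subsection \<open>Nodal functions\<close>

lemma hat_midpoint:
  assumes "closed_segment a b \<in> mesh_sides \<T>"
  shows "hat z (midpoint a b) = ((if a = z then 1 else 0) + (if b = z then 1 else 0)) / 2"
proof -
  obtain T where T: "T \<in> \<T>" "a \<in> corners T" "b \<in> corners T" using mesh_side_corners[OF assms] by blast
  obtain \<alpha> \<beta> where ab: "bary T z = (\<lambda>x. \<alpha> + \<beta> \<bullet> x)" using bary_affine[OF T(1)] by blast
  have "midpoint a b \<in> T"
    using T corners_subset closed_segment_subset[OF _ _ convex_mesh[OF T(1)], of a b] midpoint_in_closed_segment
    by blast
  then have "hat z (midpoint a b) = bary T z (midpoint a b)" using hat_eq[OF T(1)] by blast
  also have "\<dots> = (bary T z a + bary T z b) / 2"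
    by (simp add: ab midpoint_def inner_add_right field_simps)
  finally show ?thesis using bary_corner[OF T(1,2), of z] bary_corner[OF T(1,3), of z] by simp
qed

lemma mesh_node_cases:
  assumes "y \<in> mesh_nodes \<T>"
  obtains "y \<in> vertices"
    | a b where "y = midpoint a b" "closed_segment a b \<in> mesh_sides \<T>" "a \<noteq> b"
proof -
  consider "y \<in> vertices" | a b where "y = midpoint a b" "closed_segment a b \<in> mesh_sides \<T>"
    using assms unfolding mesh_nodes_def by blast
  then show thesis
  proof cases
    case (2 a b)
    obtain T where "a \<noteq> b" using mesh_side_corners[OF 2(2)] by blast
    then show thesis using that(2) 2 by blast
  qed (rule that(1))
qed

definition pw_quadratic :: "(plane \<Rightarrow> real) \<Rightarrow> bool" where
  "pw_quadratic \<phi> \<longleftrightarrow> continuous_on (closure \<Omega>) \<phi> \<and> (\<forall>y. y \<notin> closure \<Omega> \<longrightarrow> \<phi> y = 0) \<and>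
     (\<forall>T\<in>\<T>. poly_on 2 T \<phi>)"

definition is_nodal :: "plane \<Rightarrow> (plane \<Rightarrow> real) \<Rightarrow> bool" where
  "is_nodal x \<phi> \<longleftrightarrow> pw_quadratic \<phi> \<and> (\<forall>y\<in>mesh_nodes \<T>. \<phi> y = (if y = x then 1 else 0))"

lemma pw_quadratic_hats: "pw_quadratic (\<lambda>y. c * (hat z y * hat w y) + d * hat z y)"
  unfolding pw_quadratic_def using continuous_on_hat hat_outside unfolding cover
  by (auto intro!: continuous_intros poly_on_add poly_on_scale poly_on_2_mult
      intro: poly_on_hat poly_on_1_imp_2[OF poly_on_hat])

text \<open>The quadratic Lagrange function of a vertex: at mesh nodes \<open>hat x\<close> is 0,
  1/2 or 1, and \<open>2 * t * t - t\<close> keeps only the value 1, which occurs at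
  \<open>x\<close> alone.\<close>

lemma vertex_nodal:
  assumes x: "x \<in> vertices"
  shows "is_nodal x (\<lambda>y. 2 * (hat x y * hat x y) + (- 1) * hat x y)"
  unfolding is_nodal_def
proof (intro conjI ballI pw_quadratic_hats)
  fix y assume "y \<in> mesh_nodes \<T>"
  then show "2 * (hat x y * hat x y) + (- 1) * hat x y = (if y = x then 1 else 0)"
  proof (cases rule: mesh_node_cases)
    case 1
    then show ?thesis by (simp add: hat_vertex)
  next
    case (2 a b)
    have "hat x y \<noteq> 1"
      using 2(3) unfolding 2(1) hat_midpoint[OF 2(2)] by (auto split: if_splits)
    then have "y \<noteq> x" using hat_vertex[OF x, of x] by auto
    then show ?thesis using 2(3) unfolding 2(1) hat_midpoint[OF 2(2)] by auto
  qed
qed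

text \<open>The product of the two hats is 1/4 at the midpoint, hence the factor 4; the term with
  coefficient 0 only matches the shape of \<open>pw_quadratic_hats\<close>.\<close>

lemma half_node_nodal:
  assumes i: "i \<in> {1..m}"
  shows "is_nodal (half_node M i) (\<lambda>y. 4 * (hat (M i) y * hat (M (Suc i)) y) + 0 * hat (M i) y)"
  unfolding is_nodal_def
proof (intro conjI ballI pw_quadratic_hats)
  have ne: "M i \<noteq> M (Suc i)" using M_inject[of i "Suc i"] i by auto
  fix y assume "y \<in> mesh_nodes \<T>"
  then show "4 * (hat (M i) y * hat (M (Suc i)) y) + 0 * hat (M i) y = (if y = half_node M i then 1 else 0)"
  proof (cases rule: mesh_node_cases)
    case 1
    then have "y \<noteq> half_node M i" using half_node_not_vertex[OF i] by auto
    then show ?thesis using 1 ne by (simp add: hat_vertex)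
  next
    case (2 a b)
    show ?thesis
    proof (cases "{a, b} = {M i, M (Suc i)}")
      case True
      then have "y = half_node M i" unfolding 2(1) half_node_def by (auto simp: doubleton_eq_iff midpoint_sym)
      then show ?thesis
        using True ne unfolding 2(1) hat_midpoint[OF 2(2)] by (auto simp: doubleton_eq_iff)
    next
      case False
      then have z: "hat (M i) y * hat (M (Suc i)) y = 0"
        using 2(3) ne unfolding 2(1) hat_midpoint[OF 2(2)] by (auto simp: doubleton_eq_iff)
      obtain T where T: "T \<in> \<T>" "M i \<in> corners T" "M (Suc i) \<in> corners T" using slip_triangle[OF i] by blast
      \<comment> \<open>Different sides might a priori share their midpoint; the value 1/4 there
        against 0 at \<open>y\<close> rules this out.\<close>
      have "hat (M i) (half_node M i) * hat (M (Suc i)) (half_node M i) = 1 / 4"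
        using ne unfolding half_node_def hat_midpoint[OF corners_edge[OF T ne]] by simp
      then have "y \<noteq> half_node M i" using z by auto
      then show ?thesis using z by simp
    qed
  qed
qed

definition nodal :: "plane \<Rightarrow> plane \<Rightarrow> real" where
  "nodal x = (SOME \<phi>. is_nodal x \<phi>)"

lemma nodal:
  assumes "x \<in> X"
  shows "is_nodal x (nodal x)"
  unfolding nodal_def
proof (rule someI_ex[of "is_nodal x"])
  consider i where "i \<in> {2..m}" "x = M i" | i where "i \<in> {1..m}" "x = half_node M i"
    using assms X_eq by blast
  then show "\<exists>\<phi>. is_nodal x \<phi>"
  proof cases
    case 1
    then show ?thesis using vertex_nodal[OF M_vertex[of i]] by auto
  next
    case 2
    then show ?thesis using half_node_nodal by blast
  qed
qed

text \<open>Pointing along the tangent satisfies the normal condition identically.\<close>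

definition \<psi> :: "plane \<Rightarrow> plane \<Rightarrow> plane" where
  "\<psi> x = (\<lambda>y. nodal x y *\<^sub>R tangent n)"

lemma \<psi>_V:
  assumes x: "x \<in> X"
  shows "\<psi> x \<in> V"
proof -
  have nod: "is_nodal x (nodal x)" using nodal[OF x] .
  have "poly_on 2 T (\<lambda>y. \<psi> x y $ i)" if "T \<in> \<T>" for T i
    using poly_on_scale[of 2 T "nodal x" "tangent n $ i"] nod that
    by (simp add: is_nodal_def pw_quadratic_def \<psi>_def mult.commute)
  then have "\<psi> x \<in> Vh"
    using nod by (auto simp: V_h_def is_nodal_def pw_quadratic_def \<psi>_def intro!: continuous_intros)
  moreover have "\<psi> x y = 0" if y: "y \<in> closure \<Gamma>0 \<inter> mesh_nodes \<T>" for y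
  proof -
    have "y \<noteq> x" using y x slip_not_closure_Dirichlet by (auto simp: X_def)
    then show ?thesis using nod y by (simp add: is_nodal_def pw_quadratic_def \<psi>_def)
  qed
  ultimately show ?thesis by (simp add: V_nh_def \<psi>_def tangent_orthogonal)
qed

lemma X_closure: "x \<in> X \<Longrightarrow> x \<in> closure \<Gamma>1"
  using closure_subset by (auto simp: X_def)

lemma tang_\<psi>: "x \<in> X \<Longrightarrow> y \<in> X \<Longrightarrow> tang (\<psi> x) y = (if x = y then 1 else 0)"
  using nodal[of x] X_closure[of y] tangent_unit[OF unit_normal]
  by (auto simp: tang_comp_def \<psi>_def is_nodal_def pw_quadratic_def X_def)

lemma linear_form_tang: "linear_form W (\<lambda>v. tang v x)"
  by (auto simp: linear_form_def tang_comp_def inner_add_left)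

lemma tang_ends: "v \<in> V \<Longrightarrow> tang v A = 0" "v \<in> V \<Longrightarrow> tang v B = 0"
  using endpoints ends_nodes by (auto simp: V_nh_def tang_comp_def)

lemma V_V_h: "v \<in> V \<Longrightarrow> v \<in> Vh"
  by (simp add: V_nh_def)

lemma subspace_V: "subspace V"
proof (rule subspaceI)
  show "0 \<in> V" using subspace_0[OF subspace_V_h] by (simp add: V_nh_def)
  show "u + v \<in> V" if "u \<in> V" "v \<in> V" for u v
    using that subspace_add[OF subspace_V_h] by (simp add: V_nh_def inner_add_left)
  show "c *\<^sub>R v \<in> V" if "v \<in> V" for c v
    using that subspace_scale[OF subspace_V_h] by (simp add: V_nh_def)
qed

lemma inner_product_a: "inner_product_on V (a_form \<nu> \<Omega>)"
  unfolding inner_product_on_def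
proof (intro conjI ballI impI)
  fix v assume v: "v \<in> V"
  show "linear_form V (a_form \<nu> \<Omega> v)"
    using linear_form_subset[OF linear_form_a[OF V_V_h[OF v]]] V_V_h by blast
  show "a_form \<nu> \<Omega> v w = a_form \<nu> \<Omega> w v" for w by (rule a_form_sym)
  assume "v \<noteq> 0"
  moreover have "A \<in> closure \<Omega>" "B \<in> closure \<Omega>"
    using endpoints boundary(1) by (auto simp: frontier_def)
  moreover have "v A = 0" "v B = 0" using v endpoints ends_nodes by (auto simp: V_nh_def)
  ultimately have "a_form \<nu> \<Omega> v v \<noteq> 0"
    using a_form_definite[OF viscosity V_V_h[OF v]] side(3) by blast
  then show "0 < a_form \<nu> \<Omega> v v" using a_form_nonneg[OF viscosity, of v] by linarith
qed

subsection \<open>The quadrature rule\<close>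

text \<open>The composite Simpson rule with density \<open>g\<close>; both
  \<open>Lambda_inner\<close> and \<open>j_h\<close> are instances of it.\<close>

definition quadrature :: "(plane \<Rightarrow> real) \<Rightarrow> real" where
  "quadrature \<phi> = 1 / 6 * (\<Sum>i = 1..m. dist (M i) (M (Suc i)) *
     (g (M i) * \<phi> (M i) + 4 * g (half_node M i) * \<phi> (half_node M i) + g (M (Suc i)) * \<phi> (M (Suc i))))"

text \<open>Collects all contributions to a node: a vertex inside the slip side receives one from
  each adjacent mesh side.\<close>

definition weight :: "plane \<Rightarrow> real" where
  "weight x = quadrature (\<lambda>y. if y = x then 1 else 0)"

lemma quadrature_cong:
  assumes "\<And>y. y \<in> X \<or> y = A \<or> y = B \<Longrightarrow> \<phi> y = \<phi>' y"
  shows "quadrature \<phi> = quadrature \<phi>'"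
proof -
  have "\<phi> (M i) = \<phi>' (M i)" "\<phi> (M (Suc i)) = \<phi>' (M (Suc i))" "\<phi> (half_node M i) = \<phi>' (half_node M i)"
    if "i \<in> {1..m}" for i
    using M_cases[of i] M_cases[of "Suc i"] that by (auto intro!: assms simp: X_eq)
  then show ?thesis unfolding quadrature_def by simp
qed

lemma quadrature_eq:
  assumes "\<phi> A = 0" "\<phi> B = 0"
  shows "quadrature \<phi> = (\<Sum>x\<in>X. weight x * \<phi> x)"
proof -
  have lin: "quadrature (\<lambda>y. \<Sum>x\<in>I. \<phi> x * (if y = x then 1 else 0)) = (\<Sum>x\<in>I. \<phi> x * weight x)"
    if "finite I" for I
    using that
  proof (induction I)
    case (insert x I)
    have lin2: "quadrature (\<lambda>y. c * d y + e y) = c * quadrature d + quadrature e" for c d e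
      by (simp add: quadrature_def sum_distrib_left algebra_simps flip: sum.distrib)
    show ?case by (simp only: sum.insert[OF insert(1,2)] lin2 insert(3)) (simp add: weight_def)
  qed (simp add: quadrature_def)
  have "quadrature \<phi> = quadrature (\<lambda>y. \<Sum>x\<in>X. \<phi> x * (if y = x then 1 else 0))"
  proof (rule quadrature_cong)
    fix y assume "y \<in> X \<or> y = A \<or> y = B"
    moreover have "(\<Sum>x\<in>X. \<phi> x * (if y = x then 1 else 0)) = (\<Sum>x\<in>X. if y = x then \<phi> x else 0)"
      by (intro sum.cong) auto
    ultimately show "\<phi> y = (\<Sum>x\<in>X. \<phi> x * (if y = x then 1 else 0))"
      using assms ends_not_X finite_X by auto
  qed
  then show ?thesis using lin[OF finite_X] by (simp add: mult.commute)
qed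

text \<open>Continuity extends \<open>0 \<le> g\<close> to the ends, so no summand is negative, and
  one containing \<open>x\<close> is positive. At \<open>A\<close> and \<open>B\<close>, which are
  not in \<open>X\<close>, \<open>g\<close> may vanish.\<close>

lemma weight_pos:
  assumes x: "x \<in> X"
  shows "0 < weight x"
proof -
  have g0: "0 \<le> g y" if "y \<in> closure \<Gamma>1" for y
    using continuous_ge_on_closure[OF threshold(1) that] threshold(2) less_imp_le by blast
  have gx: "0 < g x" using x threshold(2) by (simp add: X_def)
  have MX: "M i \<in> closure \<Gamma>1" if "i \<in> {1..Suc m}" for i
    using nodes that unfolding side(1) side_vertices_def by blast
  define \<delta> where "\<delta> y = (if y = x then 1 else 0 :: real)" for y
  define s where "s i = g (M i) * \<delta> (M i) + 4 * g (half_node M i) * \<delta> (half_node M i)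
      + g (M (Suc i)) * \<delta> (M (Suc i))" for i
  have nonneg: "0 \<le> g (M i) * \<delta> (M i)" "0 \<le> 4 * g (half_node M i) * \<delta> (half_node M i)"
    "0 \<le> g (M (Suc i)) * \<delta> (M (Suc i))" if i: "i \<in> {1..m}" for i
    using g0[OF MX[of i]] g0[OF MX[of "Suc i"]] g0[OF X_closure[of "half_node M i"]] i
    by (auto simp: X_eq \<delta>_def)
  have d: "0 < dist (M i) (M (Suc i))" if "i \<in> {1..m}" for i
    using M_inject[of i "Suc i"] that by auto
  consider i where "i \<in> {2..m}" "x = M i" | i where "i \<in> {1..m}" "x = half_node M i"
    using x X_eq by blast
  then obtain i where i: "i \<in> {1..m}" "x = M i \<or> x = half_node M i"
  proof cases
    case (1 i)
    then show thesis by (intro that[of i]) auto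
  qed (use that in blast)
  have "0 < g (M i) * \<delta> (M i) \<or> 0 < 4 * g (half_node M i) * \<delta> (half_node M i)"
    using i(2) gx by (auto simp: \<delta>_def)
  then have "0 < s i" unfolding s_def using nonneg[OF i(1)] by linarith
  then have "0 < dist (M i) (M (Suc i)) * s i" using d[OF i(1)] by simp
  moreover have "0 \<le> dist (M k) (M (Suc k)) * s k" if "k \<in> {1..m}" for k
    using nonneg[OF that] by (simp add: s_def)
  ultimately have "0 < (\<Sum>i = 1..m. dist (M i) (M (Suc i)) * s i)" using i(1) by (intro sum_pos2) auto
  then show ?thesis by (simp add: weight_def quadrature_def s_def \<delta>_def)
qed

lemma Lambda_inner_eq:
  assumes "l A = 0" "l B = 0"
  shows "Lambda_inner g m M l \<mu> = (\<Sum>x\<in>X. weight x * l x * \<mu> x)"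
  using quadrature_eq[of "\<lambda>x. l x * \<mu> x"] assms by (simp add: Lambda_inner_def quadrature_def mult.assoc)

lemma j_h_eq:
  assumes "\<eta> A = 0" "\<eta> B = 0"
  shows "j_h g m M \<eta> = (\<Sum>x\<in>X. weight x * \<bar>\<eta> x\<bar>)"
  using quadrature_eq[of "\<lambda>x. \<bar>\<eta> x\<bar>"] assms by (simp add: j_h_def quadrature_def)

subsection \<open>The multiplier space\<close>

text \<open>Consecutive slip vertices are corners of one triangle, so the trace between them is a
  single quadratic.\<close>

lemma tang_Lambda_h:
  assumes v: "v \<in> V"
  shows "tang v \<in> Lambda_h \<Gamma>1 m M"
proof -
  have "continuous_on (closure \<Gamma>1) v"
    using continuous_on_V_h[OF V_V_h[OF v]] closure_mono[OF slip_closure] continuous_on_subset by fastforce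
  then have "continuous_on (closure \<Gamma>1) (\<lambda>x. v x \<bullet> tangent n)" by (intro continuous_intros)
  then have cont: "continuous_on (closure \<Gamma>1) (tang v)"
    by (rule continuous_on_eq) (simp add: tang_comp_def)
  have "poly_on 2 (closed_segment (M i) (M (Suc i))) (tang v)" if i: "i \<in> {1..m}" for i
  proof -
    obtain T where T: "T \<in> \<T>" "M i \<in> corners T" "M (Suc i) \<in> corners T" using slip_triangle[OF i] by blast
    have sub: "closed_segment (M i) (M (Suc i)) \<subseteq> T"
      using T corners_subset by (intro closed_segment_subset convex_mesh) auto
    have "M i \<in> closed_segment A B" "M (Suc i) \<in> closed_segment A B"
      using nodes i unfolding side_vertices_def by auto
    then have sub': "closed_segment (M i) (M (Suc i)) \<subseteq> closure \<Gamma>1"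
      unfolding side(1) by (simp add: closed_segment_subset)
    have comp: "poly_on 2 T (\<lambda>x. v x $ k)" for k using V_V_h[OF v] T(1) by (simp add: V_h_def)
    have "poly_on 2 T (\<lambda>x. tangent n $ 1 * v x $ 1 + tangent n $ 2 * v x $ 2)"
      by (intro poly_on_add poly_on_scale comp)
    then have "poly_on 2 (closed_segment (M i) (M (Suc i))) (\<lambda>x. tangent n $ 1 * v x $ 1 + tangent n $ 2 * v x $ 2)"
      using sub by (rule poly_on_subset)
    then show ?thesis
      unfolding poly_on_def using sub'
      by (auto simp: tang_comp_def inner_vec_def sum_2 mult.commute subset_iff elim!: bexI[rotated])
  qed
  then show ?thesis
    using cont tang_ends[OF v] M_ends by (auto simp: Lambda_h_def tang_comp_def)
qed

text \<open>The tangential trace of a combination of the \<open>\<psi> x\<close> has the prescribed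
  nodal values.\<close>

lemma Lambda_h_interpolation:
  obtains l where "l \<in> Lambda_h \<Gamma>1 m M" "\<And>x. x \<in> X \<Longrightarrow> l x = c x"
proof
  let ?v = "\<Sum>x\<in>X. c x *\<^sub>R \<psi> x"
  have "?v \<in> V" using \<psi>_V subspace_V by (intro subspace_sum subspace_scale) auto
  then show "tang ?v \<in> Lambda_h \<Gamma>1 m M" by (rule tang_Lambda_h)
  fix y assume y: "y \<in> X"
  have "tang ?v y = (\<Sum>x\<in>X. c x * tang (\<psi> x) y)"
    using \<psi>_V by (intro linear_form_sum[OF linear_form_tang subspace_V])
  also have "\<dots> = (\<Sum>x\<in>X. if y = x then c x else 0)" using y by (intro sum.cong) (auto simp: tang_\<psi>)
  finally show "tang ?v y = c y" using y finite_X by simp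
qed

lemma Lambda_h_ends: "l \<in> Lambda_h \<Gamma>1 m M \<Longrightarrow> l A = 0" "l \<in> Lambda_h \<Gamma>1 m M \<Longrightarrow> l B = 0"
  using M_ends by (auto simp: Lambda_h_def)

text \<open>Every slip point is a vertex or lies on some side between consecutive vertices, where
  the difference is a quadratic with zeros at both ends and at the midpoint.\<close>

lemma Lambda_h_eqI:
  assumes l: "l \<in> Lambda_h \<Gamma>1 m M" "l' \<in> Lambda_h \<Gamma>1 m M" and eq: "\<And>x. x \<in> X \<Longrightarrow> l x = l' x"
  shows "l = l'"
proof
  fix x
  define d where "d y = l y + (- 1) * l' y" for y
  have dX: "d y = 0" if "y \<in> X \<or> y = A \<or> y = B" for y
    using that eq Lambda_h_ends[OF l(1)] Lambda_h_ends[OF l(2)] by (auto simp: d_def)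
  have "x = A \<or> x = B" if "x \<in> closure \<Gamma>1" "x \<notin> \<Gamma>1"
    using that(2) that(1)[unfolded side(1)] unfolding side(2) by (auto simp: open_segment_def)
  then consider "x \<notin> closure \<Gamma>1" | "x \<in> vertices" "x \<in> closure \<Gamma>1"
    | "x \<notin> vertices" "x \<in> \<Gamma>1" | "x = A \<or> x = B"
    by blast
  then have "d x = 0"
  proof cases
    case 1
    then show ?thesis using l by (simp add: Lambda_h_def d_def)
  next
    case 2
    then obtain i where "i \<in> {1..Suc m}" "x = M i" using vertex_on_side side(1) by blast
    then show ?thesis using M_cases dX by blast
  next
    case 3
    then obtain i where i: "i \<in> {1..m}" "x \<in> open_segment (M i) (M (Suc i))"
      using edge_through_slip_point by blast
    have "poly_on 2 (closed_segment (M i) (M (Suc i))) l" "poly_on 2 (closed_segment (M i) (M (Suc i))) l'"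
      using l i(1) by (auto simp: Lambda_h_def)
    then have poly: "poly_on 2 (closed_segment (M i) (M (Suc i))) d"
      unfolding d_def[abs_def] by (intro poly_on_add poly_on_scale)
    have ends: "d (M i) = 0" "d (M (Suc i)) = 0" using M_cases[of i] M_cases[of "Suc i"] i(1) by (auto intro: dX)
    have mid: "d (midpoint (M i) (M (Suc i))) = 0"
      using i(1) by (intro dX) (auto simp: X_eq simp flip: half_node_def)
    show ?thesis
      by (rule quadratic_zero_on_segment[OF poly ends(1) mid ends(2) open_closed_segment[OF i(2)]])
  qed (use dX in blast)
  then show "l x = l' x" by (simp add: d_def)
qed

text \<open>Velocities vanishing on the whole boundary lie in \<open>V\<close> and have no slip
  values, so the bubbles suffice for the condition on \<open>V0\<close>.\<close>

lemma inf_sup_V: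
  assumes q: "q \<in> Q" and zero: "\<And>v. v \<in> V \<Longrightarrow> \<forall>x\<in>X. tang v x = 0 \<Longrightarrow> b_form \<Omega> v q = 0"
  shows "q = 0"
proof (rule inf_sup[OF inner_corner q])
  fix v assume v: "v \<in> Vh" "\<forall>x\<in>frontier \<Omega>. v x = 0"
  have "v x = 0" if "x \<in> closure \<Gamma>0 \<or> x \<in> closure \<Gamma>1" for x using that v(2) boundary(1) by blast
  moreover have "x \<in> closure \<Gamma>1" if "x \<in> \<Gamma>1" for x using that closure_subset by blast
  ultimately have "v \<in> V" "\<forall>x\<in>X. tang v x = 0" using v(1) by (auto simp: V_nh_def tang_comp_def)
  then show "b_form \<Omega> v q = 0" by (rule zero)
qed

sublocale friction_problem V Q X "a_form \<nu> \<Omega>" "b_form \<Omega>" "L2_inner \<Omega> f" "\<lambda>x v. tang v x" weight \<psi>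
proof
  show "subspace V" by (rule subspace_V)
  show "\<exists>A. finite A \<and> V \<subseteq> span A" using finite_dimensional_V_h V_V_h by (meson subset_iff)
  show "subspace Q" by (rule subspace_Q0_h)
  show "\<exists>C. finite C \<and> Q \<subseteq> span C"
    using finite_dimensional_Q_h by (auto simp: Q0_h_def)
  show "inner_product_on V (a_form \<nu> \<Omega>)" by (rule inner_product_a)
  show "linear_form V (L2_inner \<Omega> f)"
    using linear_form_subset[OF linear_form_L2_inner[OF force]] V_V_h by blast
  show "linear_form V (\<lambda>v. b_form \<Omega> v q)" if "q \<in> Q" for q
    using linear_form_subset[OF linear_form_b_left, of q V] V_V_h that by (auto simp: Q0_h_def)
  show "linear_form Q (b_form \<Omega> v)" if "v \<in> V" for v
    using linear_form_subset[OF linear_form_b_right[OF V_V_h[OF that]], of Q] by (auto simp: Q0_h_def)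
qed (use finite_X weight_pos linear_form_tang \<psi>_V tang_\<psi> inf_sup_V in auto)

section \<open>Translation between the concrete and the abstract problems\<close>

lemma j_eq: "v \<in> V \<Longrightarrow> j_h g m M (tang v) = j v"
  using j_h_eq tang_ends by (simp add: j_def)

lemma S_eq: "S = V_nh_sigma \<Omega> \<Gamma>0 \<Gamma>1 n \<T>"
  by (simp add: S_def V_nh_sigma_def)

lemma diff_eq: "(\<lambda>x. v x - u x) = v - u" for u v :: "plane \<Rightarrow> plane"
  by (simp add: fun_diff_def)

lemma solves_VI_sigma_iff: "solves_VI_sigma \<Omega> \<Gamma>0 \<Gamma>1 n \<nu> f g \<T> m M u \<longleftrightarrow> VI_sigma u"
proof -
  have j: "j_h g m M (tang v) = j v" if "v \<in> S" for v by (rule j_eq[OF SV[OF that]])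
  show ?thesis
    unfolding solves_VI_sigma_def VI_sigma_def diff_eq[of _ u] S_eq[symmetric]
    by (intro conj_cong refl ball_cong) (simp only: j)
qed

lemma solves_VI_iff: "solves_VI \<Omega> \<Gamma>0 \<Gamma>1 n \<nu> f g \<T> m M u p \<longleftrightarrow> VI u p"
proof -
  have "(\<forall>v\<in>V. L2_inner \<Omega> f (v - u) \<le> a_form \<nu> \<Omega> u (v - u) + b_form \<Omega> (v - u) p
      + j_h g m M (tang v) - j_h g m M (tang u)) \<longleftrightarrow>
    (\<forall>v\<in>V. L2_inner \<Omega> f (v - u) \<le> a_form \<nu> \<Omega> u (v - u) + b_form \<Omega> (v - u) p + j v - j u)" if "u \<in> V"
    by (intro ball_cong refl) (simp only: j_eq that)
  then show ?thesis unfolding solves_VI_def VI_def diff_eq[of _ u] S_def by blast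
qed

text \<open>\<open>VE\<close> tests with arbitrary bounded nodal values, the concrete problem with
  functions in \<open>Lambda_tilde_h\<close>; interpolation realises all such values, so both
  families of tests are equivalent.\<close>

lemma solves_VE_iff:
  "solves_VE \<Omega> \<Gamma>0 \<Gamma>1 n \<nu> f g \<T> m M u p l \<longleftrightarrow> l \<in> Lambda_h \<Gamma>1 m M \<and> VE u p l"
proof -
  have Lt: "\<mu> \<in> Lambda_tilde_h \<Gamma>1 \<T> m M \<longleftrightarrow> \<mu> \<in> Lambda_h \<Gamma>1 m M \<and> (\<forall>x\<in>X. \<bar>\<mu> x\<bar> \<le> 1)" for \<mu>
    by (auto simp: Lambda_tilde_h_def X_def)
  have inner_eq: "Lambda_inner g m M (tang v) \<mu> = (\<Sum>x\<in>X. weight x * tang v x * \<mu> x)" if "v \<in> V" for v \<mu>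
    using Lambda_inner_eq tang_ends that by blast
  have test: "(\<forall>\<mu>\<in>Lambda_tilde_h \<Gamma>1 \<T> m M. Lambda_inner g m M (tang u) (\<lambda>x. \<mu> x - l x) \<le> 0) \<longleftrightarrow>
      (\<forall>\<mu>. (\<forall>x\<in>X. \<bar>\<mu> x\<bar> \<le> 1) \<longrightarrow> (\<Sum>x\<in>X. weight x * tang u x * (\<mu> x - l x)) \<le> 0)" if u: "u \<in> V"
  proof (intro iffI allI impI ballI)
    fix \<mu> assume *: "\<forall>\<mu>\<in>Lambda_tilde_h \<Gamma>1 \<T> m M. Lambda_inner g m M (tang u) (\<lambda>x. \<mu> x - l x) \<le> 0"
      and \<mu>: "\<forall>x\<in>X. \<bar>\<mu> x\<bar> \<le> (1::real)"
    obtain \<mu>' where \<mu>': "\<mu>' \<in> Lambda_h \<Gamma>1 m M" "\<And>x. x \<in> X \<Longrightarrow> \<mu>' x = \<mu> x"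
      using Lambda_h_interpolation[of \<mu>] by blast
    then have "\<mu>' \<in> Lambda_tilde_h \<Gamma>1 \<T> m M" using \<mu> Lt by simp
    then have "(\<Sum>x\<in>X. weight x * tang u x * (\<mu>' x - l x)) \<le> 0" using * inner_eq[OF u] by simp
    then show "(\<Sum>x\<in>X. weight x * tang u x * (\<mu> x - l x)) \<le> 0" using \<mu>'(2) by simp
  qed (use inner_eq[OF u] Lt in auto)
  show ?thesis
    unfolding solves_VE_def VE_def Lt S_def using test inner_eq by auto
qed

lemma VE_cong: "(\<And>x. x \<in> X \<Longrightarrow> l x = l' x) \<Longrightarrow> VE u p l \<longleftrightarrow> VE u p l'"
  by (simp add: VE_def cong: sum.cong)

text \<open>The abstract problem fixes the multiplier at the nodes, and these values have exactly
  one extension in \<open>Lambda_h\<close>.\<close>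

lemma ex1_solves_VE:
  assumes "VI u p"
  shows "\<exists>!l. solves_VE \<Omega> \<Gamma>0 \<Gamma>1 n \<nu> f g \<T> m M u p l"
proof -
  obtain l0 where l0: "VE u p l0" using VI_imp_VE[OF assms] by blast
  obtain l where l: "l \<in> Lambda_h \<Gamma>1 m M" "\<And>x. x \<in> X \<Longrightarrow> l x = l0 x"
    using Lambda_h_interpolation[of l0] by blast
  then have "VE u p l" using l0 VE_cong[of l l0] by blast
  then show ?thesis
    unfolding solves_VE_iff using l(1) Lambda_h_eqI VE_unique by blast
qed

end

theorem theorem4p1:
  fixes \<Omega> \<Gamma>0 \<Gamma>1 :: "(real^2) set"
    and P :: "(real^2) list set"
    and A B n :: "real^2"
    and \<nu> :: real and f :: "real^2 \<Rightarrow> real^2" and g :: "real^2 \<Rightarrow> real"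
    and K K' :: real and H :: "real set" and \<T> :: "real \<Rightarrow> (real^2) set set"
    and m :: "real \<Rightarrow> nat" and M :: "real \<Rightarrow> nat \<Rightarrow> real^2" and h :: real
  assumes domain: "polygonal_domain \<Omega> P"
    and boundary: "frontier \<Omega> = closure \<Gamma>0 \<union> closure \<Gamma>1"
      "\<Gamma>0 \<inter> \<Gamma>1 = {}" "\<Gamma>0 \<noteq> {}" "\<Gamma>1 \<noteq> {}"
      "openin (top_of_set (frontier \<Omega>)) \<Gamma>0" "openin (top_of_set (frontier \<Omega>)) \<Gamma>1"
    and whole_side: "\<exists>vs\<in>P. \<exists>i<length vs. closure \<Gamma>1 = polygon_side vs i"
    and side: "closure \<Gamma>1 = closed_segment A B" "\<Gamma>1 = open_segment A B"
    and normal: "outer_unit_normal \<Omega> \<Gamma>1 n"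
    and viscosity: "\<nu> > 0"
    and force: "in_L2 \<Omega> f"
    and threshold: "continuous_on (closure \<Gamma>1) g" "\<forall>x\<in>\<Gamma>1. g x > 0"
    and meshes: "regular_mesh_family \<Omega> K K' H \<T>"
    and nodes: "\<forall>h\<in>H. side_vertices (\<T> h) A B (m h) (M h)"
    and h: "h \<in> H"
  shows "(\<exists>!u. solves_VI_sigma \<Omega> \<Gamma>0 \<Gamma>1 n \<nu> f g (\<T> h) (m h) (M h) u) \<and>
    (\<forall>u. solves_VI_sigma \<Omega> \<Gamma>0 \<Gamma>1 n \<nu> f g (\<T> h) (m h) (M h) u \<longrightarrow>
       a_form \<nu> \<Omega> u u + j_h g (m h) (M h) (tang_comp \<Gamma>1 n u) = L2_inner \<Omega> f u) \<and>
    (\<forall>u. solves_VI_sigma \<Omega> \<Gamma>0 \<Gamma>1 n \<nu> f g (\<T> h) (m h) (M h) u \<longrightarrow>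
       (\<exists>!p. solves_VI \<Omega> \<Gamma>0 \<Gamma>1 n \<nu> f g (\<T> h) (m h) (M h) u p)) \<and>
    (\<forall>u p. solves_VI \<Omega> \<Gamma>0 \<Gamma>1 n \<nu> f g (\<T> h) (m h) (M h) u p \<longrightarrow>
       (\<exists>!l. solves_VE \<Omega> \<Gamma>0 \<Gamma>1 n \<nu> f g (\<T> h) (m h) (M h) u p l)) \<and>
    (\<forall>u p l. solves_VE \<Omega> \<Gamma>0 \<Gamma>1 n \<nu> f g (\<T> h) (m h) (M h) u p l \<longrightarrow>
       solves_VI_sigma \<Omega> \<Gamma>0 \<Gamma>1 n \<nu> f g (\<T> h) (m h) (M h) u)"
proof -
  have mesh: "mesh_of \<Omega> (\<T> h)" using meshes h by (simp add: regular_mesh_family_def)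
  \<comment> \<open>For \<open>A = B\<close> the open segment would be empty.\<close>
  have AB: "A \<noteq> B" using boundary(4) side(2) by auto
  interpret domain_mesh "\<T> h" \<Omega>
  proof
    show "triangulation (\<T> h)" "\<And>T. T \<in> \<T> h \<Longrightarrow> 2 simplex T" "\<Union> (\<T> h) = closure \<Omega>"
      using mesh by (auto simp: mesh_of_def)
    show "open \<Omega>" "connected \<Omega>" "\<Omega> \<noteq> {}" using domain by (auto simp: polygonal_domain_def)
    show "frontier \<Omega> \<inter> interior (closure \<Omega>) = {}" using frontier_polygonal_domain[OF domain] .
    show "negligible (frontier \<Omega>)" using negligible_frontier_polygonal_domain[OF domain] .
  qed
  have ends: "A \<in> closure \<Gamma>0 \<and> B \<in> closure \<Gamma>0"
    using polygon_side_ends[OF domain whole_side boundary(1) side(1)] .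
  interpret friction_mesh "\<T> h" \<Omega> \<Gamma>0 \<Gamma>1 A B "m h" "M h" n \<nu> f g
  proof
    show "norm n = 1" using normal by (simp add: outer_unit_normal_def)
    show "side_vertices (\<T> h) A B (m h) (M h)" using nodes h by blast
    show "\<exists>x\<in>corners T. x \<notin> frontier \<Omega>" if "T \<in> \<T> h" for T
      using mesh that by (auto simp: mesh_of_def corners_def)
  qed (use assms AB ends in auto)
  have "a_form \<nu> \<Omega> u u + j_h g (m h) (M h) (tang_comp \<Gamma>1 n u) = L2_inner \<Omega> f u" if "VI_sigma u" for u
  proof -
    have "u \<in> V" using that SV unfolding VI_sigma_def by blast
    then show ?thesis using VI_sigma_energy[OF that] j_eq by simp
  qed
  moreover have "VI_sigma u" if "solves_VE \<Omega> \<Gamma>0 \<Gamma>1 n \<nu> f g (\<T> h) (m h) (M h) u p l" for u p l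
    using that VE_imp_VI_sigma unfolding solves_VE_iff by blast
  ultimately show ?thesis
    unfolding solves_VI_sigma_iff solves_VI_iff
    using ex1_VI_sigma VI_sigma_imp_ex1_VI ex1_solves_VE by blast
qed

end
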